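(* Let $p,q>1$, let $K\in\mathcal{K}_o^n$, and let $f:\mathbb{S}^{n-1}\to\mathbb{R}$ be a continuous function. For sufficiently small $\delta>0$ and each $t\in(-\delta,\delta)$, define $h_t=(h_K^p+tf^p)^{\frac1p}$ on $\mathbb{S}^{n-1}$. Then $$\lim_{t\to 0}\frac{\widetilde{V}_{\gamma_n,q}([h_t])-\widetilde{V}_{\gamma_n,q}(K)}{t}=\frac1p\int_{\mathbb{S}^{n-1}}f(v)^p\,d\widetilde{C}_{p,\gamma_n,q}(K,v).$$
   Context: $\mathbb{S}^{n-1}$ is the unit sphere of $\mathbb{R}^n$. A convex body in $\mathbb{R}^n$ is a compact convex set with nonempty interior; $\mathcal{K}_o^n$ is the set of convex bodies containing the origin in their interiors. The support function of $K$ is $h_K(v)=\max\{\langle v,y\rangle:y\in K\}$. For a positive continuous function $h$ on $\mathbb{S}^{n-1}$, its Wulff shape is the convex body $[h]=\{x\in\mathbb{R}^n:\langle x,v\rangle\leq h(v)\text{ for all }v\in\mathbb{S}^{n-1}\}$. For $q>0$ the Gaussian dual quermassintegral of $K\in\mathcal{K}_o^n$ is $$\widetilde{V}_{\gamma_n,q}(K)=\int_K e^{-\frac{|x|^2}{2}}|x|^{q-n}\,dx,$$ where $dx$ is Lebesgue measure on $\mathbb{R}^n$. For $K\in\mathcal{K}_o^n$, $\partial' K$ is the set of boundary points $x\in\partial K$ at which $K$ has a unique outer unit normal, denoted $\nu_K(x)\in\mathbb{S}^{n-1}$; its complement in $\partial K$ has $\mathcal{H}^{n-1}$-measure zero, where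 $\mathcal{H}^{n-1}$ is $(n-1)$-dimensional Hausdorff measure. For $\eta\subset\mathbb{S}^{n-1}$, $\nu_K^{-1}(\eta)=\{x\in\partial' K:\nu_K(x)\in\eta\}$. The $L_p$ Gaussian dual curvature measure of $K$ is the Borel measure on $\mathbb{S}^{n-1}$ given, for Borel $\eta\subset\mathbb{S}^{n-1}$, by $$\widetilde{C}_{p,\gamma_n,q}(K,\eta)=\int_{\nu_K^{-1}(\eta)}\langle x,\nu_K(x)\rangle^{1-p}\,|x|^{q-n}\,e^{-\frac{|x|^2}{2}}\,d\mathcal{H}^{n-1}(x).$$ *)

theory Defs
  imports "HOL-Analysis.Analysis"
begin

definition convex_body :: "(real^'n) set \<Rightarrow> bool" where
  "convex_body K \<longleftrightarrow> compact K \<and> convex K \<and> interior K \<noteq> {}"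

definition convex_bodies_o :: "(real^'n) set set" where
  "convex_bodies_o = {K. convex_body K \<and> 0 \<in> interior K}"

definition support_fun :: "(real^'n) set \<Rightarrow> real^'n \<Rightarrow> real" where
  "support_fun K v = (SUP y\<in>K. v \<bullet> y)"

definition wulff_shape :: "(real^'n \<Rightarrow> real) \<Rightarrow> (real^'n) set" where
  "wulff_shape h = {x. \<forall>v\<in>sphere 0 1. x \<bullet> v \<le> h v}"

definition gauss_dual_quermass :: "real \<Rightarrow> (real^'n) set \<Rightarrow> real" where
  "gauss_dual_quermass q K =
     (LINT x:K|lborel. exp (- (norm x)\<^sup>2 / 2) * norm x powr (q - real CARD('n)))"

text \<open>
  Hausdorff measure of integer dimension \<open>k\<close>, normalised by the volume of the unit ball of
  dimension \<open>k\<close>, so that it is Lebesgue measure on \<open>k\<close>-dimensional Euclidean space and surface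
  area on smooth hypersurfaces. Covering sets are required to be bounded because \<open>diameter\<close>
  has no meaningful value on unbounded sets; the empty set gets weight \<open>0\<close> also for \<open>k = 0\<close>,
  where \<open>0 ^ 0 = 1\<close> gives a singleton weight \<open>1\<close> (counting measure).
\<close>

definition hausdorff_weight :: "nat \<Rightarrow> 'a::metric_space set \<Rightarrow> ennreal" where
  "hausdorff_weight k A =
     (if A = {} then 0 else ennreal (unit_ball_vol (real k) * (diameter A / 2) ^ k))"

definition hausdorff_premeasure :: "nat \<Rightarrow> real \<Rightarrow> 'a::metric_space set \<Rightarrow> ennreal" where
  "hausdorff_premeasure k \<delta> S =
     (INF A \<in> {A :: nat \<Rightarrow> 'a set. (\<forall>i. bounded (A i) \<and> diameter (A i) \<le> \<delta>) \<and> S \<subseteq> (\<Union>i. A i)}.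
        (\<Sum>i. hausdorff_weight k (A i)))"

definition hausdorff_outer :: "nat \<Rightarrow> 'a::metric_space set \<Rightarrow> ennreal" where
  "hausdorff_outer k S = (SUP \<delta>\<in>{0<..}. hausdorff_premeasure k \<delta> S)"

definition hausdorff_measure :: "nat \<Rightarrow> 'a::metric_space measure" where
  "hausdorff_measure k = measure_of UNIV (sets borel) (hausdorff_outer k)"

definition outer_unit_normal :: "(real^'n) set \<Rightarrow> real^'n \<Rightarrow> real^'n \<Rightarrow> bool" where
  "outer_unit_normal K x v \<longleftrightarrow> norm v = 1 \<and> (\<forall>y\<in>K. v \<bullet> (y - x) \<le> 0)"

definition regular_boundary :: "(real^'n) set \<Rightarrow> (real^'n) set" where
  "regular_boundary K = {x \<in> frontier K. \<exists>!v. outer_unit_normal K x v}"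

definition gauss_map :: "(real^'n) set \<Rightarrow> real^'n \<Rightarrow> real^'n" where
  "gauss_map K x = (THE v. outer_unit_normal K x v)"

definition inverse_gauss_image :: "(real^'n) set \<Rightarrow> (real^'n) set \<Rightarrow> (real^'n) set" where
  "inverse_gauss_image K \<eta> = {x \<in> regular_boundary K. gauss_map K x \<in> \<eta>}"

definition Lp_gauss_dual_curv :: "real \<Rightarrow> real \<Rightarrow> (real^'n) set \<Rightarrow> (real^'n) measure" where
  "Lp_gauss_dual_curv p q K =
     measure_of (sphere 0 1) (sets (restrict_space borel (sphere 0 1)))
       (\<lambda>\<eta>. \<integral>\<^sup>+x\<in>inverse_gauss_image K \<eta>.
              ennreal ((x \<bullet> gauss_map K x) powr (1 - p) * norm x powr (q - real CARD('n))
                * exp (- (norm x)\<^sup>2 / 2))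
            \<partial>hausdorff_measure (CARD('n) - 1))"

text \<open>
  The power \<open>s\<^sup>p\<close> of a possibly negative real \<open>s\<close>. It is the usual power when \<open>s \<ge> 0\<close> or
  \<open>p\<close> is an integer. For \<open>s < 0\<close> and non-integer \<open>p\<close>, where there is no standard real value,
  it is the odd extension \<open>- \<bar>s\<bar>\<^sup>p\<close>. (\<open>powr\<close> alone would not do: on negative
  reals it is \<open>\<bar>s\<bar>\<^sup>p\<close>, which is wrong for odd integers \<open>p\<close>.)
\<close>

definition rpow :: "real \<Rightarrow> real \<Rightarrow> real" where
  "rpow s p =
     (if s \<ge> 0 then s powr p
      else if p \<in> \<int> then s powi \<lfloor>p\<rfloor>
      else - ((- s) powr p))"

text \<open>The base of the outer power is positive for small \<open>t\<close>.\<close>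

definition Lp_perturbation ::
    "real \<Rightarrow> (real^'n) set \<Rightarrow> (real^'n \<Rightarrow> real) \<Rightarrow> real \<Rightarrow> real^'n \<Rightarrow> real" where
  "Lp_perturbation p K f t v = (support_fun K v powr p + t * rpow (f v) p) powr (1 / p)"

end

theory Submission
  imports Defs
begin

text \<open>
  The gauge \<open>g x = max\<^sub>v (x \<bullet> v) / h\<^sub>K v\<close>, with \<open>v\<close> on the unit sphere, has \<open>K\<close> as its
  unit ball, and the maximum is attained exactly at the outer unit normals of \<open>K\<close> at \<open>x / g x\<close>.
  The perturbed support function is \<open>h\<^sub>t = h\<^sub>K (1 + t F) powr (1/p)\<close> with
  \<open>F = f\<^sup>p / h\<^sub>K\<^sup>p\<close>; its Wulff shape is the unit ball of the analogous gauge \<open>g\<^sub>t\<close>, so in the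
  direction of a boundary point \<open>y\<close> it reaches up to \<open>y / g\<^sub>t y\<close>. The formula rests on three facts.

  \<^item> Integration along rays, with Lebesgue measure on \<open>K\<close> itself in the place of a measure
    on the directions (\<open>nn_integral_polar\<close>, \<open>quermass_formula\<close>): the quermassintegral of the Wulff shape
    of \<open>h\<^sub>t\<close> is the integral over \<open>x \<in> K\<close> of the mass that a density on the ray through
    \<open>y = x / g x\<close> has up to radius \<open>1 / g\<^sub>t y\<close>. Surface measure does not enter here.

  \<^item> Danskin's argument. If the normal \<open>\<nu>\<close> at \<open>y\<close> is unique, then \<open>g\<^sub>t y\<close> is a maximum
    of functions of \<open>t\<close> with a single maximiser at \<open>t = 0\<close>, and its derivative there is
    \<open>- F \<nu> / p\<close> (\<open>gauge_perturbation_deriv\<close>). The normal is unique for almost all \<open>x\<close>, because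
    the second differences of the convex function \<open>g\<close> are small on average compared with the step
    (\<open>AE_unique_maximizer\<close>). Dominated convergence then gives the derivative as an integral
    over \<open>K\<close> (\<open>quermass_derivative\<close>).

  \<^item> The image of \<open>n\<close> times Lebesgue measure on \<open>K\<close> under \<open>x \<mapsto> x / g x\<close> has density
    \<open>y \<bullet> \<nu> y\<close> with respect to \<open>(n-1)\<close>-dimensional Hausdorff measure on the regular boundary
    (\<open>cone_measure_eq\<close>), which turns that integral into one against the curvature measure.
    Near a regular boundary point, convexity makes the boundary so flat that the radial
    projection to the tangent hyperplane is bi-Lipschitz with a constant close to one, and it
    changes the lengths of rays by factors close to one. So the claim reduces to subsets of a
    hyperplane, over which a cone has volume height times base divided by \<open>n\<close>
    (\<open>cone_volume_over_hyperplane\<close>).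

  The hyperplane case needs that \<open>k\<close>-dimensional Hausdorff measure on a \<open>k\<close>-dimensional
  space is Lebesgue measure (\<open>hausdorff_outer_eq_lborel\<close>). One inequality follows from Vitali's covering
  theorem. The other one is the isodiametric inequality: a Brunn--Minkowski inequality gives
  \<open>2\<^sup>k \<bar>A\<bar> \<le> \<bar>A - A\<bar>\<close>, and \<open>A - A\<close> lies in a ball whose radius is the diameter of \<open>A\<close>.
\<close>

section \<open>Brunn--Minkowski for unions of boxes and the isodiametric inequality\<close>

lemma box_halfspace_lt:
  fixes a b :: "'a::euclidean_space"
  assumes "i \<in> Basis"
  shows "\<exists>b'. box a b \<inter> {x. x \<bullet> i < c} = box a b'"
proof -
  define b' where "b' = b + (min (b \<bullet> i) c - b \<bullet> i) *\<^sub>R i"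
  have bi: "b' \<bullet> j = (if j = i then min (b \<bullet> i) c else b \<bullet> j)" if "j \<in> Basis" for j
    using that assms by (auto simp: b'_def inner_add_left inner_Basis)
  have "x \<in> box a b' \<longleftrightarrow> x \<in> box a b \<inter> {x. x \<bullet> i < c}" for x
  proof -
    have "x \<in> box a b' \<longleftrightarrow> (\<forall>j\<in>Basis. a \<bullet> j < x \<bullet> j \<and> x \<bullet> j < (if j = i then min (b \<bullet> i) c else b \<bullet> j))"
      by (simp add: mem_box bi cong: ball_cong)
    then show ?thesis using assms by (auto simp: mem_box split: if_splits)
  qed
  then have "box a b \<inter> {x. x \<bullet> i < c} = box a b'" by blast
  then show ?thesis by blast
qed

lemma box_halfspace_gt:
  fixes a b :: "'a::euclidean_space"
  assumes "i \<in> Basis"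
  shows "\<exists>a'. box a b \<inter> {x. c < x \<bullet> i} = box a' b"
proof -
  define a' where "a' = a + (max (a \<bullet> i) c - a \<bullet> i) *\<^sub>R i"
  have bi: "a' \<bullet> j = (if j = i then max (a \<bullet> i) c else a \<bullet> j)" if "j \<in> Basis" for j
    using that assms by (auto simp: a'_def inner_add_left inner_Basis)
  have "x \<in> box a' b \<longleftrightarrow> x \<in> box a b \<inter> {x. c < x \<bullet> i}" for x
  proof -
    have "x \<in> box a' b \<longleftrightarrow> (\<forall>j\<in>Basis. (if j = i then max (a \<bullet> i) c else a \<bullet> j) < x \<bullet> j \<and> x \<bullet> j < b \<bullet> j)"
      by (simp add: mem_box bi cong: ball_cong)
    then show ?thesis using assms by (auto simp: mem_box split: if_splits)
  qed
  then have "box a b \<inter> {x. c < x \<bullet> i} = box a' b" by blast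
  then show ?thesis by blast
qed

text \<open>
  Open boxes are used because a coordinate hyperplane cuts an open box into open boxes or empty sets,
  so that no overlaps of boundaries have to be tracked.
\<close>
definition box_family :: "'a::euclidean_space set set \<Rightarrow> bool" where
  "box_family D \<longleftrightarrow> finite D \<and> disjoint D \<and> (\<forall>X\<in>D. X \<noteq> {} \<and> (\<exists>a b. X = box a b))"

lemma box_family_open: "box_family D \<Longrightarrow> open (\<Union>D)"
  unfolding box_family_def by (metis open_Union open_box)

lemma box_family_bounded: "box_family D \<Longrightarrow> bounded (\<Union>D)"
  unfolding box_family_def by (metis bounded_Union bounded_box)

lemma open_nonempty_measure_pos:
  fixes A :: "'a::euclidean_space set"
  assumes "open A" "bounded A" "A \<noteq> {}"
  shows "0 < measure lborel A"
proof -
  have "emeasure lborel A \<noteq> 0"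
    using assms open_not_negligible[of A]
    by (metis borel_open completion.complete_sets_sandwich negligible_iff_null_sets null_setsI null_sets_completionI sets_lborel)
  moreover have "emeasure lborel A < \<infinity>" using emeasure_bounded_finite[OF assms(2)] .
  ultimately show ?thesis
    by (metis emeasure_eq_ennreal_measure ennreal_0 infinity_ennreal_def less_irrefl measure_nonneg order_le_less)
qed

lemma measure_lborel_mono_bdd:
  fixes A :: "'a::euclidean_space set"
  assumes "A \<subseteq> B" "A \<in> sets borel" "B \<in> sets borel" "bounded B"
  shows "measure lborel A \<le> measure lborel B"
  using assms emeasure_bounded_finite[of B]
  by (intro measure_mono_fmeasurable) (auto simp: fmeasurable_def)

lemma measure_lborel_Un_disj:
  fixes A :: "'a::euclidean_space set"
  assumes "A \<in> sets borel" "B \<in> sets borel" "bounded A" "bounded B" "A \<inter> B = {}"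
  shows "measure lborel (A \<union> B) = measure lborel A + measure lborel B"
  using assms emeasure_bounded_finite[of A] emeasure_bounded_finite[of B]
  by (intro measure_Union) auto

lemma halfspace_cut_measure:
  fixes A :: "'a::euclidean_space set"
  assumes A: "open A" "bounded A" and i: "i \<in> Basis"
  shows "measure lborel (A \<inter> {x. x \<bullet> i < c}) + measure lborel (A \<inter> {x. c < x \<bullet> i}) = measure lborel A"
proof -
  have *: "A \<inter> {x. x \<bullet> i < c} \<in> sets borel" "A \<inter> {x. c < x \<bullet> i} \<in> sets borel"
    using A by (auto intro!: borel_open open_Int open_halfspace_component_lt open_halfspace_component_gt)
  have b: "bounded (A \<inter> S)" for S using A(2) by (simp add: bounded_Int)
  have h: "{x. x \<bullet> i = c} \<in> null_sets lborel"
    using negligible_standard_hyperplane[OF i, of c]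
    by (simp add: negligible_iff_null_sets null_sets_completion_iff)
  have "measure lborel (A \<inter> {x. x \<bullet> i < c}) + measure lborel (A \<inter> {x. c < x \<bullet> i})
     = measure lborel (A \<inter> {x. x \<bullet> i < c} \<union> A \<inter> {x. c < x \<bullet> i})"
    using * b by (intro measure_lborel_Un_disj[symmetric]) auto
  also have "A \<inter> {x. x \<bullet> i < c} \<union> A \<inter> {x. c < x \<bullet> i} = A - {x. x \<bullet> i = c}" by auto
  also have "measure lborel \<dots> = measure lborel A"
    using h A by (intro measure_Diff_null_set) auto
  finally show ?thesis .
qed

text \<open>
  The volume of a slab of small width around the hyperplane bounds the variation.
\<close>
lemma halfspace_cut_continuous:
  fixes B :: "'a::euclidean_space set"
  assumes B: "open B" "bounded B" and i: "i \<in> Basis"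
  shows "continuous_on UNIV (\<lambda>c. measure lborel (B \<inter> {x. x \<bullet> i < c}))"
proof -
  obtain u v where uv: "B \<subseteq> cbox u v" using bounded_subset_cbox_symmetric[OF B(2)] by blast
  define F where "F = (\<lambda>c. measure lborel (B \<inter> {x. x \<bullet> i < c}))"
  have bor: "B \<inter> {x. x \<bullet> i < c} \<in> sets borel" for c
    using B by (auto intro!: borel_open open_Int open_halfspace_component_lt)
  have bd: "bounded (B \<inter> S)" for S using B(2) by (simp add: bounded_Int)
  have mono: "F c \<le> F c'" if "c \<le> c'" for c c'
    unfolding F_def using that bor bd by (intro measure_lborel_mono_bdd) auto
  have "\<exists>d>0. \<forall>c'. dist c' c < d \<longrightarrow> dist (F c') (F c) \<le> e" if "e > 0" for e c
  proof -
    obtain d where d: "0 < d" "measure lborel (cbox u v \<inter> {x. \<bar>x \<bullet> i - c\<bar> \<le> d}) < e"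
      using content_doublesplit[OF \<open>e>0\<close> i] by blast
    have cl: "closed (cbox u v \<inter> {x. \<bar>x \<bullet> i - c\<bar> \<le> d})"
      by (intro closed_Int closed_cbox closed_Collect_le continuous_intros)
    have step: "F s \<le> F r + e" if "r \<le> s" "\<bar>r - c\<bar> \<le> d" "\<bar>s - c\<bar> \<le> d" for r s
    proof -
      have "F s \<le> measure lborel ((B \<inter> {x. x \<bullet> i < r}) \<union> (cbox u v \<inter> {x. \<bar>x \<bullet> i - c\<bar> \<le> d}))"
        unfolding F_def using that uv bor bd cl
        by (intro measure_lborel_mono_bdd)
           (auto intro!: sets.Un bounded_Un[THEN iffD2] borel_closed simp: bounded_Int)
      also have "\<dots> \<le> F r + measure lborel (cbox u v \<inter> {x. \<bar>x \<bullet> i - c\<bar> \<le> d})"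
        unfolding F_def using bor cl by (intro measure_Un_le) auto
      finally show ?thesis using d by linarith
    qed
    show ?thesis
    proof (intro exI[of _ d] conjI allI impI d)
      fix c' assume c': "dist c' c < d"
      show "dist (F c') (F c) \<le> e"
      proof (cases "c \<le> c'")
        case True then show ?thesis using step[of c c'] mono[of c c'] c' d by (auto simp: dist_real_def)
      next
        case False then show ?thesis using step[of c' c] mono[of c' c] c' d by (auto simp: dist_real_def)
      qed
    qed
  qed
  then have "continuous_on UNIV F"
    unfolding continuous_on_iff by (metis (full_types) dense order_le_less_trans)
  then show ?thesis unfolding F_def .
qed

lemma halfspace_cut_ratio:
  fixes B :: "'a::euclidean_space set"
  assumes B: "open B" "bounded B" and i: "i \<in> Basis" and l: "0 < l" "l < 1"
  shows "\<exists>c. measure lborel (B \<inter> {x. x \<bullet> i < c}) = l * measure lborel B"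
proof -
  obtain r where r: "0 < r" "\<forall>x\<in>B. norm x \<le> r" using B(2) bounded_pos by blast
  have *: "\<bar>x \<bullet> i\<bar> \<le> r" if "x \<in> B" for x
    using r that Basis_le_norm[OF i, of x] by force
  have 0: "B \<inter> {x. x \<bullet> i < -r} = {}" using * by force
  have 1: "B \<inter> {x. x \<bullet> i < r + 1} = B" using * by force
  define F where "F = (\<lambda>c. measure lborel (B \<inter> {x. x \<bullet> i < c}))"
  have c: "continuous_on {-r .. r+1} F"
    using halfspace_cut_continuous[OF B i] continuous_on_subset unfolding F_def by blast
  have f: "F (-r) = 0" "F (r+1) = measure lborel B" unfolding F_def 0 1 by auto
  have p: "0 \<le> l * measure lborel B" "l * measure lborel B \<le> measure lborel B"
    using l mult_right_mono[of l 1 "measure lborel B"] by auto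
  obtain x where "F x = l * measure lborel B"
    using IVT'[of F "-r" "l * measure lborel B" "r+1", OF _ _ _ c] f p r(1) by auto
  then show ?thesis unfolding F_def by blast
qed

lemma box_family_cut:
  fixes D :: "'a::euclidean_space set set"
  assumes D: "box_family D" and S: "\<And>a b. \<exists>a' b'. box a b \<inter> S = box a' b'"
  defines "D' \<equiv> (\<lambda>X. X \<inter> S) ` {X \<in> D. X \<inter> S \<noteq> {}}"
  shows "box_family D'" "\<Union>D' = \<Union>D \<inter> S" "card D' \<le> card {X \<in> D. X \<inter> S \<noteq> {}}"
proof -
  have fin: "finite D" using D by (simp add: box_family_def)
  show "\<Union>D' = \<Union>D \<inter> S" unfolding D'_def by auto
  show "card D' \<le> card {X \<in> D. X \<inter> S \<noteq> {}}" unfolding D'_def using fin by (intro card_image_le) auto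
  show "box_family D'" unfolding box_family_def
  proof (intro conjI ballI)
    show "finite D'" unfolding D'_def using fin by auto
    show "disjoint D'"
      using D unfolding D'_def box_family_def pairwise_def disjnt_def by blast
    fix X assume "X \<in> D'"
    then show "X \<noteq> {}" "\<exists>a b. X = box a b" using D S unfolding D'_def box_family_def by fastforce+
  qed
qed

lemma box_sum_measure:
  fixes a b c d :: "'a::euclidean_space"
  assumes "box a b \<noteq> {}" "box c d \<noteq> {}"
  shows "4 ^ DIM('a) * (measure lborel (box a b) * measure lborel (box c d))
    \<le> (measure lborel (\<Union>x\<in>box a b. \<Union>y\<in>box c d. {x + y}))\<^sup>2"
proof -
  have ab: "a \<bullet> i < b \<bullet> i" "c \<bullet> i < d \<bullet> i" if "i \<in> Basis" for i
    using assms that by (auto simp: box_ne_empty)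
  have sub: "box (a + c) (b + d) \<subseteq> (\<Union>x\<in>box a b. \<Union>y\<in>box c d. {x + y})"
  proof
    fix z assume z: "z \<in> box (a + c) (b + d)"
    \<comment> \<open>in each coordinate, \<open>x\<close> divides the side of \<open>box a b\<close> in the ratio in which \<open>z\<close> divides that of the sum box\<close>
    define x where "x = (\<Sum>i\<in>Basis. (a \<bullet> i + (b \<bullet> i - a \<bullet> i) * ((z \<bullet> i - a \<bullet> i - c \<bullet> i) / (b \<bullet> i - a \<bullet> i + d \<bullet> i - c \<bullet> i))) *\<^sub>R i)"
    have xi: "a \<bullet> i < x \<bullet> i \<and> x \<bullet> i < b \<bullet> i \<and> c \<bullet> i < (z - x) \<bullet> i \<and> (z - x) \<bullet> i < d \<bullet> i" if i: "i \<in> Basis" for i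
    proof -
      define w t where "w = b \<bullet> i - a \<bullet> i" and "t = (z \<bullet> i - a \<bullet> i - c \<bullet> i) / (b \<bullet> i - a \<bullet> i + d \<bullet> i - c \<bullet> i)"
      have x: "x \<bullet> i = a \<bullet> i + w * t" using i unfolding x_def w_def t_def by simp
      have zi: "a \<bullet> i + c \<bullet> i < z \<bullet> i" "z \<bullet> i < b \<bullet> i + d \<bullet> i"
        using z i by (auto simp: mem_box inner_add_left)
      have t: "0 < t" "t < 1" unfolding t_def using zi ab[OF i] by auto
      have w: "0 < w" "0 < d \<bullet> i - c \<bullet> i" unfolding w_def using ab[OF i] by auto
      have e: "z \<bullet> i - a \<bullet> i - c \<bullet> i = t * (w + (d \<bullet> i - c \<bullet> i))"
        unfolding t_def w_def using ab[OF i] by (simp add: add_diff_eq)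
      have 1: "0 < w * t" "w * t < w" using w t by auto
      have 2: "0 < (d \<bullet> i - c \<bullet> i) * t" "(d \<bullet> i - c \<bullet> i) * t < d \<bullet> i - c \<bullet> i" using w t
        by (simp_all add: mult_less_cancel_left2)
      have "(z - x) \<bullet> i = c \<bullet> i + (d \<bullet> i - c \<bullet> i) * t"
        using e x by (simp add: inner_diff_left algebra_simps)
      then show ?thesis using 1 2 x w_def by auto
    qed
    have "x \<in> box a b" "z - x \<in> box c d" using xi by (auto simp: mem_box)
    moreover have "z \<in> {x + (z - x)}" by simp
    ultimately show "z \<in> (\<Union>x\<in>box a b. \<Union>y\<in>box c d. {x + y})" by blast
  qed
  have bd: "bounded (\<Union>x\<in>box a b. \<Union>y\<in>box c d. {x + y})"
    by (rule bounded_sums[OF bounded_box bounded_box])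
  have "measure lborel (box (a+c) (b+d)) \<le> measure lborel (\<Union>x\<in>box a b. \<Union>y\<in>box c d. {x + y})"
    using sub bd by (intro measure_lborel_mono_bdd) (auto intro!: borel_open open_sums)
  moreover have "4 ^ DIM('a) * (measure lborel (box a b) * measure lborel (box c d)) \<le> (measure lborel (box (a+c) (b+d)))\<^sup>2"
  proof -
    have le: "\<forall>i\<in>Basis. a \<bullet> i \<le> b \<bullet> i" "\<forall>i\<in>Basis. c \<bullet> i \<le> d \<bullet> i" "\<forall>i\<in>Basis. (a + c) \<bullet> i \<le> (b + d) \<bullet> i"
      using ab by (simp_all add: less_imp_le inner_add_left add_mono)
    have "4 ^ DIM('a) * (measure lborel (box a b) * measure lborel (box c d))
       = (\<Prod>i\<in>Basis. 4 * ((b - a) \<bullet> i * ((d - c) \<bullet> i)))"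
      using le by (simp add: measure_lborel_box_eq prod.distrib)
    also have "\<dots> \<le> (\<Prod>i\<in>Basis. (((b + d) - (a + c)) \<bullet> i)\<^sup>2)"
    proof (rule prod_mono, intro conjI)
      fix i :: 'a assume i: "i \<in> Basis"
      have "0 \<le> (b-a) \<bullet> i" "0 \<le> (d-c) \<bullet> i" using ab[OF i] by (auto simp: inner_diff_left)
      then show "0 \<le> 4 * ((b - a) \<bullet> i * ((d - c) \<bullet> i))" by simp
      have "((b + d) - (a + c)) \<bullet> i = (b - a) \<bullet> i + (d - c) \<bullet> i" by (simp add: inner_diff_left inner_add_left)
      then show "4 * ((b - a) \<bullet> i * ((d - c) \<bullet> i)) \<le> (((b + d) - (a + c)) \<bullet> i)\<^sup>2"
        using sum_squares_bound[of "(b-a) \<bullet> i" "(d-c) \<bullet> i"] by (simp add: power2_sum)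
    qed
    also have "\<dots> = (measure lborel (box (a+c) (b+d)))\<^sup>2"
      using le by (simp add: measure_lborel_box_eq prod_power_distrib)
    finally show ?thesis .
  qed
  ultimately show ?thesis
    by (meson measure_nonneg order_trans power_mono)
qed

lemma set_sum_commute:
  fixes A B :: "'a::real_normed_vector set"
  shows "(\<Union>x\<in>A. \<Union>y\<in>B. {x + y}) = (\<Union>x\<in>B. \<Union>y\<in>A. {x + y})"
  by (auto simp: add.commute)

text \<open>
  The induction step of Hadwiger and Ohmann. Two disjoint boxes of \<open>D\<close> lie on different
  sides of a coordinate hyperplane, so both halves of \<open>\<Union>D\<close> consist of fewer boxes.
  \<open>\<Union>E\<close> is cut by a parallel hyperplane in the same volume ratio \<open>l : (1 - l)\<close>. The sums of
  corresponding halves are then separated by a hyperplane, and the square roots of the two lower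
  bounds add up because \<open>l + (1 - l) = 1\<close>.
\<close>
lemma brunn_minkowski_cut:
  fixes D E :: "'a::euclidean_space set set"
  assumes D: "box_family D" and E: "box_family E" "E \<noteq> {}" and c2: "card D \<ge> 2"
    and IH: "\<And>D' E'::'a set set. \<lbrakk>box_family D'; box_family E'; D' \<noteq> {}; E' \<noteq> {}; card D' < card D; card E' \<le> card E\<rbrakk>
      \<Longrightarrow> 4 ^ DIM('a) * (measure lborel (\<Union>D') * measure lborel (\<Union>E'))
         \<le> (measure lborel (\<Union>x\<in>\<Union>D'. \<Union>y\<in>\<Union>E'. {x + y}))\<^sup>2"
  shows "4 ^ DIM('a) * (measure lborel (\<Union>D) * measure lborel (\<Union>E))
         \<le> (measure lborel (\<Union>x\<in>\<Union>D. \<Union>y\<in>\<Union>E. {x + y}))\<^sup>2"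
proof -
  have finD: "finite D" "finite E" using D E by (auto simp: box_family_def)
  obtain X Y where XY: "X \<in> D" "Y \<in> D" "X \<noteq> Y"
  proof -
    have "\<not> card D \<le> Suc 0" using c2 by simp
    then show ?thesis using that finD(1) by (meson card_le_Suc0_iff_eq)
  qed
  have "\<exists>i\<in>Basis. \<exists>c. \<exists>X\<in>D. \<exists>Y\<in>D. X \<subseteq> {x. x \<bullet> i < c} \<and> Y \<subseteq> {x. c < x \<bullet> i}"
  proof -
    obtain a b a' b' where eq: "X = box a b" "Y = box a' b'"
      using D XY unfolding box_family_def by meson
    have ne: "X \<noteq> {}" "Y \<noteq> {}" and "X \<inter> Y = {}"
      using D XY unfolding box_family_def pairwise_def disjnt_def by auto
    then obtain i where i: "i \<in> Basis" and "b \<bullet> i \<le> a' \<bullet> i \<or> b' \<bullet> i \<le> a \<bullet> i"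
      unfolding eq disjoint_interval box_ne_empty by (meson leD)
    then consider "b \<bullet> i \<le> a' \<bullet> i" | "b' \<bullet> i \<le> a \<bullet> i" by blast
    then show ?thesis
    proof cases
      case 1
      show ?thesis
        by (rule bexI[OF exI[of _ "b \<bullet> i"] i], intro bexI[OF bexI[OF _ XY(2)] XY(1)])
           (use i 1 in \<open>force simp: eq mem_box\<close>)
    next
      case 2
      show ?thesis
        by (rule bexI[OF exI[of _ "b' \<bullet> i"] i], intro bexI[OF bexI[OF _ XY(1)] XY(2)])
           (use i 2 in \<open>force simp: eq mem_box\<close>)
    qed
  qed
  then obtain i c X Y where i: "i \<in> Basis" and XY: "X \<in> D" "Y \<in> D" "X \<subseteq> {x. x \<bullet> i < c}" "Y \<subseteq> {x. c < x \<bullet> i}"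
    by blast
  define L where "L = (\<lambda>c::real. {x::'a. x \<bullet> i < c})"
  define U where "U = (\<lambda>c::real. {x::'a. c < x \<bullet> i})"
  have LU: "\<And>c a b. \<exists>a' b'. box a b \<inter> L c = box a' b'" "\<And>c a b. \<exists>a' b'. box a b \<inter> U c = box a' b'"
    unfolding L_def U_def using box_halfspace_lt[OF i] box_halfspace_gt[OF i] by blast+
  define A B where "A = \<Union>D" and "B = \<Union>E"
  have A: "open A" "bounded A" and B: "open B" "bounded B"
    unfolding A_def B_def using D E box_family_open box_family_bounded by auto
  have oL: "open (L c)" "open (U c)" for c
    unfolding L_def U_def by (auto intro: open_halfspace_component_lt open_halfspace_component_gt)
  have XYne: "X \<noteq> {}" "Y \<noteq> {}" using D XY(1,2) by (auto simp: box_family_def)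
  have AL: "A \<inter> L c \<noteq> {}" "A \<inter> U c \<noteq> {}" using XY XYne unfolding A_def L_def U_def by blast+
  have Bne: "B \<noteq> {}" unfolding B_def using E by (auto simp: box_family_def)
  define mA mB where "mA = measure lborel A" and "mB = measure lborel B"
  define a1 a2 where "a1 = measure lborel (A \<inter> L c)" and "a2 = measure lborel (A \<inter> U c)"
  have a: "0 < a1" "0 < a2" unfolding a1_def a2_def
    using A oL AL by (auto intro!: open_nonempty_measure_pos simp: bounded_Int)
  have sumA: "a1 + a2 = mA" unfolding a1_def a2_def mA_def L_def U_def using halfspace_cut_measure[OF A i] .
  define l where "l = a1 / mA"
  have l: "0 < l" "l < 1" unfolding l_def using a sumA by auto
  have al: "a1 = l * mA" "a2 = (1 - l) * mA" unfolding l_def using sumA a by (auto simp: field_simps)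
  obtain c' where c': "measure lborel (B \<inter> L c') = l * mB"
    unfolding L_def mB_def using halfspace_cut_ratio[OF B i l] by blast
  then have c'': "measure lborel (B \<inter> U c') = (1 - l) * mB"
    using halfspace_cut_measure[OF B i, of c'] unfolding L_def U_def mB_def by (simp add: algebra_simps)
  have mB: "0 < mB" unfolding mB_def using B Bne open_nonempty_measure_pos by blast
  have BL: "B \<inter> L c' \<noteq> {}" "B \<inter> U c' \<noteq> {}"
    using c' c'' l mB by (metis measure_empty mult_pos_pos less_irrefl diff_gt_0_iff_gt)+
  define S where "S = (\<lambda>P Q::'a set. \<Union>x\<in>P. \<Union>y\<in>Q. {x + y})"
  have less: "card {X \<in> D. X \<inter> T \<noteq> {}} < card D" if "Z \<in> D" "Z \<inter> T = {}" for Z T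
    using that finD by (intro psubset_card_mono) auto
  have le: "card {X \<in> E. X \<inter> T \<noteq> {}} \<le> card E" for T using finD by (intro card_mono) auto
  have main: "4 ^ DIM('a) * (measure lborel (A \<inter> T) * measure lborel (B \<inter> T'))
     \<le> (measure lborel (S (A \<inter> T) (B \<inter> T')))\<^sup>2"
    if T: "\<And>a b. \<exists>a' b'. box a b \<inter> T = box a' b'" and T': "\<And>a b. \<exists>a' b'. box a b \<inter> T' = box a' b'"
      and ne: "A \<inter> T \<noteq> {}" "B \<inter> T' \<noteq> {}" and Z: "Z \<in> D" "Z \<inter> T = {}" for T T' Z
  proof -
    note 1 = box_family_cut[OF D T] and 2 = box_family_cut[OF E(1) T']
    have n1: "(\<lambda>X. X \<inter> T) ` {X \<in> D. X \<inter> T \<noteq> {}} \<noteq> {}" "(\<lambda>X. X \<inter> T') ` {X \<in> E. X \<inter> T' \<noteq> {}} \<noteq> {}"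
      using ne unfolding A_def B_def by auto
    show ?thesis
      using IH[OF 1(1) 2(1) n1 order_le_less_trans[OF 1(3) less[OF Z]] order_trans[OF 2(3) le]]
      unfolding 1(2) 2(2) A_def B_def S_def .
  qed
  have Z: "Y \<inter> L c = {}" "X \<inter> U c = {}" using XY unfolding L_def U_def by force+
  define s1 s2 where "s1 = measure lborel (S (A \<inter> L c) (B \<inter> L c'))" and "s2 = measure lborel (S (A \<inter> U c) (B \<inter> U c'))"
  have 1: "4 ^ DIM('a) * (mA * mB) * l\<^sup>2 \<le> s1\<^sup>2"
    using main[OF LU(1) LU(1) AL(1) BL(1) XY(2) Z(1)] unfolding s1_def c' a1_def[symmetric] al
    by (simp add: power2_eq_square mult_ac)
  have 2: "4 ^ DIM('a) * (mA * mB) * (1 - l)\<^sup>2 \<le> s2\<^sup>2"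
    using main[OF LU(2) LU(2) AL(2) BL(2) XY(1) Z(2)] unfolding s2_def c'' a2_def[symmetric] al
    by (simp add: power2_eq_square mult_ac)
  define k where "k = sqrt (4 ^ DIM('a) * (mA * mB))"
  have k0: "0 \<le> 4 ^ DIM('a) * (mA * mB)" unfolding mA_def mB_def by simp
  have k: "k\<^sup>2 = 4 ^ DIM('a) * (mA * mB)" "0 \<le> k" unfolding k_def using k0 by auto
  have "k * l \<le> s1" using 1 k l unfolding k(1)[symmetric] power_mult_distrib[symmetric]
    by (rule_tac power2_le_imp_le) (auto simp: s1_def)
  moreover have "k * (1 - l) \<le> s2" using 2 k l unfolding k(1)[symmetric] power_mult_distrib[symmetric]
    by (rule_tac power2_le_imp_le) (auto simp: s2_def)
  ultimately have ks: "k \<le> s1 + s2" by (simp add: algebra_simps)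
  have bdS: "bounded (S P Q)" if "bounded P" "bounded Q" for P Q
    unfolding S_def using bounded_sums[OF that] .
  have oS: "open (S P Q)" if "open P" for P Q unfolding S_def using open_sums that by blast
  have "z \<bullet> i < c + c'" if "z \<in> S (A \<inter> L c) (B \<inter> L c')" for z
    using that by (auto simp: S_def L_def inner_add_left)
  moreover have "c + c' < z \<bullet> i" if "z \<in> S (A \<inter> U c) (B \<inter> U c')" for z
    using that by (auto simp: S_def U_def inner_add_left)
  ultimately have disj: "S (A \<inter> L c) (B \<inter> L c') \<inter> S (A \<inter> U c) (B \<inter> U c') = {}" by force
  have "s1 + s2 = measure lborel (S (A \<inter> L c) (B \<inter> L c') \<union> S (A \<inter> U c) (B \<inter> U c'))"
    unfolding s1_def s2_def
    by (intro measure_lborel_Un_disj[symmetric] borel_open oS bdS disj open_Int A oL)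
       (use A B in \<open>simp_all add: bounded_Int\<close>)
  also have "\<dots> \<le> measure lborel (S A B)"
    by (intro measure_lborel_mono_bdd borel_open open_Un oS bdS open_Int A B oL) (auto simp: S_def)
  finally have "k \<le> measure lborel (S A B)" using ks by linarith
  then have "k\<^sup>2 \<le> (measure lborel (S A B))\<^sup>2" using k(2) by (intro power_mono) auto
  then show ?thesis unfolding k mA_def mB_def A_def B_def S_def .
qed

text \<open>
  The Brunn--Minkowski inequality in the multiplicative form
  \<open>\<bar>A + B\<bar> \<ge> 2\<^sup>n sqrt (\<bar>A\<bar> \<bar>B\<bar>)\<close>, squared. In this form the case of two
  single boxes is the arithmetic-geometric mean inequality in each coordinate.
\<close>
lemma brunn_minkowski_boxes:
  fixes D E :: "'a::euclidean_space set set"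
  assumes "box_family D" "box_family E" "D \<noteq> {}" "E \<noteq> {}"
  shows "4 ^ DIM('a) * (measure lborel (\<Union>D) * measure lborel (\<Union>E))
         \<le> (measure lborel (\<Union>x\<in>\<Union>D. \<Union>y\<in>\<Union>E. {x + y}))\<^sup>2"
  using assms
proof (induction "card D + card E" arbitrary: D E rule: less_induct)
  case less
  have fin: "finite D" "finite E" using less.prems by (auto simp: box_family_def)
  have pos: "card D \<ge> 1" "card E \<ge> 1" using fin less.prems(3,4) by (auto simp: Suc_le_eq card_gt_0_iff)
  consider "card D \<ge> 2" | "card E \<ge> 2" | "card D = 1" "card E = 1" using pos by linarith
  then show ?case
  proof cases
    case 1
    show ?thesis
      by (rule brunn_minkowski_cut[OF less.prems(1,2,4) 1]) (rule less.hyps, auto)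
  next
    case 2
    have "4 ^ DIM('a) * (measure lborel (\<Union>E) * measure lborel (\<Union>D))
         \<le> (measure lborel (\<Union>x\<in>\<Union>E. \<Union>y\<in>\<Union>D. {x + y}))\<^sup>2"
      by (rule brunn_minkowski_cut[OF less.prems(2,1,3) 2]) (rule less.hyps, auto)
    then show ?thesis by (subst set_sum_commute) (simp add: mult_ac)
  next
    case 3
    then obtain X Y where "D = {X}" "E = {Y}" by (meson card_1_singletonE)
    moreover obtain a b c d where "X = box a b" "Y = box c d" "X \<noteq> {}" "Y \<noteq> {}"
      using less.prems calculation unfolding box_family_def by (metis insertI1)
    ultimately show ?thesis using box_sum_measure[of a b c d] by simp
  qed
qed

lemma box_family_uminus:
  fixes D :: "'a::euclidean_space set set"
  assumes "box_family D"
  shows "box_family ((`) uminus ` D)" "\<Union>((`) uminus ` D) = uminus ` \<Union>D"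
proof -
  have box: "uminus ` box a b = box (- b) (- a)" for a b :: 'a
  proof (rule set_eqI)
    fix x :: 'a
    have "x \<in> uminus ` box a b \<longleftrightarrow> - x \<in> box a b" by force
    then show "x \<in> uminus ` box a b \<longleftrightarrow> x \<in> box (- b) (- a)" by (force simp: mem_box)
  qed
  have "disjnt (uminus ` P) (uminus ` Q)" if "P \<in> D" "Q \<in> D" "uminus ` P \<noteq> uminus ` Q" for P Q
  proof -
    have "disjnt P Q" using assms that unfolding box_family_def pairwise_def by metis
    then show ?thesis by (auto simp: disjnt_def)
  qed
  then have "disjoint ((`) uminus ` D)" unfolding pairwise_image pairwise_def by blast
  then show "box_family ((`) uminus ` D)"
    using assms box unfolding box_family_def by fastforce
qed auto

lemma measure_lborel_uminus:
  fixes A :: "'a::euclidean_space set"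
  assumes "A \<in> sets borel"
  shows "measure lborel (uminus ` A) = measure lborel A"
proof -
  have eq: "lborel = distr lborel borel (uminus :: 'a \<Rightarrow> 'a)"
    using lborel_affine[of "-1" "0::'a"] by (simp add: density_1)
  have "uminus -` A = uminus ` A" by force
  then show ?thesis
    using assms by (subst (2) eq) (simp add: measure_distr)
qed

text \<open>
  The covering lemma behind the gauge integral splits \<open>U\<close> into countably many cells with disjoint
  interiors; finitely many of them carry almost all of the volume.
\<close>
lemma box_family_approx_open:
  fixes U :: "'a::euclidean_space set"
  assumes U: "open U" "bounded U" and c: "c < measure lborel U" "0 \<le> c"
  shows "\<exists>D. box_family D \<and> \<Union>D \<subseteq> U \<and> c < measure lborel (\<Union>D)"
proof -
  have ne: "U \<noteq> {}" using c by auto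
  obtain r where r: "0 < r" "U \<subseteq> cbox (- r *\<^sub>R One) (r *\<^sub>R One)"
  proof -
    obtain a where a: "U \<subseteq> cbox (-a) a" using bounded_subset_cbox_symmetric[OF U(2)] by blast
    define r where "r = norm a + 1"
    have "cbox (-a) a \<subseteq> cbox (- r *\<^sub>R One) (r *\<^sub>R One)"
      unfolding subset_box using Basis_le_norm[of _ a] by (fastforce simp: r_def abs_le_iff)
    then show ?thesis using a that[of r] by (auto simp: r_def add_nonneg_pos)
  qed
  \<comment> \<open>this gauge forces every cell of the covering lemma into \<open>U\<close>\<close>
  define g where "g = (\<lambda>x::'a. if x \<in> U then U else UNIV)"
  have gauge: "gauge g" unfolding gauge_def g_def using U by auto
  have bne: "box (- r *\<^sub>R One) (r *\<^sub>R One) \<noteq> ({}::'a set)" using r by (auto simp: box_ne_empty)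
  obtain D where D: "countable D" "\<And>K. K \<in> D \<Longrightarrow> interior K \<noteq> {} \<and> (\<exists>c d. K = cbox c d)"
    "pairwise (\<lambda>A B. interior A \<inter> interior B = {}) D"
    "\<And>K. K \<in> D \<Longrightarrow> \<exists>x \<in> U \<inter> K. K \<subseteq> g x" "U \<subseteq> \<Union>D"
    using covering_lemma[OF r(2) bne gauge] by metis
  have sub: "K \<subseteq> U" if "K \<in> D" for K using D(4)[OF that] by (auto simp: g_def)
  have Dne: "D \<noteq> {}" using D(5) ne by auto
  define f where "f = from_nat_into D"
  have f: "f n \<in> D" for n unfolding f_def using from_nat_into[OF Dne] .
  have rf: "range f = D" unfolding f_def using Dne D(1) by (rule range_from_nat_into)
  define V where "V = (\<lambda>n. \<Union>i\<le>n. interior (f i))"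
  have Vop: "open (V n)" for n unfolding V_def by auto
  have VU: "V n \<subseteq> U" for n unfolding V_def using f sub interior_subset by blast
  have null: "(\<Union>K\<in>D. frontier K) \<in> null_sets lborel"
  proof (rule null_sets_UN'[OF D(1)])
    fix K assume "K \<in> D"
    then obtain a b where "K = cbox a b" using D(2) by blast
    then have "negligible (frontier K)" by (simp add: negligible_convex_frontier)
    then show "frontier K \<in> null_sets lborel"
      by (simp add: negligible_iff_null_sets null_sets_completion_iff)
  qed
  have "U - (\<Union>n. V n) \<subseteq> (\<Union>K\<in>D. frontier K)"
  proof
    fix x assume x: "x \<in> U - (\<Union>n. V n)"
    then obtain n where n: "x \<in> f n" using D(5) rf by blast
    then have "x \<notin> interior (f n)" using x unfolding V_def by blast
    then have "x \<in> frontier (f n)" using n closure_subset unfolding frontier_def by blast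
    then show "x \<in> (\<Union>K\<in>D. frontier K)" using f by blast
  qed
  then have "U - (\<Union>n. V n) \<in> null_sets lborel"
    by (rule null_sets_subset[OF null, rotated]) (use U Vop in \<open>auto intro!: sets.Diff borel_open\<close>)
  then have "emeasure lborel (U - (U - (\<Union>n. V n))) = emeasure lborel U"
    using U by (intro emeasure_Diff_null_set) auto
  moreover have "U - (U - (\<Union>n. V n)) = (\<Union>n. V n)" using VU by blast
  ultimately have eq: "emeasure lborel (\<Union>n. V n) = emeasure lborel U" by simp
  have inc: "incseq V" unfolding V_def incseq_def by force
  have "(\<lambda>n. emeasure lborel (V n)) \<longlonglongrightarrow> emeasure lborel U"
    using Lim_emeasure_incseq[of V lborel, OF _ inc] Vop eq by (simp add: image_subset_iff)
  moreover have "ennreal c < emeasure lborel U"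
    using c emeasure_bounded_finite[OF U(2)]
    by (metis emeasure_eq_ennreal_measure ennreal_less_iff infinity_ennreal_def less_irrefl)
  ultimately obtain n where n: "ennreal c < emeasure lborel (V n)"
    using order_tendstoD(1) eventually_happens trivial_limit_sequentially by blast
  define E where "E = interior ` f ` {..n}"
  have UE: "\<Union>E = V n" unfolding E_def V_def by auto
  have "box_family E" unfolding box_family_def
  proof (intro conjI ballI)
    show "finite E" unfolding E_def by auto
    have "disjoint (interior ` D)"
      using D(3) unfolding pairwise_image unfolding pairwise_def disjnt_def by blast
    then show "disjoint E" unfolding E_def using f by (auto intro: pairwise_subset)
    fix X assume "X \<in> E"
    then obtain K where K: "K \<in> D" "X = interior K" unfolding E_def using f by blast
    show "X \<noteq> {}" using D(2)[OF K(1)] K(2) by simp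
    show "\<exists>a b. X = box a b" using D(2)[OF K(1)] K(2) interior_cbox by metis
  qed
  moreover have "c < measure lborel (V n)"
  proof -
    have "emeasure lborel (V n) \<noteq> top"
      using emeasure_bounded_finite[OF bounded_subset[OF U(2) VU[of n]]] by (simp add: less_top)
    then show ?thesis using n c by (simp add: emeasure_eq_ennreal_measure ennreal_less_iff)
  qed
  ultimately show ?thesis using UE VU by metis
qed

text \<open>
  Brunn--Minkowski is applied to boxes filling a neighbourhood of \<open>A\<close> and to their reflections.
  Their sum consists of differences of points of the neighbourhood, hence lies in a ball of radius
  slightly more than the diameter of \<open>A\<close>.
\<close>
theorem isodiametric_inequality:
  fixes A :: "'a::euclidean_space set"
  assumes A: "bounded A" "A \<in> sets borel" "A \<noteq> {}"
  shows "measure lborel A \<le> unit_ball_vol (real DIM('a)) * (diameter A / 2) ^ DIM('a)"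
proof -
  define w where "w = unit_ball_vol (real DIM('a))"
  have w: "0 \<le> w" unfolding w_def by simp
  have *: "measure lborel A \<le> w * ((diameter A + 2 * e) / 2) ^ DIM('a)" if e: "0 < e" for e
  proof (rule ccontr)
    assume neg: "\<not> ?thesis"
    define U where "U = (\<Union>a\<in>A. ball a e)"
    have AU: "A \<subseteq> U" unfolding U_def using e by auto
    have opU: "open U" unfolding U_def by auto
    have U2: "U = (\<Union>x\<in>A. \<Union>y\<in>ball 0 e. {x + y})"
    proof (intro set_eqI iffI)
      fix z assume "z \<in> U"
      then obtain a where "a \<in> A" "z \<in> ball a e" unfolding U_def by auto
      then show "z \<in> (\<Union>x\<in>A. \<Union>y\<in>ball 0 e. {x + y})"
        by (intro UN_I[of a] UN_I[of "z - a"]) (auto simp: dist_norm norm_minus_commute)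
    next
      fix z assume "z \<in> (\<Union>x\<in>A. \<Union>y\<in>ball 0 e. {x + y})"
      then obtain x y where "x \<in> A" "norm y < e" "z = x + y" by auto
      then show "z \<in> U" unfolding U_def by (intro UN_I[of x]) (auto simp: dist_norm)
    qed
    have bU: "bounded U" unfolding U2 by (rule bounded_sums[OF A(1) bounded_ball])
    have d0: "0 \<le> diameter A" using diameter_ge_0[OF A(1)] .
    define c where "c = w * ((diameter A + 2 * e) / 2) ^ DIM('a)"
    have c0: "0 \<le> c" unfolding c_def using w d0 e by simp
    have "c < measure lborel U"
      using neg measure_lborel_mono_bdd[OF AU A(2) _ bU] opU unfolding c_def by auto
    then obtain D where D: "box_family D" "\<Union>D \<subseteq> U" "c < measure lborel (\<Union>D)"
      using box_family_approx_open[OF opU bU _ c0] by blast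
    have Dne: "D \<noteq> {}" using D(3) c0 by auto
    note N = box_family_uminus[OF D(1)]
    define S where "S = (\<Union>x\<in>\<Union>D. \<Union>y\<in>uminus ` \<Union>D. {x + y})"
    have opD: "open (\<Union>D)" using D(1) box_family_open by blast
    have mN: "measure lborel (uminus ` \<Union>D) = measure lborel (\<Union>D)"
      by (rule measure_lborel_uminus) (simp add: opD)
    have BM: "4 ^ DIM('a) * (measure lborel (\<Union>D) * measure lborel (\<Union>D)) \<le> (measure lborel S)\<^sup>2"
      using brunn_minkowski_boxes[OF D(1) N(1) Dne] Dne unfolding N(2) mN S_def by blast
    have "(2::real) ^ DIM('a) * 2 ^ DIM('a) = 4 ^ DIM('a)" by (simp flip: power_mult_distrib)
    then have sq: "(2 ^ DIM('a) * measure lborel (\<Union>D))\<^sup>2 = 4 ^ DIM('a) * (measure lborel (\<Union>D) * measure lborel (\<Union>D))"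
      by (simp add: power2_eq_square)
    have le: "2 ^ DIM('a) * measure lborel (\<Union>D) \<le> measure lborel S"
      by (rule power2_le_imp_le[OF BM[folded sq] measure_nonneg])
    have "S \<subseteq> cball 0 (diameter A + 2 * e)"
    proof
      fix z assume "z \<in> S"
      then obtain x y where xy: "x \<in> U" "y \<in> U" "z = x - y" unfolding S_def using D(2) by auto
      then obtain a b where ab: "a \<in> A" "b \<in> A" "dist a x < e" "dist b y < e" unfolding U_def by auto
      have "dist x y \<le> dist x a + dist a b + dist b y"
        using dist_triangle[of x y a] dist_triangle[of a y b] by simp
      also have "\<dots> \<le> diameter A + 2 * e"
        using ab diameter_bounded_bound[OF A(1) ab(1,2)] by (simp add: dist_commute)
      finally show "z \<in> cball 0 (diameter A + 2 * e)" using xy(3) by (simp add: dist_norm[of x y])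
    qed
    moreover have "S \<in> sets borel"
      unfolding S_def using opD by (intro borel_open open_sums disjI1)
    ultimately have "measure lborel S \<le> measure lborel (cball (0::'a) (diameter A + 2 * e))"
      by (intro measure_lborel_mono_bdd) auto
    also have "\<dots> = w * (diameter A + 2 * e) ^ DIM('a)"
      unfolding w_def using d0 e by (intro content_cball) auto
    finally have "2 ^ DIM('a) * measure lborel (\<Union>D) \<le> w * (diameter A + 2 * e) ^ DIM('a)" using le by linarith
    then have "measure lborel (\<Union>D) \<le> c" unfolding c_def by (simp add: power_divide field_simps)
    then show False using D(3) by linarith
  qed
  have lim: "((\<lambda>e. w * ((diameter A + 2 * e) / 2) ^ DIM('a)) \<longlongrightarrow> w * ((diameter A + 2 * 0) / 2) ^ DIM('a)) (at_right 0)"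
    by (intro tendsto_intros) simp
  have ev: "eventually (\<lambda>e. measure lborel A \<le> w * ((diameter A + 2 * e) / 2) ^ DIM('a)) (at_right 0)"
    using * eventually_at_right_less[of "0::real"] by (auto elim: eventually_mono)
  have "measure lborel A \<le> w * ((diameter A + 2 * 0) / 2) ^ DIM('a)"
    by (rule tendsto_lowerbound[OF lim ev]) simp
  then show ?thesis unfolding w_def by simp
qed

section \<open>Hausdorff measure as a Borel measure, and its value in full dimension\<close>

lemma hausdorff_weight_empty [simp]: "hausdorff_weight k {} = 0"
  by (simp add: hausdorff_weight_def)

lemma hausdorff_premeasure_le:
  assumes "\<And>i. bounded (A i)" "\<And>i. diameter (A i) \<le> \<delta>" "S \<subseteq> (\<Union>i. A i)"
  shows "hausdorff_premeasure k \<delta> S \<le> (\<Sum>i. hausdorff_weight k (A i))"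
  unfolding hausdorff_premeasure_def using assms by (intro INF_lower) auto

lemma hausdorff_premeasure_close:
  assumes "hausdorff_premeasure k \<delta> S < e"
  shows "\<exists>A. (\<forall>i. bounded (A i) \<and> diameter (A i) \<le> \<delta>) \<and> S \<subseteq> (\<Union>i. A i) \<and> (\<Sum>i. hausdorff_weight k (A i)) < e"
  using assms unfolding hausdorff_premeasure_def INF_less_iff by auto

lemma hausdorff_premeasure_mono:
  "S \<subseteq> T \<Longrightarrow> hausdorff_premeasure k \<delta> S \<le> hausdorff_premeasure k \<delta> T"
  unfolding hausdorff_premeasure_def by (intro INF_superset_mono) auto

lemma hausdorff_premeasure_antimono:
  "\<delta> \<le> \<epsilon> \<Longrightarrow> hausdorff_premeasure k \<epsilon> S \<le> hausdorff_premeasure k \<delta> S"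
  unfolding hausdorff_premeasure_def by (intro INF_superset_mono) (auto intro: order_trans)

lemma hausdorff_premeasure_empty: "0 \<le> \<delta> \<Longrightarrow> hausdorff_premeasure k \<delta> {} = 0"
  using hausdorff_premeasure_le[of "\<lambda>_. {}" \<delta> "{}" k] by simp

lemma hausdorff_premeasure_UN_le:
  "hausdorff_premeasure k \<delta> (\<Union>n::nat. S n) \<le> (\<Sum>n. hausdorff_premeasure k \<delta> (S n))"
proof (rule ennreal_le_epsilon)
  fix e :: real assume e: "0 < e" and "(\<Sum>n. hausdorff_premeasure k \<delta> (S n)) < top"
  then have *: "\<And>n. hausdorff_premeasure k \<delta> (S n) < hausdorff_premeasure k \<delta> (S n) + e * (1/2)^Suc n"
    by (auto simp add: less_top dest!: ennreal_suminf_lessD)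
  have "\<exists>B. (\<forall>i. bounded (B i) \<and> diameter (B i) \<le> \<delta>) \<and> S n \<subseteq> (\<Union>i. B i) \<and>
      (\<Sum>i. hausdorff_weight k (B i)) < hausdorff_premeasure k \<delta> (S n) + e * (1/2)^Suc n" for n
    using hausdorff_premeasure_close[OF *] .
  then obtain B where B: "\<And>n i. bounded (B n i)" "\<And>n i. diameter (B n i) \<le> \<delta>" "\<And>n. S n \<subseteq> (\<Union>i. B n i)"
    "\<And>n. (\<Sum>i. hausdorff_weight k (B n i)) < hausdorff_premeasure k \<delta> (S n) + e * (1/2)^Suc n"
    by metis
  define C where "C = case_prod B o prod_decode"
  have S_C: "(\<Union>i. S i) \<subseteq> (\<Union>i. C i)"
    using B(3) by (auto simp add: C_def subset_eq) (metis prod.case prod_encode_inverse)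
  have "hausdorff_premeasure k \<delta> (\<Union>n. S n) \<le> (\<Sum>i. hausdorff_weight k (C i))"
    using B S_C by (intro hausdorff_premeasure_le) (auto simp: C_def split_def)
  also have "\<dots> = (\<Sum>n. \<Sum>i. hausdorff_weight k (B n i))"
    unfolding C_def comp_def
    by (rule suminf_ennreal_2dimen[where f="\<lambda>p. hausdorff_weight k (case_prod B p)"]) auto
  also have "\<dots> \<le> (\<Sum>n. hausdorff_premeasure k \<delta> (S n) + e * (1/2) ^ Suc n)"
    using B(4) by (intro suminf_le) (auto intro: less_imp_le)
  also have "... = (\<Sum>n. hausdorff_premeasure k \<delta> (S n)) + (\<Sum>n. ennreal e * ennreal ((1/2) ^ Suc n))"
    using \<open>0 < e\<close> by (subst suminf_add[symmetric])
                     (auto simp del: ennreal_suminf_cmult simp add: ennreal_mult[symmetric])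
  also have "\<dots> = (\<Sum>n. hausdorff_premeasure k \<delta> (S n)) + e"
    unfolding ennreal_suminf_cmult
    by (subst suminf_ennreal_eq[OF zero_le_power power_half_series]) auto
  finally show "hausdorff_premeasure k \<delta> (\<Union>n. S n) \<le> (\<Sum>n. hausdorff_premeasure k \<delta> (S n)) + e" .
qed

lemma hausdorff_premeasure_le_outer: "0 < \<delta> \<Longrightarrow> hausdorff_premeasure k \<delta> S \<le> hausdorff_outer k S"
  unfolding hausdorff_outer_def by (rule SUP_upper) auto

lemma hausdorff_outer_leI:
  "(\<And>\<delta>. 0 < \<delta> \<Longrightarrow> hausdorff_premeasure k \<delta> S \<le> b) \<Longrightarrow> hausdorff_outer k S \<le> b"
  unfolding hausdorff_outer_def by (rule SUP_least) auto

lemma hausdorff_outer_mono: "S \<subseteq> T \<Longrightarrow> hausdorff_outer k S \<le> hausdorff_outer k T"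
  by (meson hausdorff_outer_leI hausdorff_premeasure_le_outer hausdorff_premeasure_mono order_trans)

lemma hausdorff_outer_empty [simp]: "hausdorff_outer k {} = 0"
  using hausdorff_outer_leI[of k "{}" 0] by (simp add: hausdorff_premeasure_empty)

lemma hausdorff_outer_UN_le: "hausdorff_outer k (\<Union>n::nat. S n) \<le> (\<Sum>n. hausdorff_outer k (S n))"
proof (rule hausdorff_outer_leI)
  fix \<delta> :: real assume "0 < \<delta>"
  then show "hausdorff_premeasure k \<delta> (\<Union>n. S n) \<le> (\<Sum>n. hausdorff_outer k (S n))"
    by (intro order_trans[OF hausdorff_premeasure_UN_le] suminf_le hausdorff_premeasure_le_outer) auto
qed

lemma hausdorff_outer_Un_le: "hausdorff_outer k (S \<union> T) \<le> hausdorff_outer k S + hausdorff_outer k T"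
proof -
  define f where "f = (\<lambda>n::nat. if n = 0 then S else if n = 1 then T else {})"
  have eq: "(\<Union>n. f n) = S \<union> T" unfolding f_def by (auto split: if_splits)
  have "(\<Sum>n. hausdorff_outer k (f n)) = (\<Sum>n\<in>{0,1}. hausdorff_outer k (f n))"
    by (rule suminf_finite) (auto simp: f_def)
  then show ?thesis using hausdorff_outer_UN_le[of k f] unfolding eq by (simp add: f_def)
qed

lemma hausdorff_outer_tendsto:
  "(\<lambda>n. hausdorff_premeasure k (1 / real (Suc n)) S) \<longlonglongrightarrow> hausdorff_outer k S"
proof -
  have "incseq (\<lambda>n. hausdorff_premeasure k (1 / real (Suc n)) S)"
    by (rule incseq_SucI) (auto intro!: hausdorff_premeasure_antimono simp: frac_le)
  then have "(\<lambda>n. hausdorff_premeasure k (1 / real (Suc n)) S) \<longlonglongrightarrow> (SUP n. hausdorff_premeasure k (1 / real (Suc n)) S)"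
    by (rule LIMSEQ_SUP)
  also have "(SUP n. hausdorff_premeasure k (1 / real (Suc n)) S) = hausdorff_outer k S"
  proof (rule antisym)
    show "(SUP n. hausdorff_premeasure k (1 / real (Suc n)) S) \<le> hausdorff_outer k S"
      by (rule SUP_least, rule hausdorff_premeasure_le_outer) auto
    show "hausdorff_outer k S \<le> (SUP n. hausdorff_premeasure k (1 / real (Suc n)) S)"
    proof (rule hausdorff_outer_leI)
      fix \<delta> :: real assume "0 < \<delta>"
      then obtain n where "1 / real (Suc n) < \<delta>" using nat_approx_posE by blast
      then have "hausdorff_premeasure k \<delta> S \<le> hausdorff_premeasure k (1 / real (Suc n)) S"
        by (intro hausdorff_premeasure_antimono) auto
      then show "hausdorff_premeasure k \<delta> S \<le> (SUP n. hausdorff_premeasure k (1 / real (Suc n)) S)"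
        by (rule order_trans) (rule SUP_upper, simp)
    qed
  qed
  finally show ?thesis .
qed

text \<open>
  A covering set of diameter at most \<open>\<delta>\<close> cannot meet both \<open>S\<close> and \<open>T\<close>, so each
  covering of the union splits into coverings of the two parts.
\<close>
lemma hausdorff_premeasure_separated:
  fixes S T :: "'a::metric_space set"
  assumes sep: "\<And>x y. x \<in> S \<Longrightarrow> y \<in> T \<Longrightarrow> \<delta> < dist x y"
  shows "hausdorff_premeasure k \<delta> S + hausdorff_premeasure k \<delta> T \<le> hausdorff_premeasure k \<delta> (S \<union> T)"
  unfolding hausdorff_premeasure_def[of k \<delta> "S \<union> T"]
proof (rule INF_greatest)
  fix A :: "nat \<Rightarrow> 'a set"
  assume "A \<in> {A. (\<forall>i. bounded (A i) \<and> diameter (A i) \<le> \<delta>) \<and> S \<union> T \<subseteq> (\<Union>i. A i)}"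
  then have A: "\<And>i. bounded (A i)" "\<And>i. diameter (A i) \<le> \<delta>" "S \<union> T \<subseteq> (\<Union>i. A i)" by auto
  \<comment> \<open>the covering sets are sorted by whether they meet \<open>S\<close>\<close>
  define AS where "AS = (\<lambda>i. if A i \<inter> S = {} then {} else A i)"
  define AT where "AT = (\<lambda>i. if A i \<inter> S = {} then A i else {})"
  have disj: "A i \<inter> T = {}" if "A i \<inter> S \<noteq> {}" for i
  proof (rule ccontr)
    assume "A i \<inter> T \<noteq> {}"
    then obtain x y where "x \<in> A i" "x \<in> S" "y \<in> A i" "y \<in> T" using \<open>A i \<inter> S \<noteq> {}\<close> by blast
    then show False using sep[of x y] diameter_bounded_bound[OF A(1)[of i], of x y] A(2)[of i] by auto
  qed
  have d0: "0 \<le> \<delta>" using A(2)[of 0] diameter_ge_0[OF A(1)[of 0]] by linarith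
  have "hausdorff_premeasure k \<delta> S \<le> (\<Sum>i. hausdorff_weight k (AS i))"
  proof (rule hausdorff_premeasure_le)
    show "S \<subseteq> (\<Union>i. AS i)"
    proof
      fix x assume x: "x \<in> S"
      then obtain i where "x \<in> A i" using A(3) by auto
      then have "x \<in> AS i" using x unfolding AS_def by auto
      then show "x \<in> (\<Union>i. AS i)" by blast
    qed
  qed (use A d0 in \<open>auto simp: AS_def\<close>)
  moreover have "hausdorff_premeasure k \<delta> T \<le> (\<Sum>i. hausdorff_weight k (AT i))"
  proof (rule hausdorff_premeasure_le)
    show "T \<subseteq> (\<Union>i. AT i)"
    proof
      fix x assume x: "x \<in> T"
      then obtain i where i: "x \<in> A i" using A(3) by auto
      then have "x \<in> AT i" using x disj[of i] unfolding AT_def by auto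
      then show "x \<in> (\<Union>i. AT i)" by blast
    qed
  qed (use A d0 in \<open>auto simp: AT_def\<close>)
  moreover have "(\<Sum>i. hausdorff_weight k (AS i)) + (\<Sum>i. hausdorff_weight k (AT i)) = (\<Sum>i. hausdorff_weight k (A i))"
  proof -
    have "hausdorff_weight k (AS i) + hausdorff_weight k (AT i) = hausdorff_weight k (A i)" for i
      by (simp add: AS_def AT_def)
    then show ?thesis by (simp add: suminf_add)
  qed
  ultimately show "hausdorff_premeasure k \<delta> S + hausdorff_premeasure k \<delta> T \<le> (\<Sum>i. hausdorff_weight k (A i))"
    by (metis add_mono)
qed

lemma hausdorff_outer_separated:
  fixes S T :: "'a::metric_space set"
  assumes r: "0 < r" and sep: "\<And>x y. x \<in> S \<Longrightarrow> y \<in> T \<Longrightarrow> r \<le> dist x y"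
  shows "hausdorff_outer k (S \<union> T) = hausdorff_outer k S + hausdorff_outer k T"
proof (rule antisym[OF hausdorff_outer_Un_le])
  obtain N where N: "1 / real (Suc N) < r" using r nat_approx_posE by blast
  have "hausdorff_premeasure k (1 / real (Suc n)) S + hausdorff_premeasure k (1 / real (Suc n)) T \<le> hausdorff_outer k (S \<union> T)"
    if "n \<ge> N" for n
  proof (rule order_trans[OF hausdorff_premeasure_separated hausdorff_premeasure_le_outer])
    fix x y assume xy: "x \<in> S" "y \<in> T"
    have "1 / real (Suc n) \<le> 1 / real (Suc N)" using that by (simp add: frac_le)
    then show "1 / real (Suc n) < dist x y" using sep[OF xy] N by linarith
  qed auto
  then show "hausdorff_outer k S + hausdorff_outer k T \<le> hausdorff_outer k (S \<union> T)"
    by (intro LIMSEQ_le_const2[OF tendsto_add[OF hausdorff_outer_tendsto hausdorff_outer_tendsto]]) blast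
qed

text \<open>
  Each layer is separated from the union of the earlier ones, so finitely many of them add up by induction.
\<close>
lemma hausdorff_outer_layers:
  fixes R :: "nat \<Rightarrow> 'a::metric_space set"
  assumes sep: "\<And>i j. i < j \<Longrightarrow> \<exists>r>0. \<forall>x\<in>R j. \<forall>y\<in>(\<Union>l\<le>i. R l). r \<le> dist x y"
  shows "(\<Sum>i. hausdorff_outer k (R i)) \<le> hausdorff_outer k (\<Union>i. R i)"
proof -
  have "(\<Sum>i<n. hausdorff_outer k (R i)) = hausdorff_outer k (\<Union>i<n. R i)" for n
  proof (induction n)
    case (Suc n)
    have "hausdorff_outer k (R n \<union> (\<Union>i<n. R i)) = hausdorff_outer k (R n) + hausdorff_outer k (\<Union>i<n. R i)"
    proof (cases n)
      case (Suc m)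
      then obtain r where r: "r > 0" "\<forall>x\<in>R n. \<forall>y\<in>(\<Union>l\<le>m. R l). r \<le> dist x y" using sep[of m n] by auto
      have "(\<Union>l\<le>m. R l) = (\<Union>i<n. R i)" using Suc by (simp add: lessThan_Suc_atMost)
      then show ?thesis using r by (intro hausdorff_outer_separated[OF r(1)]) auto
    qed simp
    moreover have "(\<Union>i<Suc n. R i) = R n \<union> (\<Union>i<n. R i)" by (simp add: lessThan_Suc)
    ultimately show ?case using Suc by (simp add: add.commute)
  qed simp
  then have "(\<Sum>i<n. hausdorff_outer k (R i)) \<le> hausdorff_outer k (\<Union>i. R i)" for n
    by (metis (no_types, lifting) UN_mono hausdorff_outer_mono order_refl subset_UNIV)
  then show ?thesis unfolding suminf_eq_SUP by (intro SUP_least)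
qed

text \<open>
  Caratheodory's criterion for metric outer measures. The part of \<open>T\<close> at distance at least
  \<open>a n\<close> from \<open>F\<close> is separated from \<open>F\<close>. What it misses of \<open>T - F\<close> is a union of layers of points
  whose distances lie between consecutive \<open>a i\<close>. The layers of equal parity are separated from each
  other, so the measures of all layers have a finite sum, and its tails tend to zero.
\<close>
lemma hausdorff_outer_closed_caratheodory:
  fixes F T :: "'a::metric_space set"
  assumes F: "closed F" 
  shows "hausdorff_outer k (F \<inter> T) + hausdorff_outer k (T - F) \<le> hausdorff_outer k T"
proof (cases "F = {} \<or> hausdorff_outer k T = top")
  case False
  then have Fne: "F \<noteq> {}" and fin: "hausdorff_outer k T \<noteq> top" by auto
  define d where "d = (\<lambda>x. infdist x F)"
  have dpos: "d x > 0" if "x \<notin> F" for x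
    using that F Fne unfolding d_def by (simp add: infdist_pos_not_in_closed)
  have d1: "d x \<le> d y + dist x y" for x y
    unfolding d_def by (simp add: infdist_triangle)
  have dF: "d y \<le> dist y x" if "x \<in> F" for x y unfolding d_def using infdist_le[OF that] .
  define a where "a = (\<lambda>n. 1 / real (Suc n))"
  have apos: "a n > 0" for n unfolding a_def by simp
  have adec: "a n < a m" if "m < n" for m n using that unfolding a_def by (simp add: frac_less2)
  have adec': "a n \<le> a m" if "m \<le> n" for m n using that unfolding a_def by (simp add: frac_le)
  define Tn where "Tn = (\<lambda>n. {x \<in> T. a n \<le> d x})"
  define R where "R = (\<lambda>n. {x \<in> T. a (Suc n) \<le> d x \<and> d x < a n})"
  have le1: "hausdorff_outer k (F \<inter> T) + hausdorff_outer k (Tn n) \<le> hausdorff_outer k T" for n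
  proof -
    have "hausdorff_outer k (F \<inter> T) + hausdorff_outer k (Tn n) = hausdorff_outer k (F \<inter> T \<union> Tn n)"
    proof (rule hausdorff_outer_separated[OF apos[of n], symmetric])
      fix x y assume "x \<in> F \<inter> T" "y \<in> Tn n"
      then show "a n \<le> dist x y" using dF[of x y] by (auto simp: Tn_def dist_commute)
    qed
    also have "\<dots> \<le> hausdorff_outer k T" by (rule hausdorff_outer_mono) (auto simp: Tn_def)
    finally show ?thesis .
  qed
  \<comment> \<open>layers of equal parity \<open>b\<close> are separated by the layer in between\<close>
  have sepR: "\<exists>r>0. \<forall>x\<in>R (2 * j + b). \<forall>y\<in>(\<Union>l\<le>i. R (2 * l + b)). r \<le> dist x y" if "i < j" for i j b
  proof (intro exI[of _ "a (2 * i + b + 1) - a (2 * j + b)"] conjI ballI)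
    show "0 < a (2 * i + b + 1) - a (2 * j + b)" using that by (simp add: adec)
    fix x y assume x: "x \<in> R (2 * j + b)" and "y \<in> (\<Union>l\<le>i. R (2 * l + b))"
    then obtain l where l: "l \<le> i" "y \<in> R (2 * l + b)" by auto
    have "a (2 * i + b + 1) \<le> a (2 * l + b + 1)" using l(1) by (intro adec') simp
    then have "a (2 * i + b + 1) \<le> d y" using l(2) unfolding R_def by auto
    moreover have "d x < a (2 * j + b)" using x unfolding R_def by auto
    ultimately show "a (2 * i + b + 1) - a (2 * j + b) \<le> dist x y"
      using d1[of y x] by (simp add: dist_commute)
  qed
  have half: "(\<Sum>i. hausdorff_outer k (R (2 * i + b))) \<le> hausdorff_outer k T" for b
    by (rule order_trans[OF hausdorff_outer_layers[OF sepR] hausdorff_outer_mono]) (auto simp: R_def)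
  have sumR: "(\<Sum>i. hausdorff_outer k (R i)) \<noteq> top"
  proof -
    have "(\<Sum>i<n. hausdorff_outer k (R i)) \<le> hausdorff_outer k T + hausdorff_outer k T" for n
    proof -
      have "{..<n} \<subseteq> (\<lambda>i. 2 * i) ` {..<n} \<union> (\<lambda>i. 2 * i + 1) ` {..<n}"
      proof
        fix m assume "m \<in> {..<n}"
        then show "m \<in> (\<lambda>i. 2 * i) ` {..<n} \<union> (\<lambda>i. 2 * i + 1) ` {..<n}"
          by (cases "even m") (auto elim!: evenE oddE)
      qed
      then have "(\<Sum>i<n. hausdorff_outer k (R i)) \<le> (\<Sum>i\<in>(\<lambda>i. 2 * i) ` {..<n} \<union> (\<lambda>i. 2 * i + 1) ` {..<n}. hausdorff_outer k (R i))"
        by (intro sum_mono2) auto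
      also have "\<dots> = (\<Sum>i\<in>(\<lambda>i. 2 * i) ` {..<n}. hausdorff_outer k (R i)) + (\<Sum>i\<in>(\<lambda>i. 2 * i + 1) ` {..<n}. hausdorff_outer k (R i))"
        by (rule sum.union_disjoint) (auto, presburger)
      also have "\<dots> = (\<Sum>i<n. hausdorff_outer k (R (2 * i + 0))) + (\<Sum>i<n. hausdorff_outer k (R (2 * i + 1)))"
        by (simp add: sum.reindex inj_on_def)
      also have "\<dots> \<le> (\<Sum>i. hausdorff_outer k (R (2 * i + 0))) + (\<Sum>i. hausdorff_outer k (R (2 * i + 1)))"
        by (intro add_mono sum_le_suminf) auto
      also have "\<dots> \<le> hausdorff_outer k T + hausdorff_outer k T"
        by (intro add_mono half)
      finally show ?thesis .
    qed
    then have "(\<Sum>i. hausdorff_outer k (R i)) \<le> hausdorff_outer k T + hausdorff_outer k T"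
      unfolding suminf_eq_SUP by (intro SUP_least)
    moreover have "hausdorff_outer k T + hausdorff_outer k T < top" using fin by (simp add: less_top)
    ultimately show ?thesis by (metis leD)
  qed
  have "T - F \<subseteq> Tn n \<union> (\<Union>i. R (i + n))" for n
  proof
    fix x assume x: "x \<in> T - F"
    show "x \<in> Tn n \<union> (\<Union>i. R (i + n))"
    proof (cases "a n \<le> d x")
      case False
      obtain N where N: "a N < d x" using nat_approx_posE[OF dpos[of x]] x unfolding a_def by auto
      define m where "m = (LEAST m. a m \<le> d x)"
      have m: "a m \<le> d x" unfolding m_def using LeastI[of "\<lambda>m. a m \<le> d x" N] N by simp
      have "m > n" using False m adec'[of m n] by (meson not_le order_trans)
      then obtain l where l: "m = Suc l" "n \<le> l" by (metis Suc_leI less_iff_Suc_add le_add1)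
      have "\<not> a l \<le> d x" using not_less_Least[of l "\<lambda>m. a m \<le> d x"] l(1) unfolding m_def by simp
      then have "x \<in> R (l - n + n)" using m l x unfolding R_def by auto
      then show ?thesis by blast
    qed (use x in \<open>auto simp: Tn_def\<close>)
  qed
  then have le2: "hausdorff_outer k (T - F) \<le> hausdorff_outer k (Tn n) + (\<Sum>i. hausdorff_outer k (R (i + n)))" for n
    by (rule order_trans[OF hausdorff_outer_mono order_trans[OF hausdorff_outer_Un_le add_left_mono[OF hausdorff_outer_UN_le]]])
  have le3: "hausdorff_outer k (F \<inter> T) + hausdorff_outer k (T - F) \<le> hausdorff_outer k T + (\<Sum>i. hausdorff_outer k (R (i + n)))" for n
  proof -
    have "hausdorff_outer k (F \<inter> T) + hausdorff_outer k (T - F)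
       \<le> hausdorff_outer k (F \<inter> T) + (hausdorff_outer k (Tn n) + (\<Sum>i. hausdorff_outer k (R (i + n))))"
      by (intro add_left_mono le2)
    also have "\<dots> \<le> hausdorff_outer k T + (\<Sum>i. hausdorff_outer k (R (i + n)))"
      unfolding add.assoc[symmetric] by (intro add_right_mono le1)
    finally show ?thesis .
  qed
  have tail: "(\<lambda>n. \<Sum>i. hausdorff_outer k (R (i + n))) \<longlonglongrightarrow> 0"
  proof -
    define f where "f = (\<lambda>i. enn2real (hausdorff_outer k (R i)))"
    have e: "hausdorff_outer k (R i) = ennreal (f i)" for i
      unfolding f_def using ennreal_suminf_lessD[of "\<lambda>i. hausdorff_outer k (R i)" top i] sumR
      by (simp add: less_top)
    have f0: "0 \<le> f i" for i unfolding f_def by simp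
    have sf: "summable f" by (rule summable_suminf_not_top[OF f0]) (use sumR e in simp)
    have "(\<lambda>n. ennreal (\<Sum>i. f (i + n))) \<longlonglongrightarrow> ennreal 0"
      by (rule tendsto_ennrealI[OF suminf_exist_split2[OF sf]])
    moreover have "ennreal (\<Sum>i. f (i + n)) = (\<Sum>i. hausdorff_outer k (R (i + n)))" for n
      unfolding e using f0 sf by (intro suminf_ennreal2[symmetric]) (auto simp: summable_iff_shift)
    ultimately show ?thesis by simp
  qed
  have "(\<lambda>n. hausdorff_outer k T + (\<Sum>i. hausdorff_outer k (R (i + n)))) \<longlonglongrightarrow> hausdorff_outer k T + 0"
    by (intro tendsto_add tendsto_const tail)
  then show ?thesis using LIMSEQ_le_const le3 by fastforce
qed auto

lemma hausdorff_measure_space: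
  "measure_space UNIV (sets borel) (hausdorff_outer k :: 'a::metric_space set \<Rightarrow> ennreal)"
proof -
  let ?O = "hausdorff_outer k :: 'a set \<Rightarrow> ennreal"
  interpret P: sigma_algebra UNIV "UNIV :: 'a set set"
    using sigma_algebra_Pow[of "UNIV :: 'a set"] by simp
  have oms: "outer_measure_space UNIV ?O"
    unfolding outer_measure_space_def positive_def increasing_def countably_subadditive_def
    using hausdorff_outer_mono hausdorff_outer_UN_le by auto
  have ms: "measure_space UNIV (lambda_system UNIV UNIV ?O) ?O"
    using P.caratheodory_lemma[OF oms] .
  then interpret L: sigma_algebra UNIV "lambda_system UNIV UNIV ?O"
    by (simp add: measure_space_def)
  have "closed F \<Longrightarrow> F \<in> lambda_system UNIV UNIV ?O" for F
  proof -
    assume F: "closed F"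
    have "?O (F \<inter> T) + ?O ((UNIV - F) \<inter> T) = ?O T" for T
    proof (rule antisym)
      have "(UNIV - F) \<inter> T = T - F" by auto
      then show "?O (F \<inter> T) + ?O ((UNIV - F) \<inter> T) \<le> ?O T"
        using hausdorff_outer_closed_caratheodory[OF F, of k T] by simp
      have "?O T = ?O (F \<inter> T \<union> (UNIV - F) \<inter> T)" by (rule arg_cong[where f = ?O]) auto
      also have "\<dots> \<le> ?O (F \<inter> T) + ?O ((UNIV - F) \<inter> T)" by (rule hausdorff_outer_Un_le)
      finally show "?O T \<le> ?O (F \<inter> T) + ?O ((UNIV - F) \<inter> T)" .
    qed
    then show ?thesis by (simp add: lambda_system_def)
  qed
  then have "sigma_sets UNIV (Collect closed) \<subseteq> lambda_system UNIV UNIV ?O"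
    by (intro L.sigma_sets_subset) auto
  then have "sets (borel :: 'a measure) \<subseteq> lambda_system UNIV UNIV ?O"
    by (simp add: borel_eq_closed)
  then show ?thesis
    using measure_down[OF ms _] sets.sigma_algebra_axioms[of "borel :: 'a measure"] by simp
qed

lemma sets_hausdorff_measure [simp, measurable_cong]: "sets (hausdorff_measure k) = sets borel"
  unfolding hausdorff_measure_def by (simp add: sets.sigma_sets_eq[of borel, simplified])

lemma space_hausdorff_measure [simp]: "space (hausdorff_measure k) = UNIV"
  unfolding hausdorff_measure_def by simp

lemma emeasure_hausdorff_measure:
  fixes S :: "'a::metric_space set"
  assumes "S \<in> sets borel"
  shows "emeasure (hausdorff_measure k) S = hausdorff_outer k S"
proof -
  have "measure_space UNIV (sigma_sets UNIV (sets borel)) (hausdorff_outer k :: 'a set \<Rightarrow> ennreal)"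
    using hausdorff_measure_space[of k] by (simp add: sets.sigma_sets_eq[of borel, simplified])
  then show ?thesis
    unfolding hausdorff_measure_def using assms
    by (intro emeasure_measure_of_sigma)
       (auto simp: measure_space_def sets.sigma_sets_eq[of borel, simplified])
qed

lemma hausdorff_outer_lipschitz_image:
  fixes f :: "'a::metric_space \<Rightarrow> 'b::metric_space"
  assumes L: "0 < L" and lip: "\<And>x y. x \<in> S \<Longrightarrow> y \<in> S \<Longrightarrow> dist (f x) (f y) \<le> L * dist x y"
  shows "hausdorff_outer k (f ` S) \<le> ennreal (L ^ k) * hausdorff_outer k S"
proof (rule hausdorff_outer_leI)
  fix \<delta> :: real assume d: "0 < \<delta>"
  have *: "hausdorff_premeasure k \<delta> (f ` S) \<le> ennreal (L ^ k) * (\<Sum>i. hausdorff_weight k (A i))"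
    if A: "\<And>i. bounded (A i)" "\<And>i. diameter (A i) \<le> \<delta> / L" "S \<subseteq> (\<Union>i. A i)" for A :: "nat \<Rightarrow> 'a set"
  proof -
    define B where "B = (\<lambda>i. f ` (A i \<inter> S))"
    have db: "dist x y \<le> L * diameter (A i)" if xy: "x \<in> B i" "y \<in> B i" for x y i
    proof -
      obtain x' y' where x': "x' \<in> A i" "x' \<in> S" "y' \<in> A i" "y' \<in> S" "x = f x'" "y = f y'"
        using xy unfolding B_def by auto
      have "dist x y \<le> L * dist x' y'" using lip x' by auto
      also have "\<dots> \<le> L * diameter (A i)" using diameter_bounded_bound[OF A(1) x'(1,3)] L by simp
      finally show ?thesis .
    qed
    have bB: "bounded (B i)" for i
    proof (cases "B i = {}")
      case False
      then obtain x where "x \<in> B i" by auto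
      then show ?thesis unfolding bounded_def using db[of x i] by blast
    qed simp
    have dB: "diameter (B i) \<le> L * diameter (A i)" for i
      using db[of _ i] L diameter_ge_0[OF A(1)[of i]] unfolding diameter_def[of "B i"]
      by (auto intro!: cSUP_least)
    have "hausdorff_premeasure k \<delta> (f ` S) \<le> (\<Sum>i. hausdorff_weight k (B i))"
    proof (rule hausdorff_premeasure_le[OF bB])
      show "diameter (B i) \<le> \<delta>" for i
      proof -
        have "L * diameter (A i) \<le> L * (\<delta> / L)" using A(2)[of i] L by (intro mult_left_mono) auto
        then show ?thesis using dB[of i] L by simp
      qed
      show "f ` S \<subseteq> (\<Union>i. B i)"
      proof
        fix y assume "y \<in> f ` S"
        then obtain x i where "x \<in> S" "y = f x" "x \<in> A i" using A(3) by auto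
        then have "y \<in> B i" unfolding B_def by auto
        then show "y \<in> (\<Union>i. B i)" by blast
      qed
    qed
    also have "\<dots> \<le> (\<Sum>i. ennreal (L ^ k) * hausdorff_weight k (A i))"
    proof (rule suminf_le)
      fix i
      show "hausdorff_weight k (B i) \<le> ennreal (L ^ k) * hausdorff_weight k (A i)"
      proof (cases "B i = {}")
        case False
        then have Ai: "A i \<noteq> {}" unfolding B_def by auto
        have "(diameter (B i) / 2) ^ k \<le> (L * diameter (A i) / 2) ^ k"
          using dB[of i] diameter_ge_0[OF bB] by (intro power_mono) auto
        also have "\<dots> = L ^ k * (diameter (A i) / 2) ^ k" by (simp add: power_mult_distrib power_divide)
        finally have "unit_ball_vol (real k) * (diameter (B i) / 2) ^ k
           \<le> L ^ k * (unit_ball_vol (real k) * (diameter (A i) / 2) ^ k)"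
          using mult_left_mono[of "(diameter (B i) / 2) ^ k" _ "unit_ball_vol (real k)"] by (simp add: mult_ac)
        then show ?thesis using False Ai L unfolding hausdorff_weight_def
          by (simp add: ennreal_mult'[symmetric] ennreal_leI)
      qed simp
    qed auto
    also have "\<dots> = ennreal (L ^ k) * (\<Sum>i. hausdorff_weight k (A i))" by simp
    finally show ?thesis .
  qed
  have "hausdorff_premeasure k \<delta> (f ` S) \<le> ennreal (L ^ k) * hausdorff_premeasure k (\<delta> / L) S"
  proof -
    have Lk: "0 < L ^ k" using L by simp
    have "hausdorff_premeasure k \<delta> (f ` S) / ennreal (L ^ k) \<le> hausdorff_premeasure k (\<delta> / L) S"
      unfolding hausdorff_premeasure_def[of k "\<delta> / L" S]
    proof (rule INF_greatest)
      fix A :: "nat \<Rightarrow> 'a set"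
      assume "A \<in> {A. (\<forall>i. bounded (A i) \<and> diameter (A i) \<le> \<delta> / L) \<and> S \<subseteq> (\<Union>i. A i)}"
      then have "hausdorff_premeasure k \<delta> (f ` S) \<le> ennreal (L ^ k) * (\<Sum>i. hausdorff_weight k (A i))"
        using * by auto
      then show "hausdorff_premeasure k \<delta> (f ` S) / ennreal (L ^ k) \<le> (\<Sum>i. hausdorff_weight k (A i))"
        using Lk by (simp add: divide_le_posI_ennreal mult.commute)
    qed
    then have "ennreal (L ^ k) * (hausdorff_premeasure k \<delta> (f ` S) / ennreal (L ^ k))
        \<le> ennreal (L ^ k) * hausdorff_premeasure k (\<delta> / L) S"
      by (intro mult_left_mono) auto
    moreover have "ennreal (L ^ k) * (hausdorff_premeasure k \<delta> (f ` S) / ennreal (L ^ k)) = hausdorff_premeasure k \<delta> (f ` S)"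
    proof -
      have "ennreal (L ^ k) * (x / ennreal (L ^ k)) = x" for x
        using L mult_divide_eq_ennreal[of "ennreal (L ^ k)" x]
        by (simp only: ennreal_times_divide mult.commute[of "ennreal (L ^ k)" x]) simp
      then show ?thesis .
    qed
    ultimately show ?thesis by simp
  qed
  also have "\<dots> \<le> ennreal (L ^ k) * hausdorff_outer k S"
    using d L by (intro mult_left_mono hausdorff_premeasure_le_outer) auto
  finally show "hausdorff_premeasure k \<delta> (f ` S) \<le> ennreal (L ^ k) * hausdorff_outer k S" .
qed

lemma hausdorff_weight_ball_le:
  fixes a :: "'a::euclidean_space"
  assumes "0 < r"
  shows "hausdorff_weight DIM('a) (ball a r) \<le> emeasure lborel (ball a r)"
proof -
  have "diameter (ball a r) / 2 \<le> r" using assms by simp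
  then have "(diameter (ball a r) / 2) ^ DIM('a) \<le> r ^ DIM('a)"
    using diameter_ge_0[OF bounded_ball, of a r] by (intro power_mono) auto
  then show ?thesis
    using assms by (auto simp: hausdorff_weight_def emeasure_ball intro!: ennreal_leI mult_left_mono)
qed

lemma sum_disjoint_balls_le:
  fixes a :: "'i \<Rightarrow> 'a::euclidean_space"
  assumes "countable C" "pairwise (\<lambda>i j. disjnt (ball (a i) (r i)) (ball (a j) (r j))) C"
    and "\<And>i. i \<in> C \<Longrightarrow> ball (a i) (r i) \<subseteq> U" "open U"
  shows "(\<integral>\<^sup>+i. emeasure lborel (ball (a i) (r i)) \<partial>count_space C) \<le> emeasure lborel U"
proof -
  have "(\<integral>\<^sup>+i. emeasure lborel (ball (a i) (r i)) \<partial>count_space C) = emeasure lborel (\<Union>i\<in>C. ball (a i) (r i))"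
    using assms by (intro emeasure_UN_countable[symmetric])
      (auto simp: disjoint_family_on_def pairwise_def disjnt_def)
  also have "\<dots> \<le> emeasure lborel U" using assms by (intro emeasure_mono) auto
  finally show ?thesis .
qed

lemma hausdorff_premeasure_countable_cover:
  fixes A :: "'i \<Rightarrow> 'a::metric_space set"
  assumes C: "countable C" and A: "\<And>i. i \<in> C \<Longrightarrow> bounded (A i)" "\<And>i. i \<in> C \<Longrightarrow> diameter (A i) \<le> \<delta>"
    and S: "S \<subseteq> (\<Union>i\<in>C. A i)" and d: "0 \<le> \<delta>"
  shows "hausdorff_premeasure k \<delta> S \<le> (\<integral>\<^sup>+i. hausdorff_weight k (A i) \<partial>count_space C)"
proof -
  define B where "B = (\<lambda>n. if n \<in> to_nat_on C ` C then A (from_nat_into C n) else {})"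
  have inv: "from_nat_into C (to_nat_on C i) = i" if "i \<in> C" for i using that C by simp
  have "hausdorff_premeasure k \<delta> S \<le> (\<Sum>n. hausdorff_weight k (B n))"
  proof (rule hausdorff_premeasure_le)
    show "S \<subseteq> (\<Union>n. B n)"
    proof
      fix x assume "x \<in> S"
      then obtain i where i: "i \<in> C" "x \<in> A i" using S by auto
      then have "x \<in> B (to_nat_on C i)" unfolding B_def using inv by auto
      then show "x \<in> (\<Union>n. B n)" by blast
    qed
  qed (use A d inv in \<open>auto simp: B_def\<close>)
  also have "\<dots> = (\<integral>\<^sup>+n. hausdorff_weight k (B n) \<partial>count_space UNIV)"
    by (rule nn_integral_count_space_nat[symmetric])
  also have "\<dots> = (\<integral>\<^sup>+n. hausdorff_weight k (A (from_nat_into C n)) \<partial>count_space (to_nat_on C ` C))"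
    by (subst nn_integral_count_space_indicator) (auto intro!: nn_integral_cong simp: B_def indicator_def)
  also have "\<dots> = (\<integral>\<^sup>+i. hausdorff_weight k (A i) \<partial>count_space C)"
    using inj_on_to_nat_on[OF C]
    by (subst nn_integral_bij_count_space[where g="to_nat_on C" and A=C, symmetric])
       (auto simp: inj_on_imp_bij_betw inv intro!: nn_integral_cong)
  finally show ?thesis .
qed

text \<open>
  An open neighbourhood of small volume contains disjoint balls whose fivefold enlargements
  still cover the set (Vitali), and enlarging multiplies volumes only by a constant.
\<close>
lemma hausdorff_outer_negligible:
  fixes N :: "'a::euclidean_space set"
  assumes N: "negligible N"
  shows "hausdorff_outer DIM('a) N = 0"
proof -
  have "hausdorff_outer DIM('a) N \<le> 0"
  proof (rule hausdorff_outer_leI)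
    fix \<delta> :: real assume d: "0 < \<delta>"
    show "hausdorff_premeasure DIM('a) \<delta> N \<le> 0"
    proof (rule ennreal_le_epsilon)
      fix e :: real assume e: "0 < e"
      define e' where "e' = e / 5 ^ DIM('a)"
      have e': "0 < e'" unfolding e'_def using e by simp
      obtain T where T: "open T" "N \<subseteq> T" "emeasure lebesgue (T - N) < ennreal e'"
        using sets_lebesgue_outer_open[OF negligible_imp_sets[OF N] e'] .
      have "emeasure lebesgue T = emeasure lebesgue (T - N)"
        using T N by (intro emeasure_Diff_null_set[symmetric]) (auto simp: negligible_iff_null_sets)
      then have eT: "emeasure lborel T \<le> ennreal e'" using T by simp
      define K where "K = {(x, r). x \<in> N \<and> 0 < r \<and> r \<le> \<delta> / 10 \<and> ball x r \<subseteq> T}"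
      have cov: "N \<subseteq> (\<Union>i\<in>K. ball (fst i) (snd i))"
      proof
        fix x assume x: "x \<in> N"
        then obtain r where r: "0 < r" "ball x r \<subseteq> T" using T openE by blast
        then have "(x, min r (\<delta> / 10)) \<in> K" using x d unfolding K_def by auto
        then show "x \<in> (\<Union>i\<in>K. ball (fst i) (snd i))"
          using r d by (intro UN_I[of "(x, min r (\<delta> / 10))"]) auto
      qed
      obtain C where C: "countable C" "C \<subseteq> K"
        "pairwise (\<lambda>i j. disjnt (ball (fst i) (snd i)) (ball (fst j) (snd j))) C"
        "N \<subseteq> (\<Union>i\<in>C. ball (fst i) (5 * snd i))"
      proof (rule Vitali_covering_lemma_balls[OF cov])
        show "0 < snd i \<and> snd i \<le> \<delta> / 10" if "i \<in> K" for i using that unfolding K_def by auto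
      qed
      have CK: "0 < snd i" "snd i \<le> \<delta> / 10" "ball (fst i) (snd i) \<subseteq> T" if "i \<in> C" for i
      proof -
        have "i \<in> K" using that C(2) by blast
        then show "0 < snd i" "snd i \<le> \<delta> / 10" "ball (fst i) (snd i) \<subseteq> T" by (simp_all add: K_def case_prod_beta)
      qed
      have "hausdorff_premeasure DIM('a) \<delta> N \<le> (\<integral>\<^sup>+i. hausdorff_weight DIM('a) (ball (fst i) (5 * snd i)) \<partial>count_space C)"
        using C CK d by (intro hausdorff_premeasure_countable_cover) force+
      also have "\<dots> \<le> (\<integral>\<^sup>+i. ennreal (5 ^ DIM('a)) * emeasure lborel (ball (fst i) (snd i)) \<partial>count_space C)"
      proof (rule nn_integral_mono)
        fix i assume "i \<in> space (count_space C)"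
        then have i: "0 < snd i" using CK by simp
        have "hausdorff_weight DIM('a) (ball (fst i) (5 * snd i)) \<le> emeasure lborel (ball (fst i) (5 * snd i))"
          using i by (intro hausdorff_weight_ball_le) simp
        also have "\<dots> = ennreal (5 ^ DIM('a)) * emeasure lborel (ball (fst i) (snd i))"
          using i by (simp add: emeasure_ball power_mult_distrib ennreal_mult'[symmetric] mult_ac)
        finally show "hausdorff_weight DIM('a) (ball (fst i) (5 * snd i)) \<le> \<dots>" .
      qed
      also have "\<dots> = ennreal (5 ^ DIM('a)) * (\<integral>\<^sup>+i. emeasure lborel (ball (fst i) (snd i)) \<partial>count_space C)"
        by (rule nn_integral_cmult) simp
      also have "\<dots> \<le> ennreal (5 ^ DIM('a)) * ennreal e'"
        using CK T(1) by (intro mult_left_mono order_trans[OF sum_disjoint_balls_le[OF C(1,3), of T] eT]) auto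
      also have "\<dots> = ennreal e" unfolding e'_def using e by (simp add: ennreal_mult'[symmetric])
      finally show "hausdorff_premeasure DIM('a) \<delta> N \<le> 0 + ennreal e" by simp
    qed
  qed
  then show ?thesis by simp
qed

text \<open>
  By Vitali's theorem an open set is, up to a negligible set, a disjoint union of arbitrarily small
  balls, and the weight of a ball is at most its volume.
\<close>
lemma hausdorff_outer_le_open:
  fixes U :: "'a::euclidean_space set"
  assumes U: "open U"
  shows "hausdorff_outer DIM('a) U \<le> emeasure lborel U"
proof (rule hausdorff_outer_leI)
  fix \<delta> :: real assume d: "0 < \<delta>"
  define K where "K = {(x, r). x \<in> U \<and> 0 < r \<and> r \<le> \<delta> / 2 \<and> ball x r \<subseteq> U}"
  have "\<exists>i. i \<in> K \<and> x \<in> ball (fst i) (snd i) \<and> snd i < t" if x: "x \<in> U" "0 < t" for x t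
  proof -
    obtain r where r: "0 < r" "ball x r \<subseteq> U" using x U openE by blast
    define s where "s = min r (min (\<delta> / 2) (t / 2))"
    have "0 < s" "s \<le> r" "s \<le> \<delta> / 2" "s < t" unfolding s_def using r d x by auto
    moreover have "ball x s \<subseteq> U" using \<open>s \<le> r\<close> r(2) by (auto simp: subset_iff)
    ultimately show ?thesis using x unfolding K_def by (intro exI[of _ "(x, s)"]) auto
  qed
  then obtain C where C: "countable C" "C \<subseteq> K"
    "pairwise (\<lambda>i j. disjnt (ball (fst i) (snd i)) (ball (fst j) (snd j))) C"
    "negligible (U - (\<Union>i\<in>C. ball (fst i) (snd i)))"
    by (rule Vitali_covering_theorem_balls)
  have CK: "0 < snd i" "snd i \<le> \<delta> / 2" "ball (fst i) (snd i) \<subseteq> U" if "i \<in> C" for i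
  proof -
    have "i \<in> K" using that C(2) by blast
    then show "0 < snd i" "snd i \<le> \<delta> / 2" "ball (fst i) (snd i) \<subseteq> U" by (simp_all add: K_def case_prod_beta)
  qed
  define V where "V = (\<Union>i\<in>C. ball (fst i) (snd i))"
  have "hausdorff_premeasure DIM('a) \<delta> V \<le> (\<integral>\<^sup>+i. hausdorff_weight DIM('a) (ball (fst i) (snd i)) \<partial>count_space C)"
    unfolding V_def using C(1) CK d by (intro hausdorff_premeasure_countable_cover) force+
  also have "\<dots> \<le> (\<integral>\<^sup>+i. emeasure lborel (ball (fst i) (snd i)) \<partial>count_space C)"
    using CK by (intro nn_integral_mono hausdorff_weight_ball_le) auto
  also have "\<dots> \<le> emeasure lborel U" using C CK U by (intro sum_disjoint_balls_le) auto
  finally have 1: "hausdorff_premeasure DIM('a) \<delta> V \<le> emeasure lborel U" .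
  have 2: "hausdorff_premeasure DIM('a) \<delta> (U - V) \<le> 0"
    using hausdorff_outer_negligible[OF C(4)] hausdorff_premeasure_le_outer[OF d, of "DIM('a)" "U - V"] unfolding V_def by simp
  define f where "f = (\<lambda>n::nat. if n = 0 then V else if n = 1 then U - V else {})"
  have "hausdorff_premeasure DIM('a) \<delta> U \<le> hausdorff_premeasure DIM('a) \<delta> (\<Union>n. f n)"
    by (rule hausdorff_premeasure_mono) (auto simp: f_def split: if_splits)
  also have "\<dots> \<le> (\<Sum>n. hausdorff_premeasure DIM('a) \<delta> (f n))" by (rule hausdorff_premeasure_UN_le)
  also have "\<dots> = (\<Sum>n\<in>{0,1}. hausdorff_premeasure DIM('a) \<delta> (f n))"
    using d by (intro suminf_finite) (auto simp: f_def hausdorff_premeasure_empty)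
  also have "\<dots> \<le> emeasure lborel U" using 1 2 by (simp add: f_def)
  finally show "hausdorff_premeasure DIM('a) \<delta> U \<le> emeasure lborel U" .
qed

text \<open>
  Outer regularity reduces the upper bound to open sets. The lower bound follows from the isodiametric
  inequality for the closures of the sets of a covering.
\<close>
theorem hausdorff_outer_eq_lborel:
  fixes S :: "'a::euclidean_space set"
  assumes S: "S \<in> sets borel"
  shows "hausdorff_outer DIM('a) S = emeasure lborel S"
proof (rule antisym)
  show "hausdorff_outer DIM('a) S \<le> emeasure lborel S"
  proof (rule ennreal_le_epsilon)
    fix e :: real assume e: "0 < e"
    have S': "S \<in> sets lebesgue" using S by simp
    obtain T where T: "open T" "S \<subseteq> T" "emeasure lebesgue (T - S) < ennreal e"
      using sets_lebesgue_outer_open[OF S' e] .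
    have "hausdorff_outer DIM('a) S \<le> emeasure lborel T"
      using hausdorff_outer_mono[OF T(2)] hausdorff_outer_le_open[OF T(1)] by (rule order_trans)
    also have "T = S \<union> (T - S)" using T(2) by auto
    also have "emeasure lborel (S \<union> (T - S)) \<le> emeasure lborel S + emeasure lborel (T - S)"
      using S T(1) by (intro emeasure_subadditive) auto
    also have "\<dots> \<le> emeasure lborel S + ennreal e"
      using T(3) S T(1) by (intro add_left_mono) (simp add: less_imp_le)
    finally show "hausdorff_outer DIM('a) S \<le> emeasure lborel S + ennreal e" .
  qed
  have "emeasure lborel S \<le> hausdorff_premeasure DIM('a) 1 S"
    unfolding hausdorff_premeasure_def
  proof (rule INF_greatest)
    fix A :: "nat \<Rightarrow> 'a set"
    assume "A \<in> {A. (\<forall>i. bounded (A i) \<and> diameter (A i) \<le> 1) \<and> S \<subseteq> (\<Union>i. A i)}"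
    then have A: "\<And>i. bounded (A i)" "S \<subseteq> (\<Union>i. A i)" by auto
    have w: "emeasure lborel (closure (A i)) \<le> hausdorff_weight DIM('a) (A i)" for i
    proof (cases "A i = {}")
      case False
      have b: "bounded (closure (A i))" using A(1) by (rule bounded_closure)
      have "emeasure lborel (closure (A i)) = ennreal (measure lborel (closure (A i)))"
        using emeasure_bounded_finite[OF b] by (intro emeasure_eq_ennreal_measure) (simp add: less_top)
      also have "\<dots> \<le> ennreal (unit_ball_vol (real DIM('a)) * (diameter (closure (A i)) / 2) ^ DIM('a))"
        using False by (intro ennreal_leI isodiametric_inequality b) auto
      also have "diameter (closure (A i)) = diameter (A i)" using A(1) by (rule diameter_closure)
      finally show ?thesis using False by (simp add: hausdorff_weight_def)
    qed simp
    have "emeasure lborel S \<le> emeasure lborel (\<Union>i. closure (A i))"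
    proof (rule emeasure_mono)
      show "S \<subseteq> (\<Union>i. closure (A i))"
        by (rule order_trans[OF A(2) UN_mono]) (use closure_subset in auto)
    qed auto
    also have "\<dots> \<le> (\<Sum>i. emeasure lborel (closure (A i)))"
      by (rule emeasure_subadditive_countably) auto
    also have "\<dots> \<le> (\<Sum>i. hausdorff_weight DIM('a) (A i))" by (intro suminf_le w) auto
    finally show "emeasure lborel S \<le> (\<Sum>i. hausdorff_weight DIM('a) (A i))" .
  qed
  also have "\<dots> \<le> hausdorff_outer DIM('a) S" by (rule hausdorff_premeasure_le_outer) simp
  finally show "emeasure lborel S \<le> hausdorff_outer DIM('a) S" .
qed

section \<open>Volume of cones over subsets of a hyperplane\<close>

lemma hausdorff_outer_isometric_image:
  fixes f :: "'a::metric_space \<Rightarrow> 'b::metric_space"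
  assumes iso: "\<And>x y. x \<in> S \<Longrightarrow> y \<in> S \<Longrightarrow> dist (f x) (f y) = dist x y"
  shows "hausdorff_outer k (f ` S) = hausdorff_outer k S"
proof (rule antisym)
  show "hausdorff_outer k (f ` S) \<le> hausdorff_outer k S"
    using hausdorff_outer_lipschitz_image[of 1 S f k] iso by simp
  have inj: "inj_on f S" using iso by (metis dist_eq_0_iff inj_onI)
  have "hausdorff_outer k (inv_into S f ` f ` S) \<le> ennreal (1 ^ k) * hausdorff_outer k (f ` S)"
  proof (rule hausdorff_outer_lipschitz_image)
    fix x y assume "x \<in> f ` S" "y \<in> f ` S"
    then obtain a b where "a \<in> S" "b \<in> S" "x = f a" "y = f b" by auto
    then show "dist (inv_into S f x) (inv_into S f y) \<le> 1 * dist x y"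
      using iso inj by simp
  qed simp
  then show "hausdorff_outer k S \<le> hausdorff_outer k (f ` S)" using inj by simp
qed

lemma emeasure_lborel_scale_vimage:
  fixes A :: "'a::euclidean_space set"
  assumes c: "0 < c" and A: "A \<in> sets borel"
  shows "emeasure lborel A = ennreal (c ^ DIM('a)) * emeasure lborel ((\<lambda>x. c *\<^sub>R x) -` A)"
proof -
  have eq: "(lborel :: 'a measure) = density (distr lborel borel (\<lambda>x. 0 + c *\<^sub>R x)) (\<lambda>_. \<bar>c\<bar> ^ DIM('a))"
    using c by (intro lborel_affine) simp
  have "emeasure lborel A = ennreal (c ^ DIM('a)) * emeasure (distr lborel borel (\<lambda>x::'a. 0 + c *\<^sub>R x)) A"
    using c A by (subst eq) (simp add: emeasure_density_const)
  also have "emeasure (distr lborel borel (\<lambda>x::'a. 0 + c *\<^sub>R x)) A = emeasure lborel ((\<lambda>x. c *\<^sub>R x) -` A)"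
    using A by (subst emeasure_distr) auto
  finally show ?thesis .
qed

text \<open>
  The union of the segments from the origin to the points of \<open>F\<close>, without the origin, for \<open>F\<close>
  in the hyperplane at height \<open>h\<close> in the direction \<open>v\<close>. The description by rescaling \<open>x\<close> into the
  hyperplane makes it a preimage and hence a Borel set.
\<close>
definition cone_below :: "'b::euclidean_space \<Rightarrow> real \<Rightarrow> 'b set \<Rightarrow> 'b set" where
  "cone_below v h F = {x. 0 < v \<bullet> x \<and> v \<bullet> x \<le> h \<and> (h / (v \<bullet> x)) *\<^sub>R x \<in> F}"

lemma cone_below_measurable [measurable]:
  assumes "F \<in> sets borel" shows "cone_below v h F \<in> sets borel"
proof -
  have "cone_below v h F = {x. 0 < v \<bullet> x \<and> v \<bullet> x \<le> h} \<inter> ((\<lambda>x. (h / (v \<bullet> x)) *\<^sub>R x) -` F \<inter> space borel)"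
    by (auto simp: cone_below_def)
  moreover have "(\<lambda>x. (h / (v \<bullet> x)) *\<^sub>R x) \<in> borel_measurable borel" by measurable
  ultimately show ?thesis using assms by (auto intro!: sets.Int measurable_sets)
qed

text \<open>
  The hyperplane is parametrised isometrically by a space \<open>'a\<close> of one dimension less. Isometries
  preserve Hausdorff measure and hence, in full dimension, Lebesgue measure. So the cone can be
  computed in \<open>'a \<times> real\<close>, where the slice at height \<open>s\<close> is a copy of the base scaled by \<open>s / h\<close>.
\<close>
lemma cone_volume_over_hyperplane_isometry:
  fixes F :: "'b::euclidean_space set" and f :: "'a::euclidean_space \<Rightarrow> 'b"
  assumes lin: "linear f" and norm: "\<And>a. norm (f a) = norm a" and rng: "range f = {x. v \<bullet> x = 0}"
    and dim: "DIM('b) = DIM('a) + 1" and v: "norm v = 1" and h: "0 < h"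
    and F: "F \<in> sets borel" "F \<subseteq> {z. v \<bullet> z = h}"
  shows "of_nat DIM('b) * emeasure lborel (cone_below v h F) = ennreal h * hausdorff_outer DIM('a) F"
proof -
  interpret f: linear f by (rule lin)
  define T where "T = (\<lambda>(a, s). f a + s *\<^sub>R v)"
  have fv: "v \<bullet> f a = 0" for a using rng by auto
  have vv: "v \<bullet> v = 1" using v by (simp add: dot_square_norm)
  have normT: "norm (T p) = norm p" for p
  proof -
    obtain a s where p: "p = (a, s)" by (cases p)
    have "orthogonal (f a) (s *\<^sub>R v)"
      using fv[of a] by (simp add: orthogonal_def inner_commute)
    then have "(norm (T p))\<^sup>2 = (norm p)\<^sup>2"
      unfolding p T_def using norm[of a] v by (simp add: norm_add_Pythagorean norm_Pair)
    then show ?thesis by simp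
  qed
  have distT: "dist (T p) (T q) = dist p q" for p q
  proof -
    have "T p - T q = T (p - q)" unfolding T_def by (cases p, cases q) (simp add: f.diff algebra_simps)
    then show ?thesis using normT[of "p - q"] by (simp add: dist_norm)
  qed
  have contf: "continuous_on UNIV f" using lin by (rule linear_continuous_on[OF linear_conv_bounded_linear[THEN iffD1]])
  have contT: "continuous_on UNIV T"
    unfolding T_def case_prod_beta
    by (intro continuous_intros continuous_on_compose2[OF contf]) auto
  define F' where "F' = (\<lambda>a. f a + h *\<^sub>R v) -` F"
  have F'b: "F' \<in> sets borel"
  proof -
    have "(\<lambda>a. f a + h *\<^sub>R v) \<in> borel_measurable borel"
      by (intro borel_measurable_continuous_onI continuous_intros contf)
    from measurable_sets[OF this F(1)] show ?thesis by (simp add: F'_def)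
  qed
  have F_eq: "F = (\<lambda>a. f a + h *\<^sub>R v) ` F'"
  proof (intro subset_antisym subsetI)
    fix z assume z: "z \<in> F"
    then have "v \<bullet> (z - h *\<^sub>R v) = 0" using F(2) vv by (auto simp: inner_diff_right)
    then obtain a where a: "z - h *\<^sub>R v = f a" using rng by auto
    then have "z = f a + h *\<^sub>R v" by (simp add: algebra_simps)
    then show "z \<in> (\<lambda>a. f a + h *\<^sub>R v) ` F'" using z unfolding F'_def by auto
  qed (auto simp: F'_def)
  have HF: "hausdorff_outer DIM('a) F = emeasure lborel F'"
  proof -
    have "dist (f a + h *\<^sub>R v) (f b + h *\<^sub>R v) = dist a b" for a b
      using norm[of "a - b"] by (simp add: dist_norm f.diff)
    then show ?thesis
      by (subst F_eq) (simp add: hausdorff_outer_isometric_image hausdorff_outer_eq_lborel[OF F'b])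
  qed
  define Q where "Q = T -` cone_below v h F"
  have Qb: "Q \<in> sets borel"
    using measurable_sets[OF borel_measurable_continuous_onI[OF contT] cone_below_measurable[OF F(1), of v h]]
    unfolding Q_def by simp
  have Qsurj: "T ` Q = cone_below v h F"
  proof -
    have "x \<in> range T" for x
    proof -
      have "v \<bullet> (x - (v \<bullet> x) *\<^sub>R v) = 0" using vv by (simp add: inner_diff_right)
      then obtain a where "x - (v \<bullet> x) *\<^sub>R v = f a" using rng by auto
      then have "x = T (a, v \<bullet> x)" unfolding T_def by (simp add: algebra_simps)
      then show ?thesis by blast
    qed
    then have "range T = UNIV" by blast
    then show ?thesis unfolding Q_def by (simp add: image_vimage_eq)
  qed
  have Qs: "(a, s) \<in> Q \<longleftrightarrow> 0 < s \<and> s \<le> h \<and> (h / s) *\<^sub>R a \<in> F'" for a s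
  proof -
    have "v \<bullet> T (a, s) = s" unfolding T_def by (simp add: inner_add_right fv vv)
    moreover have "s > 0 \<Longrightarrow> (h / s) *\<^sub>R T (a, s) = f ((h / s) *\<^sub>R a) + h *\<^sub>R v"
      unfolding T_def by (simp add: scaleR_add_right f.scaleR)
    ultimately show ?thesis unfolding Q_def cone_below_def F'_def by auto
  qed
  have "emeasure lborel (cone_below v h F) = hausdorff_outer DIM('b) (T ` Q)"
    unfolding Qsurj using hausdorff_outer_eq_lborel[OF cone_below_measurable[OF F(1)]] by simp
  also have "\<dots> = hausdorff_outer DIM('b) Q" by (rule hausdorff_outer_isometric_image) (simp add: distT)
  also have "\<dots> = emeasure lborel Q"
    using hausdorff_outer_eq_lborel[OF Qb] dim by simp
  also have "\<dots> = emeasure (lborel \<Otimes>\<^sub>M lborel) Q" by (simp add: lborel_prod)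
  also have "\<dots> = (\<integral>\<^sup>+s. emeasure lborel ((\<lambda>a. (a, s)) -` Q) \<partial>lborel)"
  proof (rule lborel_pair.emeasure_pair_measure_alt2)
    have "sets (lborel \<Otimes>\<^sub>M lborel :: ('a \<times> real) measure) = sets borel" by (simp only: lborel_prod sets_lborel)
    then show "Q \<in> sets (lborel \<Otimes>\<^sub>M lborel)" using Qb by (simp only:)
  qed
  also have "\<dots> = (\<integral>\<^sup>+s. emeasure lborel F' * (ennreal ((s / h) ^ DIM('a)) * indicator {0..h} s) \<partial>lborel)"
  proof (rule nn_integral_cong)
    fix s :: real
    show "emeasure lborel ((\<lambda>a. (a, s)) -` Q) = emeasure lborel F' * (ennreal ((s / h) ^ DIM('a)) * indicator {0..h} s)"
    proof (cases "0 < s \<and> s \<le> h")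
      case True
      have "(\<lambda>a. (a, s)) -` Q = (\<lambda>a. (h / s) *\<^sub>R a) -` F'" using Qs True by auto
      moreover have "emeasure lborel F' = ennreal ((h / s) ^ DIM('a)) * emeasure lborel ((\<lambda>a. (h / s) *\<^sub>R a) -` F')"
        using True h F'b by (intro emeasure_lborel_scale_vimage) auto
      moreover have "ennreal ((s / h) ^ DIM('a)) * ennreal ((h / s) ^ DIM('a)) = 1"
        using True h by (simp add: ennreal_mult[symmetric] flip: power_mult_distrib)
      ultimately show ?thesis using True
        by (simp add: mult.assoc[symmetric] mult.commute[of _ "ennreal ((s / h) ^ DIM('a))"])
    next
      case False
      then have "(\<lambda>a. (a, s)) -` Q = {}" using Qs by auto
      moreover have "ennreal ((s / h) ^ DIM('a)) * indicator {0..h} s = 0"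
        using False by (cases "s = 0") (auto simp: indicator_def)
      ultimately show ?thesis by simp
    qed
  qed
  also have "\<dots> = emeasure lborel F' * (\<integral>\<^sup>+s. ennreal ((s / h) ^ DIM('a)) * indicator {0..h} s \<partial>lborel)"
    by (rule nn_integral_cmult) measurable
  also have "(\<integral>\<^sup>+s. ennreal ((s / h) ^ DIM('a)) * indicator {0..h} s \<partial>lborel)
      = ennreal (h * (h / h) ^ (DIM('a) + 1) / (DIM('a) + 1) - h * (0 / h) ^ (DIM('a) + 1) / (DIM('a) + 1))"
  proof (rule nn_integral_FTC_Icc)
    fix s :: real
    have "DERIV (\<lambda>s. (s / h) ^ Suc DIM('a)) s :> real (Suc DIM('a)) * ((s / h) ^ DIM('a) * (1 / h))"
      by (rule DERIV_cong[OF DERIV_power[where n="Suc DIM('a)" and f="\<lambda>s. s / h" and D="1 / h"]])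
         (use h in \<open>auto intro!: derivative_eq_intros\<close>)
    then have "DERIV (\<lambda>s. h / real (Suc DIM('a)) * (s / h) ^ Suc DIM('a)) s :>
        h / real (Suc DIM('a)) * (real (Suc DIM('a)) * ((s / h) ^ DIM('a) * (1 / h)))"
      by (rule DERIV_cmult)
    then show "DERIV (\<lambda>s. h * (s / h) ^ (DIM('a) + 1) / (DIM('a) + 1)) s :> (s / h) ^ DIM('a)"
      using h by (simp add: add.commute del: power_Suc)
  qed (use h in auto)
  finally have "emeasure lborel (cone_below v h F) = emeasure lborel F' * ennreal (h / DIM('b))"
    using h dim by simp
  moreover have "of_nat DIM('b) * ennreal (h / DIM('b)) = ennreal h"
    using h by (simp add: ennreal_of_nat_eq_real_of_nat ennreal_mult'[symmetric])
  ultimately show ?thesis unfolding HF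
    by (metis mult.assoc mult.commute)
qed

text \<open>
  An index type with one element less, so that \<open>real^'n pred_index\<close> can parametrise hyperplanes
  of \<open>real^'n\<close>. As types are not empty, a singleton index type is sent to itself; hyperplanes of the
  line are single points and are treated by counting measure.
\<close>
typedef ('n::finite) pred_index = "if CARD('n) = 1 then UNIV else UNIV - {undefined :: 'n}"
proof (cases "CARD('n) = 1")
  case False
  have "UNIV \<noteq> {undefined :: 'n}"
  proof
    assume "UNIV = {undefined :: 'n}"
    then have "CARD('n) = card {undefined :: 'n}" by (rule arg_cong)
    then show False using False by simp
  qed
  then have "\<exists>x::'n. x \<in> UNIV - {undefined}" by blast
  then show ?thesis using False by simp
qed auto

instance pred_index :: (finite) finite
proof
  have "(UNIV :: 'a pred_index set) = Abs_pred_index ` (if CARD('a) = 1 then UNIV else UNIV - {undefined :: 'a})"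
    using type_definition.Abs_image[OF type_definition_pred_index] by metis
  then show "finite (UNIV :: 'a pred_index set)" by (metis finite finite_imageI)
qed

lemma card_pred_index:
  assumes "CARD('n::finite) \<noteq> 1"
  shows "CARD('n pred_index) + 1 = CARD('n)"
proof -
  have "CARD('n pred_index) = card (UNIV - {undefined :: 'n})"
  proof -
    have "CARD('n pred_index) = card (if CARD('n) = 1 then UNIV else UNIV - {undefined :: 'n})"
      by (rule type_definition.card[OF type_definition_pred_index])
    then show ?thesis using assms by simp
  qed
  moreover have "0 < CARD('n)" by simp
  ultimately show ?thesis by (simp add: card_Diff_singleton)
qed

lemma hausdorff_outer_0_singleton: "hausdorff_outer 0 {p :: 'a::metric_space} = 1"
proof (rule antisym)
  have w: "hausdorff_weight 0 A = (if A = {} then 0 else 1)" for A :: "'a set"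
    by (simp add: hausdorff_weight_def)
  show "hausdorff_outer 0 {p} \<le> 1"
  proof (rule hausdorff_outer_leI)
    fix \<delta> :: real assume d: "0 < \<delta>"
    define A where "A = (\<lambda>n::nat. if n = 0 then {p} else {})"
    have "hausdorff_premeasure 0 \<delta> {p} \<le> (\<Sum>n. hausdorff_weight 0 (A n))"
      using d by (intro hausdorff_premeasure_le) (auto simp: A_def split: if_splits)
    also have "\<dots> = (\<Sum>n\<in>{0}. hausdorff_weight 0 (A n))" by (rule suminf_finite) (auto simp: A_def)
    finally show "hausdorff_premeasure 0 \<delta> {p} \<le> 1" by (simp add: w A_def)
  qed
  have "1 \<le> hausdorff_premeasure 0 1 {p}"
    unfolding hausdorff_premeasure_def
  proof (rule INF_greatest)
    fix A :: "nat \<Rightarrow> 'a set"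
    assume "A \<in> {A. (\<forall>i. bounded (A i) \<and> diameter (A i) \<le> 1) \<and> {p} \<subseteq> (\<Union>i. A i)}"
    then obtain i where "p \<in> A i" by auto
    then have "1 \<le> hausdorff_weight 0 (A i)" by (auto simp: w)
    also have "\<dots> = (\<Sum>n\<in>{i}. hausdorff_weight 0 (A n))" by simp
    also have "\<dots> \<le> (\<Sum>n. hausdorff_weight 0 (A n))" by (rule sum_le_suminf) auto
    finally show "1 \<le> (\<Sum>n. hausdorff_weight 0 (A n))" .
  qed
  also have "\<dots> \<le> hausdorff_outer 0 {p}" by (rule hausdorff_premeasure_le_outer) simp
  finally show "1 \<le> hausdorff_outer 0 {p}" .
qed

text \<open>
  In dimension at least two the hyperplane is parametrised by \<open>real^'n pred_index\<close>. On the line, \<open>F\<close> is empty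
  or a single point, and the cone over a point is an interval.
\<close>
theorem cone_volume_over_hyperplane:
  fixes F :: "(real^'n) set"
  assumes v: "norm v = 1" and h: "0 < h" and F: "F \<in> sets borel" "F \<subseteq> {z. v \<bullet> z = h}"
  shows "of_nat CARD('n) * emeasure lborel (cone_below v h F) = ennreal h * hausdorff_outer (CARD('n) - 1) F"
proof (cases "CARD('n) = 1")
  case False
  have v0: "v \<noteq> 0" using v by auto
  have card: "CARD('n) = CARD('n pred_index) + 1" using card_pred_index[OF False] by simp
  have "dim (UNIV :: (real^'n pred_index) set) = dim {x. v \<bullet> x = 0}"
    using dim_hyperplane[OF v0] card by simp
  then obtain f :: "real^'n pred_index \<Rightarrow> real^'n" where f: "linear f" "f ` UNIV = {x. v \<bullet> x = 0}" "\<And>a. norm (f a) = norm a"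
    using isometries_subspaces[OF subspace_UNIV subspace_hyperplane, of v] by (metis UNIV_I)
  show ?thesis
    using cone_volume_over_hyperplane_isometry[OF f(1,3,2) _ v h F] card by simp
next
  case True
  define T where "T = (\<lambda>s::real. s *\<^sub>R v)"
  have vv: "v \<bullet> v = 1" using v by (simp add: dot_square_norm)
  have surj: "x = T (v \<bullet> x)" for x
  proof -
    have "v \<noteq> 0" using v by auto
    then have "dim {x. v \<bullet> x = 0} = 0" using dim_hyperplane[of v] True by simp
    then have "{x. v \<bullet> x = 0} \<subseteq> {0}" by (simp add: dim_eq_0)
    moreover have "v \<bullet> (x - (v \<bullet> x) *\<^sub>R v) = 0" using vv by (simp add: inner_diff_right)
    ultimately show ?thesis unfolding T_def by auto
  qed
  have "F \<subseteq> {T h}"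
  proof
    fix z assume "z \<in> F"
    then have "v \<bullet> z = h" using F(2) by auto
    then show "z \<in> {T h}" using surj[of z] by simp
  qed
  then consider "F = {}" | "F = {T h}" by blast
  then show ?thesis
  proof cases
    case 1
    then show ?thesis by (simp add: cone_below_def)
  next
    case 2
    have "cone_below v h F = T ` {0<..h}"
    proof (intro set_eqI iffI)
      fix x assume x: "x \<in> cone_below v h F"
      then show "x \<in> T ` {0<..h}" using surj[of x] by (intro image_eqI[of _ _ "v \<bullet> x"]) (auto simp: cone_below_def)
    next
      fix x assume "x \<in> T ` {0<..h}"
      then obtain s where "0 < s" "s \<le> h" "x = T s" by auto
      then show "x \<in> cone_below v h F" by (auto simp: cone_below_def T_def vv 2)
    qed
    moreover have "hausdorff_outer 1 (T ` {0<..h}) = hausdorff_outer 1 {0<..h}"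
      by (rule hausdorff_outer_isometric_image) (use v in \<open>simp add: T_def dist_norm flip: scaleR_diff_left\<close>)
    moreover have "hausdorff_outer 1 {0<..h} = ennreal h"
      using hausdorff_outer_eq_lborel[of "{0<..h}"] h by simp
    moreover have "hausdorff_outer 1 (cone_below v h F) = emeasure lborel (cone_below v h F)"
      using hausdorff_outer_eq_lborel[OF cone_below_measurable[OF F(1), of v h]] True by simp
    ultimately show ?thesis using True 2 by (simp add: hausdorff_outer_0_singleton)
  qed
qed

section \<open>Gauges of Wulff shapes and uniqueness of normals\<close>

text \<open>
  The gauge (Minkowski functional) of the Wulff shape of \<open>h\<close>, as a supremum of linear functions.
\<close>
definition wulff_gauge :: "(real^'n \<Rightarrow> real) \<Rightarrow> real^'n \<Rightarrow> real" where
  "wulff_gauge h x = (SUP v\<in>sphere 0 1. (x \<bullet> v) / h v)"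

lemma sphere_nonempty: "sphere (0::real^'n) 1 \<noteq> {}"
  by (simp add: sphere_eq_empty)

locale wulff_function =
  fixes h :: "real^'n \<Rightarrow> real"
  assumes cont: "continuous_on (sphere 0 1) h" and pos: "\<And>v. v \<in> sphere 0 1 \<Longrightarrow> 0 < h v"
begin

lemma ratio_continuous: "continuous_on (sphere 0 1) (\<lambda>v. (x \<bullet> v) / h v)"
  by (intro continuous_intros cont) (use pos in force)

lemma ratio_bdd: "bdd_above ((\<lambda>v. (x \<bullet> v) / h v) ` sphere 0 1)"
  by (intro bounded_imp_bdd_above compact_imp_bounded compact_continuous_image ratio_continuous compact_sphere)

lemma gauge_upper: "v \<in> sphere 0 1 \<Longrightarrow> (x \<bullet> v) / h v \<le> wulff_gauge h x"
  unfolding wulff_gauge_def by (rule cSUP_upper[OF _ ratio_bdd])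

lemma gauge_attained: "\<exists>v\<in>sphere 0 1. wulff_gauge h x = (x \<bullet> v) / h v"
proof -
  obtain v where v: "v \<in> sphere 0 1" "\<forall>w\<in>sphere 0 1. (x \<bullet> w) / h w \<le> (x \<bullet> v) / h v"
    using continuous_attains_sup[OF compact_sphere sphere_nonempty ratio_continuous, of x] by blast
  have "wulff_gauge h x \<le> (x \<bullet> v) / h v"
    unfolding wulff_gauge_def using v by (intro cSUP_least sphere_nonempty) auto
  then show ?thesis using gauge_upper[OF v(1), of x] v(1) by (intro bexI[of _ v]) auto
qed

lemma gauge_le_iff: "wulff_gauge h x \<le> c \<longleftrightarrow> (\<forall>v\<in>sphere 0 1. (x \<bullet> v) / h v \<le> c)"
  using gauge_attained[of x] gauge_upper[of _ x] by (metis order_trans)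

lemma gauge_scale:
  assumes "0 \<le> c" shows "wulff_gauge h (c *\<^sub>R x) = c * wulff_gauge h x"
proof (rule antisym)
  show "wulff_gauge h (c *\<^sub>R x) \<le> c * wulff_gauge h x"
    unfolding gauge_le_iff using gauge_upper[of _ x] assms mult_left_mono by fastforce
  obtain v where v: "v \<in> sphere 0 1" "wulff_gauge h x = (x \<bullet> v) / h v" using gauge_attained by blast
  then show "c * wulff_gauge h x \<le> wulff_gauge h (c *\<^sub>R x)" using gauge_upper[OF v(1), of "c *\<^sub>R x"] by simp
qed

lemma gauge_0 [simp]: "wulff_gauge h 0 = 0"
  using gauge_scale[of 0 0] by simp

lemma gauge_add: "wulff_gauge h (x + y) \<le> wulff_gauge h x + wulff_gauge h y"
  unfolding gauge_le_iff
proof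
  fix v :: "real^'n" assume v: "v \<in> sphere 0 1"
  show "((x + y) \<bullet> v) / h v \<le> wulff_gauge h x + wulff_gauge h y"
    using gauge_upper[OF v, of x] gauge_upper[OF v, of y] by (simp add: inner_add_left add_divide_distrib)
qed

lemma h_bounds: "\<exists>m M. 0 < m \<and> (\<forall>v\<in>sphere 0 1. m \<le> h v \<and> h v \<le> M)"
proof -
  obtain a where a: "a \<in> sphere 0 1" "\<forall>w\<in>sphere 0 1. h a \<le> h w"
    using continuous_attains_inf[OF compact_sphere sphere_nonempty cont] by blast
  obtain b where "b \<in> sphere 0 1" "\<forall>w\<in>sphere 0 1. h w \<le> h b"
    using continuous_attains_sup[OF compact_sphere sphere_nonempty cont] by blast
  then show ?thesis using a pos by (intro exI[of _ "h a"] exI[of _ "h b"]) auto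
qed

lemma gauge_norm_bounds: "\<exists>c C. 0 < c \<and> 0 < C \<and> (\<forall>x. c * norm x \<le> wulff_gauge h x \<and> wulff_gauge h x \<le> C * norm x)"
proof -
  obtain m M where m: "0 < m" "\<forall>v\<in>sphere 0 1. m \<le> h v \<and> h v \<le> M" using h_bounds by blast
  have M: "0 < M" using m sphere_nonempty by fastforce
  have "(1 / M) * norm x \<le> wulff_gauge h x" for x
  proof (cases "x = 0")
    case False
    define v where "v = x /\<^sub>R norm x"
    have v: "v \<in> sphere 0 1" "x \<bullet> v = norm x"
      using False by (simp_all add: v_def dot_square_norm power2_eq_square)
    have "(1 / M) * norm x \<le> norm x / h v" using m M v pos[OF v(1)] by (auto intro!: divide_left_mono)
    also have "\<dots> \<le> wulff_gauge h x" using gauge_upper[OF v(1), of x] v(2) by simp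
    finally show ?thesis .
  qed simp
  moreover have "wulff_gauge h x \<le> (1 / m) * norm x" for x
    unfolding gauge_le_iff
  proof
    fix v :: "real^'n" assume v: "v \<in> sphere 0 1"
    have "x \<bullet> v \<le> norm x" using norm_cauchy_schwarz[of x v] v by simp
    then have "(x \<bullet> v) / h v \<le> norm x / h v" using pos[OF v] by (simp add: divide_right_mono)
    also have "\<dots> \<le> norm x / m" using m v pos[OF v] by (auto intro!: divide_left_mono)
    finally show "(x \<bullet> v) / h v \<le> (1 / m) * norm x" by simp
  qed
  ultimately show ?thesis using m M by (intro exI[of _ "1/M"] exI[of _ "1/m"]) auto
qed

lemma gauge_nonneg: "0 \<le> wulff_gauge h x"
  using gauge_norm_bounds by (meson mult_nonneg_nonneg norm_ge_zero order_less_imp_le order_trans)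

lemma gauge_pos: "x \<noteq> 0 \<Longrightarrow> 0 < wulff_gauge h x"
  using gauge_norm_bounds by (meson mult_pos_pos zero_less_norm_iff order_less_le_trans)

lemma gauge_pos_iff: "0 < wulff_gauge h x \<longleftrightarrow> x \<noteq> 0"
  using gauge_pos by auto

lemma gauge_lipschitz: "\<exists>L>0. \<forall>x y. \<bar>wulff_gauge h x - wulff_gauge h y\<bar> \<le> L * norm (x - y)"
proof -
  obtain C where C: "0 < C" "\<And>x. wulff_gauge h x \<le> C * norm x" using gauge_norm_bounds by blast
  have "wulff_gauge h x - wulff_gauge h y \<le> C * norm (x - y)" for x y
    using gauge_add[of "x - y" y] C(2)[of "x - y"] by simp
  then have "\<bar>wulff_gauge h x - wulff_gauge h y\<bar> \<le> C * norm (x - y)" for x y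
    by (smt (verit) norm_minus_commute)
  then show ?thesis using C by blast
qed

lemma gauge_continuous: "continuous_on UNIV (wulff_gauge h)"
proof -
  obtain L where "L > 0" "\<forall>x y. \<bar>wulff_gauge h x - wulff_gauge h y\<bar> \<le> L * norm (x - y)" using gauge_lipschitz by blast
  then have "L-lipschitz_on UNIV (wulff_gauge h)" by (auto intro!: lipschitz_onI simp: dist_norm)
  then show ?thesis by (rule lipschitz_on_continuous_on)
qed

lemma gauge_measurable [measurable]: "wulff_gauge h \<in> borel_measurable borel"
  by (rule borel_measurable_continuous_onI[OF gauge_continuous])

lemma wulff_shape_eq: "wulff_shape h = {x. wulff_gauge h x \<le> 1}"
  unfolding wulff_shape_def gauge_le_iff using pos by (auto simp: field_simps)

lemma wulff_shape_measurable [measurable]: "wulff_shape h \<in> sets borel"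
  unfolding wulff_shape_eq by measurable

end

lemma support_fun_upper:
  assumes "compact K" "y \<in> K" shows "v \<bullet> y \<le> support_fun K v"
proof -
  have "bdd_above ((\<lambda>y. v \<bullet> y) ` K)"
    by (intro bounded_imp_bdd_above compact_imp_bounded compact_continuous_image continuous_intros assms(1))
  then show ?thesis unfolding support_fun_def using assms(2) by (intro cSUP_upper)
qed

lemma support_fun_attained:
  assumes "compact K" "K \<noteq> {}" shows "\<exists>y\<in>K. support_fun K v = v \<bullet> y"
proof -
  obtain y where y: "y \<in> K" "\<forall>z\<in>K. v \<bullet> z \<le> v \<bullet> y"
    using continuous_attains_sup[OF assms, of "\<lambda>y. v \<bullet> y"] by (force intro: continuous_intros)
  have "support_fun K v \<le> v \<bullet> y" unfolding support_fun_def using y assms by (intro cSUP_least) auto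
  then show ?thesis using support_fun_upper[OF assms(1) y(1), of v] y(1) by (intro bexI[of _ y]) auto
qed

text \<open>
  For the support function \<open>h\<close> of \<open>K\<close> the gauge \<open>g\<close> is the Minkowski functional of \<open>K\<close>, since
  \<open>K\<close> is the Wulff shape of \<open>h\<close>.
\<close>
locale convex_body_o =
  fixes K :: "(real^'n) set"
  assumes K: "K \<in> convex_bodies_o"
begin

abbreviation "h \<equiv> support_fun K"
abbreviation "g \<equiv> wulff_gauge h"

lemma compact_K: "compact K" and convex_K: "convex K" and zero_interior: "0 \<in> interior K"
  using K by (auto simp: convex_bodies_o_def convex_body_def)

lemma K_nonempty: "K \<noteq> {}" using zero_interior interior_subset by auto

lemma support_fun_lipschitz: "\<exists>R>0. \<forall>v w. \<bar>h v - h w\<bar> \<le> R * norm (v - w)"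
proof -
  obtain R where R: "0 < R" "\<forall>x\<in>K. norm x \<le> R" using compact_imp_bounded[OF compact_K] bounded_pos by blast
  have "h v - h w \<le> R * norm (v - w)" for v w
  proof -
    obtain y where y: "y \<in> K" "h v = v \<bullet> y" using support_fun_attained[OF compact_K K_nonempty] by blast
    have "h v - h w \<le> (v - w) \<bullet> y" using y support_fun_upper[OF compact_K y(1), of w] by (simp add: inner_diff_left)
    also have "\<dots> \<le> norm (v - w) * norm y" by (rule norm_cauchy_schwarz)
    also have "\<dots> \<le> norm (v - w) * R" using R y by (intro mult_left_mono) auto
    finally show ?thesis by (simp add: mult.commute)
  qed
  then have "\<bar>h v - h w\<bar> \<le> R * norm (v - w)" for v w by (smt (verit) norm_minus_commute)
  then show ?thesis using R by blast
qed

lemma support_fun_continuous: "continuous_on UNIV h"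
proof -
  obtain L where "L > 0" "\<forall>x y. \<bar>h x - h y\<bar> \<le> L * norm (x - y)" using support_fun_lipschitz by blast
  then have "L-lipschitz_on UNIV h" by (auto intro!: lipschitz_onI simp: dist_norm)
  then show ?thesis by (rule lipschitz_on_continuous_on)
qed

lemma support_fun_pos: "v \<noteq> 0 \<Longrightarrow> 0 < h v"
proof -
  assume v: "v \<noteq> 0"
  obtain r where r: "0 < r" "cball 0 r \<subseteq> K" using zero_interior mem_interior_cball by blast
  have "(r / norm v) *\<^sub>R v \<in> K" using r v by (intro subsetD[OF r(2)]) auto
  then have "v \<bullet> ((r / norm v) *\<^sub>R v) \<le> h v" by (rule support_fun_upper[OF compact_K])
  moreover have "0 < v \<bullet> ((r / norm v) *\<^sub>R v)" using v r by simp
  ultimately show ?thesis by linarith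
qed

sublocale W: wulff_function h
proof
  show "continuous_on (sphere 0 1) h" using support_fun_continuous continuous_on_subset by blast
  show "0 < h v" if "v \<in> sphere 0 1" for v using that by (intro support_fun_pos) auto
qed

text \<open>
  A point outside \<open>K\<close> is strictly separated from \<open>K\<close> by a hyperplane, whose unit normal violates the
  defining inequality of the Wulff shape.
\<close>
lemma wulff_shape_support_fun: "wulff_shape h = K"
proof (intro subset_antisym subsetI)
  fix x assume "x \<in> K"
  then show "x \<in> wulff_shape h" unfolding wulff_shape_def
    using support_fun_upper[OF compact_K] by (auto simp: inner_commute[of x])
next
  fix x assume x: "x \<in> wulff_shape h"
  show "x \<in> K"
  proof (rule ccontr)
    assume "x \<notin> K"
    then obtain a b where ab: "a \<bullet> x < b" "\<forall>y\<in>K. b < a \<bullet> y"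
      using separating_hyperplane_closed_point[OF convex_K compact_imp_closed[OF compact_K]] by blast
    have a0: "a \<noteq> 0" using ab K_nonempty by fastforce
    define v where "v = - a /\<^sub>R norm a"
    have v: "v \<in> sphere 0 1" using a0 by (simp add: v_def)
    obtain y where y: "y \<in> K" "h v = v \<bullet> y" using support_fun_attained[OF compact_K K_nonempty] by blast
    have "x \<bullet> v \<le> h v" using x v unfolding wulff_shape_def by blast
    then have "x \<bullet> v \<le> v \<bullet> y" using y by simp
    then have "a \<bullet> y \<le> a \<bullet> x" using a0 by (simp add: v_def inner_commute divide_right_mono field_simps)
    then show False using ab y(1) by (meson less_trans not_le)
  qed
qed

lemma K_iff: "x \<in> K \<longleftrightarrow> g x \<le> 1"
  using W.wulff_shape_eq wulff_shape_support_fun by blast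

lemma K_measurable [measurable]: "K \<in> sets borel"
  using compact_imp_closed[OF compact_K] by simp

lemma frontier_eq: "frontier K = {x. g x = 1}"
proof (intro set_eqI iffI)
  fix x assume x: "x \<in> frontier K"
  then have "x \<in> K" using compact_imp_closed[OF compact_K] frontier_subset_closed by blast
  moreover have "\<not> g x < 1"
  proof
    assume "g x < 1"
    have "open {x. g x < 1}" by (rule open_Collect_less[OF W.gauge_continuous continuous_on_const])
    then have "{x. g x < 1} \<subseteq> interior K" by (intro interior_maximal) (auto simp: K_iff)
    then show False using x \<open>g x < 1\<close> by (auto simp: frontier_def)
  qed
  ultimately show "x \<in> {x. g x = 1}" by (simp add: K_iff)
next
  fix x assume x: "x \<in> {x. g x = 1}"
  then have xK: "x \<in> K" by (simp add: K_iff)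
  have "x \<notin> interior K"
  proof
    assume "x \<in> interior K"
    then obtain e where e: "0 < e" "cball x e \<subseteq> K" using mem_interior_cball by blast
    have x0: "x \<noteq> 0" using x by auto
    define c where "c = 1 + e / norm x"
    have c: "1 < c" unfolding c_def using e x0 by simp
    have "x - c *\<^sub>R x = - (e / norm x) *\<^sub>R x" unfolding c_def by (simp add: scaleR_add_left)
    then have "c *\<^sub>R x \<in> cball x e" using x0 e by (simp add: dist_norm)
    then have "g (c *\<^sub>R x) \<le> 1" using e(2) K_iff by blast
    then show False using W.gauge_scale[of c x] c x by simp
  qed
  then show "x \<in> frontier K" using xK closure_subset by (auto simp: frontier_def)
qed

lemma outer_unit_normal_iff:
  assumes "g x = 1"
  shows "outer_unit_normal K x v \<longleftrightarrow> v \<in> sphere 0 1 \<and> x \<bullet> v = h v"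
proof -
  have xK: "x \<in> K" using assms by (simp add: K_iff)
  have "(\<forall>y\<in>K. v \<bullet> (y - x) \<le> 0) \<longleftrightarrow> x \<bullet> v = h v"
  proof
    assume a: "\<forall>y\<in>K. v \<bullet> (y - x) \<le> 0"
    obtain y where y: "y \<in> K" "h v = v \<bullet> y" using support_fun_attained[OF compact_K K_nonempty] by blast
    have "h v \<le> v \<bullet> x" using a y by (auto simp: inner_diff_right)
    then show "x \<bullet> v = h v" using support_fun_upper[OF compact_K xK, of v] by (simp add: inner_commute)
  next
    assume "x \<bullet> v = h v"
    then show "\<forall>y\<in>K. v \<bullet> (y - x) \<le> 0"
      using support_fun_upper[OF compact_K, of _ v] by (simp add: inner_diff_right inner_commute)
  qed
  then show ?thesis by (auto simp: outer_unit_normal_def)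
qed

text \<open>
  Normals are the maximisers in the definition of the gauge; this links the geometry of \<open>K\<close>
  to the differentiation of a maximum.
\<close>
lemma outer_unit_normal_iff_ratio:
  assumes "g x = 1"
  shows "outer_unit_normal K x v \<longleftrightarrow> v \<in> sphere 0 1 \<and> (x \<bullet> v) / h v = 1"
  using W.pos by (auto simp: outer_unit_normal_iff[OF assms] order_less_imp_not_eq2)

lemma outer_unit_normal_exists: "g x = 1 \<Longrightarrow> \<exists>v. outer_unit_normal K x v"
  using W.gauge_attained[of x] outer_unit_normal_iff_ratio by metis

lemma regular_boundary_iff:
  "x \<in> regular_boundary K \<longleftrightarrow> g x = 1 \<and> (\<exists>!v. outer_unit_normal K x v)"
  unfolding regular_boundary_def frontier_eq by auto

lemma gauss_map_normal: "x \<in> regular_boundary K \<Longrightarrow> outer_unit_normal K x (gauss_map K x)"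
  unfolding regular_boundary_def gauss_map_def by (auto intro: theI')

lemma gauss_map_unique: "x \<in> regular_boundary K \<Longrightarrow> outer_unit_normal K x v \<Longrightarrow> v = gauss_map K x"
  using gauss_map_normal unfolding regular_boundary_def by blast

lemma gauss_map_support: "x \<in> regular_boundary K \<Longrightarrow> gauss_map K x \<in> sphere 0 1 \<and> x \<bullet> gauss_map K x = h (gauss_map K x)"
  using gauss_map_normal outer_unit_normal_iff regular_boundary_iff by blast

end

lemma integral_lborel_translation:
  fixes f :: "'a::euclidean_space \<Rightarrow> real"
  assumes "f \<in> borel_measurable borel"
  shows "(LINT x|lborel. f (x + c)) = (LINT x|lborel. f x)"
proof -
  have "(LINT x|lborel. f x) = (LINT x|distr lborel borel ((+) c). f x)"
    by (simp add: lborel_distr_plus)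
  also have "\<dots> = (LINT x|lborel. f (c + x))" using assms by (intro integral_distr) auto
  finally show ?thesis by (simp add: add.commute)
qed

lemma integrable_lborel_translation:
  fixes f :: "'a::euclidean_space \<Rightarrow> real"
  assumes "integrable lborel f"
  shows "integrable lborel (\<lambda>x. f (x + c))"
proof -
  have "integrable (distr lborel borel ((+) c)) f" using assms by (simp add: lborel_distr_plus)
  then have "integrable lborel (\<lambda>x. f (c + x))" using assms
    by (subst (asm) integrable_distr_eq) auto
  then show ?thesis by (simp add: add.commute)
qed

text \<open>
  The second differences are multiplied by a Lipschitz cutoff \<open>\<phi>\<close> and integrated. One of the two differences can
  be shifted to the cutoff, which leaves a product of two first differences, of second order in the
  step. Even after division by the step it tends to zero, so the infimum over all steps
  of the nonnegative quotients has integral zero.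
\<close>
lemma second_difference_AE_small:
  fixes g :: "'a::euclidean_space \<Rightarrow> real"
  assumes L: "0 < L" "\<And>x y. \<bar>g x - g y\<bar> \<le> L * norm (x - y)"
    and conv: "\<And>x d. 0 \<le> g (x + d) + g (x - d) - 2 * g x" and e: "norm e = 1"
  shows "AE x in lborel. \<forall>\<epsilon>>0. \<exists>n::nat. real (Suc n) * (g (x + e /\<^sub>R Suc n) + g (x - e /\<^sub>R Suc n) - 2 * g x) < \<epsilon>"
proof -
  define A where "A = (\<lambda>n x. real (Suc n) * (g (x + e /\<^sub>R Suc n) + g (x - e /\<^sub>R Suc n) - 2 * g x))"
  have "L-lipschitz_on UNIV g" using L by (auto intro!: lipschitz_onI simp: dist_norm)
  then have contg: "continuous_on UNIV g" by (rule lipschitz_on_continuous_on)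
  have [measurable]: "g \<in> borel_measurable borel" by (rule borel_measurable_continuous_onI[OF contg])
  have [measurable]: "A n \<in> borel_measurable borel" for n unfolding A_def by measurable
  have A0: "0 \<le> A n x" for n x unfolding A_def using conv[of x "e /\<^sub>R Suc n"] by simp
  define D where "D = (\<lambda>x. INF n. ennreal (A n x))"
  have [measurable]: "D \<in> borel_measurable borel" unfolding D_def by measurable
  have AER: "AE x in lborel. x \<in> ball 0 R \<longrightarrow> D x = 0" if R: "0 < R" for R :: real
  proof -
    define \<phi> where "\<phi> = (\<lambda>x::'a. max 0 (R - norm x))"
    have \<phi>0: "0 \<le> \<phi> x" for x unfolding \<phi>_def by simp
    have \<phi>1: "\<bar>\<phi> x - \<phi> y\<bar> \<le> norm (x - y)" for x y
      unfolding \<phi>_def using norm_triangle_ineq3[of x y] by (auto simp: max_def abs_if split: if_splits)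
    have [measurable]: "\<phi> \<in> borel_measurable borel" unfolding \<phi>_def by measurable
    define V where "V = measure lborel (ball (0::'a) (R + 1))"
    have bd: "(\<integral>\<^sup>+x. ennreal (\<phi> x) * ennreal (A n x) \<partial>lborel) \<le> ennreal (L * V / Suc n)" for n
    proof -
      define d where "d = e /\<^sub>R Suc n"
      have nd: "norm d = 1 / Suc n" unfolding d_def using e by (simp add: divide_inverse)
      have nd1: "norm d \<le> 1" unfolding nd by simp
      define F where "F = (\<lambda>x. \<phi> x * (g (x + d) - g x))"
      define G where "G = (\<lambda>x. \<phi> (x + d) * (g (x + d) - g x))"
      have [measurable]: "F \<in> borel_measurable borel" "G \<in> borel_measurable borel" unfolding F_def G_def by measurable
      have gd: "\<bar>g (x + d) - g x\<bar> \<le> L * norm d" for x using L(2)[of "x + d" x] by simp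
      have supp: "\<phi> x = 0 \<and> \<phi> (x + d) = 0" if "x \<notin> ball 0 (R + 1)" for x
        using that nd1 norm_triangle_ineq4[of "x + d" d] unfolding \<phi>_def by auto
      have \<phi>R: "\<phi> x \<le> R" for x unfolding \<phi>_def using R by auto
      have fin: "emeasure lborel (ball (0::'a) (R + 1)) < \<infinity>" by (rule emeasure_bounded_finite) simp
      have Fb: "norm (F x) \<le> R * (L * norm d)" "norm (G x) \<le> R * (L * norm d)" for x
        unfolding F_def G_def using \<phi>R \<phi>0 gd L R by (auto simp: abs_mult intro!: mult_mono)
      have iF: "integrable lborel F"
        by (rule integrableI_bounded_set[of "ball 0 (R + 1)" _ _ "R * (L * norm d)"])
           (use fin Fb supp in \<open>auto simp: F_def\<close>)
      have iG: "integrable lborel G"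
        by (rule integrableI_bounded_set[of "ball 0 (R + 1)" _ _ "R * (L * norm d)"])
           (use fin Fb supp in \<open>auto simp: G_def\<close>)
      \<comment> \<open>the backward difference at \<open>x + d\<close> is the forward difference at \<open>x\<close>\<close>
      have G': "G x = (\<lambda>x. \<phi> x * (g x - g (x - d))) (x + d)" for x unfolding G_def by simp
      have iG': "integrable lborel (\<lambda>x. \<phi> x * (g x - g (x - d)))"
        using integrable_lborel_translation[OF iG, of "- d"] unfolding G_def by simp
      have "(LINT x|lborel. \<phi> x * (g x - g (x - d))) = (LINT x|lborel. G x)"
        unfolding G' by (rule integral_lborel_translation[symmetric]) measurable
      then have "(LINT x|lborel. F x - \<phi> x * (g x - g (x - d))) = (LINT x|lborel. F x - G x)"
        using iF iG iG' by simp
      also have "\<dots> \<le> (LINT x|lborel. indicator (ball (0::'a) (R + 1)) x * (norm d * (L * norm d)))"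
      proof (rule Bochner_Integration.integral_mono)
        show "integrable lborel (\<lambda>x. indicator (ball (0::'a) (R + 1)) x * (norm d * (L * norm d)))"
          using fin by (intro integrable_mult_left integrable_real_indicator) auto
        fix x
        have "F x - G x = (\<phi> x - \<phi> (x + d)) * (g (x + d) - g x)" unfolding F_def G_def by (simp add: algebra_simps)
        also have "\<dots> \<le> \<bar>\<phi> x - \<phi> (x + d)\<bar> * \<bar>g (x + d) - g x\<bar>" by (metis abs_ge_self abs_mult)
        also have "\<dots> \<le> norm d * (L * norm d)" using \<phi>1[of x "x + d"] gd[of x] by (intro mult_mono) auto
        finally have "F x - G x \<le> norm d * (L * norm d)" .
        then show "F x - G x \<le> indicator (ball 0 (R + 1)) x * (norm d * (L * norm d))"
          using supp[of x] by (cases "x \<in> ball 0 (R + 1)") (auto simp: F_def G_def)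
      qed (use iF iG in auto)
      also have "\<dots> = V * (norm d * (L * norm d))" unfolding V_def by simp
      finally have le: "(LINT x|lborel. F x - \<phi> x * (g x - g (x - d))) \<le> V * (norm d * (L * norm d))" .
      have eq: "\<phi> x * A n x = real (Suc n) * (F x - \<phi> x * (g x - g (x - d)))" for x
        unfolding A_def F_def d_def[symmetric] by (simp add: algebra_simps)
      have "(LINT x|lborel. \<phi> x * A n x) \<le> real (Suc n) * (V * (norm d * (L * norm d)))"
        unfolding eq using le by simp
      also have "\<dots> = L * V / Suc n" unfolding nd
      proof -
        have "k * (V * (1 / k * (L * (1 / k)))) = L * V / k" if "0 < k" for k :: real
          using that by (simp add: field_simps)
        from this[of "real (Suc n)"] show "real (Suc n) * (V * (1 / real (Suc n) * (L * (1 / real (Suc n))))) = L * V / Suc n"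
          by simp
      qed
      finally have "(LINT x|lborel. \<phi> x * A n x) \<le> L * V / Suc n" .
      moreover have "integrable lborel (\<lambda>x. \<phi> x * A n x)" unfolding eq using iF iG' by simp
      ultimately show ?thesis using \<phi>0 A0
        by (simp add: ennreal_mult[symmetric] nn_integral_eq_integral ennreal_leI)
    qed
    have b: "(\<integral>\<^sup>+x. ennreal (\<phi> x) * D x \<partial>lborel) \<le> ennreal (L * V / Suc n)" for n
      by (rule order_trans[OF nn_integral_mono bd[of n]]) (auto simp: D_def intro!: mult_left_mono INF_lower)
    have lim: "(\<lambda>n. ennreal (L * V / Suc n)) \<longlonglongrightarrow> ennreal 0"
      by (intro tendsto_ennrealI lim_const_over_n[THEN LIMSEQ_Suc])
    have "(\<integral>\<^sup>+x. ennreal (\<phi> x) * D x \<partial>lborel) \<le> ennreal 0"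
      by (rule LIMSEQ_le_const[OF lim]) (use b in blast)
    then have "AE x in lborel. ennreal (\<phi> x) * D x = 0"
      by (simp add: nn_integral_0_iff_AE)
    then show ?thesis by eventually_elim (auto simp: \<phi>_def)
  qed
  have "AE x in lborel. \<forall>N::nat. x \<in> ball 0 (real (Suc N)) \<longrightarrow> D x = 0"
    unfolding AE_all_countable using AER by simp
  then show ?thesis
  proof eventually_elim
    case (elim x)
    obtain N :: nat where "norm x < real N" using reals_Archimedean2 by blast
    then have "D x = 0" using elim[rule_format, of N] by auto
    show ?case
    proof (intro allI impI)
      fix \<epsilon> :: real assume "0 < \<epsilon>"
      then have "D x < ennreal \<epsilon>" using \<open>D x = 0\<close> by simp
      then obtain n where "ennreal (A n x) < ennreal \<epsilon>" unfolding D_def INF_less_iff by auto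
      then have "A n x < \<epsilon>" using A0 by (simp add: ennreal_less_iff)
      then show "\<exists>n. real (Suc n) * (g (x + e /\<^sub>R Suc n) + g (x - e /\<^sub>R Suc n) - 2 * g x) < \<epsilon>" unfolding A_def by blast
    qed
  qed
qed

text \<open>
  Two maximisers \<open>v\<close>, \<open>w\<close> at \<open>x\<close> give two subgradients \<open>v / h v\<close>, \<open>w / h w\<close> of the gauge, and the
  second difference in a basis direction bounds the difference of their coordinates from above. So
  the subgradients agree at almost every point, and their norms recover \<open>h v = h w\<close>.
\<close>
lemma (in wulff_function) AE_unique_maximizer:
  "AE x in lborel. \<forall>v\<in>sphere 0 1. \<forall>w\<in>sphere 0 1.
     (x \<bullet> v) / h v = wulff_gauge h x \<longrightarrow> (x \<bullet> w) / h w = wulff_gauge h x \<longrightarrow> v = w"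
proof -
  let ?g = "wulff_gauge h"
  obtain L where L: "0 < L" "\<And>x y. \<bar>?g x - ?g y\<bar> \<le> L * norm (x - y)" using gauge_lipschitz by blast
  have conv: "0 \<le> ?g (x + d) + ?g (x - d) - 2 * ?g x" for x d
    using gauge_add[of "x + d" "x - d"] gauge_scale[of 2 x] by (simp add: scaleR_2)
  have "AE x in lborel. \<forall>i\<in>Basis. \<forall>\<epsilon>>0. \<exists>n::nat. real (Suc n) * (?g (x + i /\<^sub>R Suc n) + ?g (x - i /\<^sub>R Suc n) - 2 * ?g x) < \<epsilon>"
    by (rule AE_finite_allI[OF finite_Basis]) (rule second_difference_AE_small[OF L conv norm_Basis])
  then show ?thesis
  proof eventually_elim
    case (elim x)
    have le: "v \<bullet> i / h v \<le> w \<bullet> i / h w"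
      if v: "v \<in> sphere 0 1" "(x \<bullet> v) / h v = ?g x" and w: "w \<in> sphere 0 1" "(x \<bullet> w) / h w = ?g x" and i: "i \<in> Basis" for v w i
    proof (rule field_le_epsilon)
      fix \<epsilon> :: real assume "0 < \<epsilon>"
      then obtain n :: nat where n: "real (Suc n) * (?g (x + i /\<^sub>R Suc n) + ?g (x - i /\<^sub>R Suc n) - 2 * ?g x) < \<epsilon>"
        using elim i by blast
      define c where "c = 1 / real (Suc n)"
      have c: "0 < c" "i /\<^sub>R Suc n = c *\<^sub>R i" unfolding c_def by (auto simp: divide_inverse)
      have "?g x + c * (v \<bullet> i / h v) \<le> ?g (x + c *\<^sub>R i)"
        using gauge_upper[OF v(1), of "x + c *\<^sub>R i"] v(2) by (simp add: inner_add_left add_divide_distrib inner_commute[of v i])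
      moreover have "?g x - c * (w \<bullet> i / h w) \<le> ?g (x - c *\<^sub>R i)"
        using gauge_upper[OF w(1), of "x - c *\<^sub>R i"] w(2) by (simp add: inner_diff_left diff_divide_distrib inner_commute[of w i])
      ultimately have "c * (v \<bullet> i / h v - w \<bullet> i / h w) \<le> ?g (x + c *\<^sub>R i) + ?g (x - c *\<^sub>R i) - 2 * ?g x"
        by (simp add: right_diff_distrib)
      also have "\<dots> = c * (real (Suc n) * (?g (x + c *\<^sub>R i) + ?g (x - c *\<^sub>R i) - 2 * ?g x))"
        unfolding c_def by simp
      also have "\<dots> \<le> c * \<epsilon>" using n c by (intro mult_left_mono) auto
      finally have "v \<bullet> i / h v - w \<bullet> i / h w \<le> \<epsilon>" using c(1) by (simp add: mult_le_cancel_left_pos)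
      then show "v \<bullet> i / h v \<le> w \<bullet> i / h w + \<epsilon>" by simp
    qed
    show ?case
    proof (intro ballI impI)
      fix v w :: "real^'n"
      assume v: "v \<in> sphere 0 1" "(x \<bullet> v) / h v = ?g x" and w: "w \<in> sphere 0 1" "(x \<bullet> w) / h w = ?g x"
      have "v \<bullet> i / h v = w \<bullet> i / h w" if "i \<in> Basis" for i
        using le[OF v w that] le[OF w v that] by simp
      then have eq: "v /\<^sub>R h v = w /\<^sub>R h w"
        by (metis (no_types, lifting) euclidean_eqI divide_inverse_commute inner_scaleR_left)
      have "norm (v /\<^sub>R h v) = norm (w /\<^sub>R h w)" by (simp only: eq)
      then have "h v = h w" using v(1) w(1) pos[OF v(1)] pos[OF w(1)] by simp
      then show "v = w" using pos[OF w(1)] eq by simp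
    qed
  qed
qed

section \<open>Integration along rays\<close>

lemma nn_integral_lborel_scale:
  fixes f :: "'a::euclidean_space \<Rightarrow> ennreal"
  assumes [measurable]: "f \<in> borel_measurable borel" and c: "0 < c"
  shows "(\<integral>\<^sup>+x. f x \<partial>lborel) = ennreal (c ^ DIM('a)) * (\<integral>\<^sup>+x. f (c *\<^sub>R x) \<partial>lborel)"
proof -
  have eq: "(lborel :: 'a measure) = density (distr lborel borel (\<lambda>x. 0 + c *\<^sub>R x)) (\<lambda>_. \<bar>c\<bar> ^ DIM('a))"
    using c by (intro lborel_affine) simp
  have "(\<integral>\<^sup>+x. f x \<partial>lborel) = (\<integral>\<^sup>+x. ennreal (c ^ DIM('a)) * f (0 + c *\<^sub>R x) \<partial>lborel)"
    using c by (subst eq) (simp add: nn_integral_density nn_integral_distr)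
  also have "\<dots> = ennreal (c ^ DIM('a)) * (\<integral>\<^sup>+x. f (c *\<^sub>R x) \<partial>lborel)"
    by (subst nn_integral_cmult) auto
  finally show ?thesis .
qed

lemma nn_integral_inverse_power_tail:
  assumes a: "0 < a" and n: "0 < n"
  shows "(\<integral>\<^sup>+s. ennreal (real n / s ^ Suc n) * indicator {a..} s \<partial>lborel) = ennreal (1 / a ^ n)"
proof -
  have "(\<integral>\<^sup>+s. ennreal (real n / s ^ Suc n) * indicator {a..} s \<partial>lborel) = ennreal (0 - (- (inverse a ^ n)))"
  proof (rule nn_integral_FTC_atLeast)
    fix s assume s: "a \<le> s"
    then have s0: "0 < s" using a by simp
    have "DERIV (\<lambda>s. - (inverse s ^ n)) s :> - (real n * (inverse s ^ (n - 1) * - (inverse s ^ Suc (Suc 0))))"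
      using s0 by (auto intro!: derivative_eq_intros simp: power2_eq_square)
    moreover have "- (real n * (inverse s ^ (n - 1) * - (inverse s ^ Suc (Suc 0)))) = real n / s ^ Suc n"
    proof -
      have "inverse s ^ (n - 1) * inverse s ^ Suc (Suc 0) = inverse s ^ Suc n"
        using n by (simp only: power_add[symmetric]) simp
      then show ?thesis by (simp add: divide_inverse power_inverse)
    qed
    ultimately show "DERIV (\<lambda>s. - (inverse s ^ n)) s :> real n / s ^ Suc n" by simp
    show "0 \<le> real n / s ^ Suc n" using s0 by simp
  next
    have "((\<lambda>s::real. - (inverse s ^ n)) \<longlongrightarrow> - (0 ^ n)) at_top"
      by (intro tendsto_intros tendsto_inverse_0_at_top filterlim_ident)
    then show "((\<lambda>s::real. - (inverse s ^ n)) \<longlongrightarrow> 0) at_top" by (simp only: zero_power[OF n] minus_zero)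
  qed auto
  then show ?thesis by (simp add: power_inverse divide_inverse)
qed

context wulff_function begin

abbreviation "\<g> \<equiv> wulff_gauge h"

text \<open>
  Polar coordinates in which the point \<open>x\<close> of the Wulff shape stands for its ray. After the substitution
  \<open>r = s * \<g> x\<close> the inner integral is over \<open>G (s x)\<close>; exchanging the
  integrals, rescaling \<open>x\<close> and exchanging them again leaves
  \<open>G z * (\<g> z)^n\<close> times the integral of \<open>n / s^(n+1)\<close> over \<open>s \<ge> \<g> z\<close>, which is \<open>G z\<close>.
\<close>
lemma nn_integral_polar:
  fixes G :: "real^'n \<Rightarrow> ennreal"
  assumes [measurable]: "G \<in> borel_measurable borel"
  shows "(\<integral>\<^sup>+x. G x \<partial>lborel) =
    (\<integral>\<^sup>+x. indicator (wulff_shape h) x *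
       (\<integral>\<^sup>+r. G ((r / \<g> x) *\<^sub>R x) * ennreal (real CARD('n) * r ^ (CARD('n) - 1)) * indicator {0<..} r \<partial>lborel) \<partial>lborel)"
proof -
  define n where "n = CARD('n)"
  have n: "0 < n" unfolding n_def by simp
  have AE0: "AE x in lborel. x \<noteq> (0::real^'n)" by (rule AE_lborel_singleton)
  define H where "H = (\<lambda>x s. indicator {x. \<g> x \<le> 1} x * G (s *\<^sub>R x) * ennreal (real n * s ^ (n - 1) * \<g> x ^ n) * indicator {0::real<..} s)"
  have [measurable]: "case_prod H \<in> borel_measurable (lborel \<Otimes>\<^sub>M lborel)"
    unfolding H_def by measurable
  have "(\<integral>\<^sup>+x. indicator (wulff_shape h) x *
       (\<integral>\<^sup>+r. G ((r / \<g> x) *\<^sub>R x) * ennreal (real n * r ^ (n - 1)) * indicator {0<..} r \<partial>lborel) \<partial>lborel)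
    = (\<integral>\<^sup>+x. (\<integral>\<^sup>+s. H x s \<partial>lborel) \<partial>lborel)"
  proof (rule nn_integral_cong_AE, use AE0 in eventually_elim)
    case (elim x)
    then have gx: "0 < \<g> x" by (rule gauge_pos)
    have "(\<integral>\<^sup>+r. G ((r / \<g> x) *\<^sub>R x) * ennreal (real n * r ^ (n - 1)) * indicator {0<..} r \<partial>lborel)
       = ennreal \<bar>\<g> x\<bar> * (\<integral>\<^sup>+s. G (((0 + \<g> x * s) / \<g> x) *\<^sub>R x) * ennreal (real n * (0 + \<g> x * s) ^ (n - 1)) * indicator {0<..} (0 + \<g> x * s) \<partial>lborel)"
      using gx by (intro nn_integral_real_affine) auto
    also have "\<dots> = (\<integral>\<^sup>+s. G (s *\<^sub>R x) * ennreal (real n * s ^ (n - 1) * \<g> x ^ n) * indicator {0<..} s \<partial>lborel)"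
    proof (subst nn_integral_cmult[symmetric])
      show "(\<integral>\<^sup>+s. ennreal \<bar>\<g> x\<bar> * (G (((0 + \<g> x * s) / \<g> x) *\<^sub>R x) * ennreal (real n * (0 + \<g> x * s) ^ (n - 1)) * indicator {0<..} (0 + \<g> x * s)) \<partial>lborel)
        = (\<integral>\<^sup>+s. G (s *\<^sub>R x) * ennreal (real n * s ^ (n - 1) * \<g> x ^ n) * indicator {0<..} s \<partial>lborel)"
      proof (rule nn_integral_cong)
        fix s :: real
        show "ennreal \<bar>\<g> x\<bar> * (G (((0 + \<g> x * s) / \<g> x) *\<^sub>R x) * ennreal (real n * (0 + \<g> x * s) ^ (n - 1)) * indicator {0<..} (0 + \<g> x * s))
          = G (s *\<^sub>R x) * ennreal (real n * s ^ (n - 1) * \<g> x ^ n) * indicator {0<..} s"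
        proof (cases "0 < s")
          case True
          have "\<g> x * \<g> x ^ (n - 1) = \<g> x ^ n" using n by (metis power_eq_if less_numeral_extra(3))
          then have "ennreal (\<g> x) * ennreal (real n * (\<g> x * s) ^ (n - 1)) = ennreal (real n * s ^ (n - 1) * \<g> x ^ n)"
            using gx True by (simp add: ennreal_mult[symmetric] power_mult_distrib mult_ac)
          moreover have "ennreal \<bar>\<g> x\<bar> * (G (((0 + \<g> x * s) / \<g> x) *\<^sub>R x) * ennreal (real n * (0 + \<g> x * s) ^ (n - 1)) * indicator {0<..} (0 + \<g> x * s))
            = G (s *\<^sub>R x) * (ennreal (\<g> x) * ennreal (real n * (\<g> x * s) ^ (n - 1))) * indicator {0<..} s"
            using gx True by (simp add: zero_less_mult_iff mult.left_commute)
          ultimately show ?thesis by simp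
        qed (use gx in \<open>auto simp: zero_less_mult_iff\<close>)
      qed
    qed measurable
    finally show ?case unfolding H_def wulff_shape_eq
      by (simp add: nn_integral_cmult[symmetric] mult.assoc)
  qed
  also have "\<dots> = (\<integral>\<^sup>+s. (\<integral>\<^sup>+x. H x s \<partial>lborel) \<partial>lborel)"
    by (rule lborel_pair.Fubini'[symmetric]) measurable
  also have "\<dots> = (\<integral>\<^sup>+s. (\<integral>\<^sup>+x. G x * ennreal (\<g> x ^ n) * (ennreal (real n / s ^ Suc n) * (indicator {\<g> x..} s * indicator {0<..} s)) \<partial>lborel) \<partial>lborel)"
  proof (rule nn_integral_cong)
    fix s :: real
    show "(\<integral>\<^sup>+x. H x s \<partial>lborel) = (\<integral>\<^sup>+x. G x * ennreal (\<g> x ^ n) * (ennreal (real n / s ^ Suc n) * (indicator {\<g> x..} s * indicator {0<..} s)) \<partial>lborel)"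
    proof (cases "0 < s")
      case True
      have "(\<integral>\<^sup>+x. H x s \<partial>lborel) = ennreal ((1 / s) ^ n) * (\<integral>\<^sup>+x. H ((1 / s) *\<^sub>R x) s \<partial>lborel)"
        using nn_integral_lborel_scale[of "\<lambda>x. H x s" "1 / s"] True unfolding n_def by simp
      also have "\<dots> = (\<integral>\<^sup>+x. ennreal ((1 / s) ^ n) * H ((1 / s) *\<^sub>R x) s \<partial>lborel)"
        by (rule nn_integral_cmult[symmetric]) measurable
      also have "\<dots> = (\<integral>\<^sup>+x. G x * ennreal (\<g> x ^ n) * (ennreal (real n / s ^ Suc n) * (indicator {\<g> x..} s * indicator {0<..} s)) \<partial>lborel)"
      proof (rule nn_integral_cong)
        fix x :: "real^'n"
        have g1: "\<g> ((1 / s) *\<^sub>R x) = \<g> x / s" using gauge_scale[of "1 / s" x] True by simp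
        have ind: "indicator {x. \<g> x \<le> 1} ((1 / s) *\<^sub>R x) = (indicator {\<g> x..} s :: ennreal)"
          unfolding indicator_def mem_Collect_eq g1 using True by auto
        have "(1 / s) ^ n * (real n * s ^ (n - 1) * (\<g> x / s) ^ n) = \<g> x ^ n * (real n / s ^ Suc n)"
        proof -
          have "s ^ n = s * s ^ (n - 1)" using n by (metis power_eq_if less_numeral_extra(3))
          then show ?thesis using True by (simp add: power_divide field_simps)
        qed
        then have "ennreal ((1 / s) ^ n) * ennreal (real n * s ^ (n - 1) * (\<g> x / s) ^ n) = ennreal (\<g> x ^ n) * ennreal (real n / s ^ Suc n)"
          using True gauge_nonneg[of x] by (simp add: ennreal_mult[symmetric])
        then show "ennreal ((1 / s) ^ n) * H ((1 / s) *\<^sub>R x) s = G x * ennreal (\<g> x ^ n) * (ennreal (real n / s ^ Suc n) * (indicator {\<g> x..} s * indicator {0<..} s))"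
        proof -
          have alg: "a * (i * y * b * k) = y * c * (d * (i * k))" if "a * b = c * d" for a b c d i y k :: ennreal
          proof -
            have "a * (i * y * b * k) = (a * b) * (i * y * k)" by (simp only: ac_simps)
            also have "\<dots> = y * c * (d * (i * k))" unfolding that by (simp only: ac_simps)
            finally show ?thesis .
          qed
          assume *: "ennreal ((1 / s) ^ n) * ennreal (real n * s ^ (n - 1) * (\<g> x / s) ^ n) = ennreal (\<g> x ^ n) * ennreal (real n / s ^ Suc n)"
          have "s *\<^sub>R (1 / s) *\<^sub>R x = x" using True by simp
          then show ?thesis unfolding H_def g1 ind by (simp only: alg[OF *])
        qed
      qed
      finally show ?thesis .
    qed (simp add: H_def)
  qed
  also have "\<dots> = (\<integral>\<^sup>+x. (\<integral>\<^sup>+s. G x * ennreal (\<g> x ^ n) * (ennreal (real n / s ^ Suc n) * (indicator {\<g> x..} s * indicator {0<..} s)) \<partial>lborel) \<partial>lborel)"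
    unfolding indicator_def atLeast_def by (rule lborel_pair.Fubini') measurable
  also have "\<dots> = (\<integral>\<^sup>+x. G x \<partial>lborel)"
  proof (rule nn_integral_cong_AE, use AE0 in eventually_elim)
    case (elim x)
    then have gx: "0 < \<g> x" by (rule gauge_pos)
    have "(\<integral>\<^sup>+s. G x * ennreal (\<g> x ^ n) * (ennreal (real n / s ^ Suc n) * (indicator {\<g> x..} s * indicator {0<..} s)) \<partial>lborel)
      = G x * ennreal (\<g> x ^ n) * (\<integral>\<^sup>+s. ennreal (real n / s ^ Suc n) * (indicator {\<g> x..} s * indicator {0<..} s) \<partial>lborel)"
      by (rule nn_integral_cmult) measurable
    also have "(\<integral>\<^sup>+s. ennreal (real n / s ^ Suc n) * (indicator {\<g> x..} s * indicator {0<..} s) \<partial>lborel)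
      = (\<integral>\<^sup>+s. ennreal (real n / s ^ Suc n) * indicator {\<g> x..} s \<partial>lborel)"
      using gx by (intro nn_integral_cong) (auto simp: indicator_def)
    also have "\<dots> = ennreal (1 / \<g> x ^ n)" by (rule nn_integral_inverse_power_tail[OF gx n])
    also have "G x * ennreal (\<g> x ^ n) * ennreal (1 / \<g> x ^ n) = G x"
      using gx by (simp add: mult.assoc ennreal_mult[symmetric])
    finally show ?case .
  qed
  finally show ?thesis unfolding n_def by simp
qed

end

text \<open>
  The integrand of the dual quermassintegral at \<open>r y\<close> times \<open>n r^(n-1)\<close>, simplified so
  that it is continuous at \<open>r = 0\<close> for \<open>q > 1\<close>.
\<close>
definition radial_density :: "real \<Rightarrow> real^'n \<Rightarrow> real \<Rightarrow> real" where
  "radial_density q y r = real CARD('n) * norm y powr (q - real CARD('n)) * (r powr (q - 1) * exp (- (r * norm y)\<^sup>2 / 2))"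

definition radial_mass :: "real \<Rightarrow> real^'n \<Rightarrow> real \<Rightarrow> real" where
  "radial_mass q y R = integral {0..R} (radial_density q y)"

lemma radial_density_nonneg: "0 \<le> radial_density q y r"
  unfolding radial_density_def by simp

lemma radial_density_continuous:
  assumes "1 < q" shows "continuous_on {0..R} (radial_density q y)"
  unfolding radial_density_def using assms
  by (intro continuous_intros continuous_on_powr') auto

lemma radial_mass_nonneg: "1 < q \<Longrightarrow> 0 \<le> radial_mass q y R"
  unfolding radial_mass_def
  by (rule integral_nonneg) (auto intro: integrable_continuous_interval radial_density_continuous radial_density_nonneg)

lemma nn_integral_radial_density:
  assumes q: "1 < q"
  shows "(\<integral>\<^sup>+r. ennreal (radial_density q y r) * indicator {0<..R} r \<partial>lborel) = ennreal (radial_mass q y R)"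
proof -
  have si: "set_integrable lborel {0..R} (radial_density q y)"
    by (rule borel_integrable_atLeastAtMost'[OF radial_density_continuous[OF q]])
  have "(\<integral>\<^sup>+r. ennreal (radial_density q y r) * indicator {0<..R} r \<partial>lborel)
     = (\<integral>\<^sup>+r. ennreal (indicator {0..R} r *\<^sub>R radial_density q y r) \<partial>lborel)"
    by (rule nn_integral_cong) (use q in \<open>auto simp: indicator_def radial_density_def\<close>)
  also have "\<dots> = ennreal (LINT r:{0..R}|lborel. radial_density q y r)"
    using si unfolding set_lebesgue_integral_def set_integrable_def
    by (intro nn_integral_eq_integral) (auto simp: radial_density_nonneg)
  also have "(LINT r:{0..R}|lborel. radial_density q y r) = radial_mass q y R"
    unfolding radial_mass_def by (rule set_borel_integral_eq_integral[OF si])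
  finally show ?thesis .
qed

lemma radial_mass_deriv:
  assumes q: "1 < q" and R: "0 < R"
  shows "(radial_mass q y has_real_derivative radial_density q y R) (at R)"
proof -
  have "((\<lambda>u. integral {0..u} (radial_density q y)) has_real_derivative radial_density q y R) (at R within {0..R+1})"
    using R by (intro integral_has_real_derivative radial_density_continuous[OF q]) auto
  moreover have "at R within {0..R+1} = at R"
    using R by (intro at_within_interior) auto
  ultimately show ?thesis unfolding radial_mass_def[abs_def] by simp
qed

context convex_body_o begin

definition boundary_proj :: "real^'n \<Rightarrow> real^'n" where "boundary_proj x = (1 / g x) *\<^sub>R x"

lemma proj_measurable [measurable]: "boundary_proj \<in> borel_measurable borel"
  unfolding boundary_proj_def[abs_def] by measurable

lemma gauge_proj: "x \<noteq> 0 \<Longrightarrow> g (boundary_proj x) = 1"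
  unfolding boundary_proj_def using W.gauge_pos[of x] W.gauge_scale[of "1 / g x" x] by simp

lemma quermass_radial_inner:
  assumes "wulff_function h'" and q: "1 < q"
  shows "(\<integral>\<^sup>+r. indicator (wulff_shape h') ((r / g x) *\<^sub>R x) *
        ennreal (exp (- (norm ((r / g x) *\<^sub>R x))\<^sup>2 / 2) * norm ((r / g x) *\<^sub>R x) powr (q - real CARD('n))) *
        ennreal (real CARD('n) * r ^ (CARD('n) - 1)) * indicator {0<..} r \<partial>lborel)
     = ennreal (radial_mass q (boundary_proj x) (1 / wulff_gauge h' (boundary_proj x)))"
proof -
  interpret W': wulff_function h' by fact
  let ?n = "CARD('n)"
  define y where "y = boundary_proj x"
  have ry: "(r / g x) *\<^sub>R x = r *\<^sub>R y" for r unfolding y_def boundary_proj_def by simp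
  show ?thesis
  proof (cases "x = 0")
    case True
    then show ?thesis by (simp add: radial_mass_def boundary_proj_def)
  next
    case False
    have y0: "y \<noteq> 0" using gauge_proj[OF False] unfolding y_def[symmetric] by auto
    have gy: "0 < wulff_gauge h' y" using W'.gauge_pos[OF y0] .
    have "(\<integral>\<^sup>+r. indicator (wulff_shape h') ((r / g x) *\<^sub>R x) *
        ennreal (exp (- (norm ((r / g x) *\<^sub>R x))\<^sup>2 / 2) * norm ((r / g x) *\<^sub>R x) powr (q - real ?n)) *
        ennreal (real ?n * r ^ (?n - 1)) * indicator {0<..} r \<partial>lborel)
      = (\<integral>\<^sup>+r. ennreal (radial_density q y r) * indicator {0<..1 / wulff_gauge h' y} r \<partial>lborel)"
    proof (rule nn_integral_cong)
      fix r :: real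
      show "indicator (wulff_shape h') ((r / g x) *\<^sub>R x) *
        ennreal (exp (- (norm ((r / g x) *\<^sub>R x))\<^sup>2 / 2) * norm ((r / g x) *\<^sub>R x) powr (q - real ?n)) *
        ennreal (real ?n * r ^ (?n - 1)) * indicator {0<..} r = ennreal (radial_density q y r) * indicator {0<..1 / wulff_gauge h' y} r"
      proof (cases "0 < r")
        case True
        have in_iff: "r *\<^sub>R y \<in> wulff_shape h' \<longleftrightarrow> r \<le> 1 / wulff_gauge h' y"
          unfolding W'.wulff_shape_eq using W'.gauge_scale[of r y] True gy by (simp add: field_simps)
        have nr: "norm (r *\<^sub>R y) = r * norm y" using True by simp
        have "r powr (q - real ?n) * r ^ (?n - 1) = r powr (q - 1)"
        proof -
          have "r ^ (?n - 1) = r powr (real ?n - 1)"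
            using powr_realpow[OF True, of "?n - 1"] by (simp add: of_nat_diff Suc_le_eq)
          then show ?thesis by (simp add: powr_add[symmetric])
        qed
        then have "exp (- (r * norm y)\<^sup>2 / 2) * (r * norm y) powr (q - real ?n) * (real ?n * r ^ (?n - 1)) = radial_density q y r"
          unfolding radial_density_def using True by (simp add: powr_mult mult_ac)
        then have "ennreal (exp (- (r * norm y)\<^sup>2 / 2) * (r * norm y) powr (q - real ?n)) * ennreal (real ?n * r ^ (?n - 1)) = ennreal (radial_density q y r)"
          using True by (subst ennreal_mult[symmetric]) auto
        then show ?thesis unfolding ry nr using True by (auto simp: indicator_def in_iff)
      qed auto
    qed
    also have "\<dots> = ennreal (radial_mass q y (1 / wulff_gauge h' y))"
      by (rule nn_integral_radial_density[OF q])
    finally show ?thesis unfolding y_def .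
  qed
qed

lemma quermass_measurable:
  assumes "wulff_function h'" and q: "1 < q"
  shows "(\<lambda>x. radial_mass q (boundary_proj x) (1 / wulff_gauge h' (boundary_proj x))) \<in> borel_measurable borel"
proof -
  interpret W': wulff_function h' by fact
  have [measurable]: "(\<lambda>x. \<integral>\<^sup>+r. indicator (wulff_shape h') ((r / g x) *\<^sub>R x) *
        ennreal (exp (- (norm ((r / g x) *\<^sub>R x))\<^sup>2 / 2) * norm ((r / g x) *\<^sub>R x) powr (q - real CARD('n))) *
        ennreal (real CARD('n) * r ^ (CARD('n) - 1)) * indicator {0<..} r \<partial>lborel) \<in> borel_measurable borel"
    by measurable
  have "(\<lambda>x. enn2real (\<integral>\<^sup>+r. indicator (wulff_shape h') ((r / g x) *\<^sub>R x) *
        ennreal (exp (- (norm ((r / g x) *\<^sub>R x))\<^sup>2 / 2) * norm ((r / g x) *\<^sub>R x) powr (q - real CARD('n))) *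
        ennreal (real CARD('n) * r ^ (CARD('n) - 1)) * indicator {0<..} r \<partial>lborel)) \<in> borel_measurable borel"
    by measurable
  then show ?thesis unfolding quermass_radial_inner[OF assms] by (simp add: radial_mass_nonneg[OF q])
qed

text \<open>
  On the ray through \<open>x\<close> the Wulff shape of \<open>h'\<close> is the interval that ends at the reciprocal of its gauge
  at the boundary point \<open>boundary_proj x\<close>.
\<close>
lemma quermass_formula:
  assumes "wulff_function h'" and q: "1 < q"
  shows "gauss_dual_quermass q (wulff_shape h') = (LINT x:K|lborel. radial_mass q (boundary_proj x) (1 / wulff_gauge h' (boundary_proj x)))"
proof -
  interpret W': wulff_function h' by fact
  have m [measurable]: "(\<lambda>x. radial_mass q (boundary_proj x) (1 / wulff_gauge h' (boundary_proj x))) \<in> borel_measurable borel"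
    by (rule quermass_measurable[OF assms])
  define w where "w = (\<lambda>x::real^'n. exp (- (norm x)\<^sup>2 / 2) * norm x powr (q - real CARD('n)))"
  have w0: "0 \<le> w x" for x unfolding w_def by simp
  have [measurable]: "w \<in> borel_measurable borel" unfolding w_def by measurable
  have "gauss_dual_quermass q (wulff_shape h') = enn2real (\<integral>\<^sup>+x. ennreal (indicator (wulff_shape h') x *\<^sub>R w x) \<partial>lborel)"
    unfolding gauss_dual_quermass_def set_lebesgue_integral_def w_def[symmetric]
    by (subst integral_eq_nn_integral) (auto simp: w0)
  also have "(\<integral>\<^sup>+x. ennreal (indicator (wulff_shape h') x *\<^sub>R w x) \<partial>lborel) = (\<integral>\<^sup>+x. indicator (wulff_shape h') x * ennreal (w x) \<partial>lborel)"
    by (rule nn_integral_cong) (auto simp: indicator_def)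
  also have "\<dots> = (\<integral>\<^sup>+x. indicator K x * ennreal (radial_mass q (boundary_proj x) (1 / wulff_gauge h' (boundary_proj x))) \<partial>lborel)"
  proof -
    have "(\<integral>\<^sup>+x. indicator (wulff_shape h') x * ennreal (w x) \<partial>lborel) =
      (\<integral>\<^sup>+x. indicator (wulff_shape h) x *
       (\<integral>\<^sup>+r. indicator (wulff_shape h') ((r / g x) *\<^sub>R x) * ennreal (w ((r / g x) *\<^sub>R x)) * ennreal (real CARD('n) * r ^ (CARD('n) - 1)) * indicator {0<..} r \<partial>lborel) \<partial>lborel)"
      by (rule W.nn_integral_polar) measurable
    then show ?thesis unfolding w_def quermass_radial_inner[OF assms] wulff_shape_support_fun .
  qed
  also have "\<dots> = (\<integral>\<^sup>+x. ennreal (indicator K x *\<^sub>R radial_mass q (boundary_proj x) (1 / wulff_gauge h' (boundary_proj x))) \<partial>lborel)"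
    by (rule nn_integral_cong) (auto simp: indicator_def)
  also have "enn2real \<dots> = (LINT x:K|lborel. radial_mass q (boundary_proj x) (1 / wulff_gauge h' (boundary_proj x)))"
    unfolding set_lebesgue_integral_def
    by (subst integral_eq_nn_integral) (auto simp: radial_mass_nonneg[OF q])
  finally show ?thesis .
qed

end

section \<open>Differentiation under the integral sign\<close>

context convex_body_o begin

text \<open>
  Upper semicontinuity of the normals: away from the normal at \<open>y0\<close> the support inequality is strict,
  with a uniform gap by compactness, and the gap survives a small motion of the base point.
\<close>
lemma normals_near_regular:
  assumes y0: "y0 \<in> regular_boundary K" and e: "0 < \<eta>"
  shows "\<exists>r>0. \<forall>x v. dist x y0 < r \<longrightarrow> g x = 1 \<longrightarrow> outer_unit_normal K x v \<longrightarrow> dist v (gauss_map K y0) < \<eta>"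
proof -
  define \<nu> where "\<nu> = gauss_map K y0"
  have g0: "g y0 = 1" using y0 regular_boundary_iff by blast
  define C where "C = sphere 0 1 - ball \<nu> \<eta>"
  have compC: "compact C" unfolding C_def by (intro compact_diff) auto
  have gap: "0 < h v - y0 \<bullet> v" if v: "v \<in> C" for v
  proof -
    have vs: "v \<in> sphere 0 1" and vn: "v \<noteq> \<nu>" using v e unfolding C_def by auto
    have "(y0 \<bullet> v) / h v \<le> 1" using W.gauge_upper[OF vs, of y0] g0 by simp
    then have "y0 \<bullet> v \<le> h v" using W.pos[OF vs] by (simp add: field_simps)
    moreover have "y0 \<bullet> v \<noteq> h v"
      using gauss_map_unique[OF y0, of v] vs vn unfolding outer_unit_normal_iff[OF g0] \<nu>_def by blast
    ultimately show ?thesis by simp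
  qed
  have "\<exists>r>0. \<forall>v\<in>C. r \<le> h v - y0 \<bullet> v"
  proof (cases "C = {}")
    case False
    have "continuous_on C (\<lambda>v. h v - y0 \<bullet> v)"
      by (intro continuous_intros continuous_on_subset[OF support_fun_continuous]) auto
    then obtain v where "v \<in> C" "\<forall>w\<in>C. h v - y0 \<bullet> v \<le> h w - y0 \<bullet> w"
      using continuous_attains_inf[OF compC False] by blast
    then show ?thesis using gap by blast
  qed (auto intro: exI[of _ 1])
  then obtain r where r: "0 < r" "\<forall>v\<in>C. r \<le> h v - y0 \<bullet> v" by blast
  show ?thesis
  proof (intro exI[of _ r] conjI allI impI r(1))
    fix x v assume x: "dist x y0 < r" "g x = 1" and n: "outer_unit_normal K x v"
    have vs: "v \<in> sphere 0 1" and xv: "x \<bullet> v = h v" using n outer_unit_normal_iff[OF x(2)] by auto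
    have "(x - y0) \<bullet> v \<le> norm (x - y0)" using norm_cauchy_schwarz[of "x - y0" v] vs by simp
    then have "h v - y0 \<bullet> v < r" using xv x(1) by (simp add: inner_diff_left dist_norm)
    then have "v \<notin> C" using r(2) by force
    then show "dist v (gauss_map K y0) < \<eta>" using vs unfolding C_def \<nu>_def by (simp add: dist_commute)
  qed
qed

lemma gauss_map_continuous: "continuous_on (regular_boundary K) (gauss_map K)"
  unfolding continuous_on_iff
proof (intro ballI allI impI)
  fix y0 and \<eta> :: real assume y0: "y0 \<in> regular_boundary K" and e: "0 < \<eta>"
  obtain r where "0 < r" "\<forall>x v. dist x y0 < r \<longrightarrow> g x = 1 \<longrightarrow> outer_unit_normal K x v \<longrightarrow> dist v (gauss_map K y0) < \<eta>"
    using normals_near_regular[OF y0 e] by blast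
  then show "\<exists>d>0. \<forall>x'\<in>regular_boundary K. dist x' y0 < d \<longrightarrow> dist (gauss_map K x') (gauss_map K y0) < \<eta>"
    using gauss_map_normal regular_boundary_iff by blast
qed

text \<open>
  The points with two normals at distance at least \<open>1 / (k + 1)\<close> form a projection of a compact set.
\<close>
lemma regular_boundary_measurable [measurable]: "regular_boundary K \<in> sets borel"
proof -
  define N where "N = (\<lambda>k::nat. {(y, v, w). y \<in> {y. g y = 1} \<and> v \<in> sphere 0 1 \<and> w \<in> sphere 0 1 \<and> y \<bullet> v = h v \<and> y \<bullet> w = h w \<and> 1 / real (Suc k) \<le> dist v w})"
  have cg: "continuous_on S g" for S using W.gauge_continuous continuous_on_subset by blast
  have ch: "continuous_on S h" for S using support_fun_continuous continuous_on_subset by blast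
  have "closed (fst ` N k)" for k
  proof -
    have comp: "compact (frontier K \<times> sphere (0::real^'n) 1 \<times> sphere (0::real^'n) 1)"
      by (intro compact_Times compact_frontier compact_K compact_sphere)
    have cl: "closed {z :: (real^'n) \<times> (real^'n) \<times> (real^'n). fst z \<bullet> fst (snd z) = h (fst (snd z)) \<and> fst z \<bullet> snd (snd z) = h (snd (snd z)) \<and> 1 / real (Suc k) \<le> dist (fst (snd z)) (snd (snd z))}"
      by (intro closed_Collect_conj closed_Collect_eq closed_Collect_le continuous_intros continuous_on_compose2[OF ch[of UNIV]]) auto
    have "N k = (frontier K \<times> sphere 0 1 \<times> sphere 0 1) \<inter> {z. fst z \<bullet> fst (snd z) = h (fst (snd z)) \<and> fst z \<bullet> snd (snd z) = h (snd (snd z)) \<and> 1 / real (Suc k) \<le> dist (fst (snd z)) (snd (snd z))}"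
      unfolding N_def frontier_eq by auto
    then have "compact (N k)" using compact_Int_closed[OF comp cl] by simp
    then have "compact (fst ` N k)" by (intro compact_continuous_image continuous_intros)
    then show ?thesis by (rule compact_imp_closed)
  qed
  then have 1: "(\<Union>k. fst ` N k) \<in> sets borel" by (intro sets.countable_UN) auto
  have "regular_boundary K = frontier K - (\<Union>k. fst ` N k)"
  proof (intro set_eqI iffI)
    fix x assume x: "x \<in> regular_boundary K"
    then have gx: "g x = 1" using regular_boundary_iff by blast
    have "x \<notin> fst ` N k" for k
    proof
      assume "x \<in> fst ` N k"
      then obtain v w where vw: "v \<in> sphere 0 1" "w \<in> sphere 0 1" "x \<bullet> v = h v" "x \<bullet> w = h w" "1 / real (Suc k) \<le> dist v w"
        unfolding N_def by auto
      then have "v = gauss_map K x" "w = gauss_map K x"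
        using gauss_map_unique[OF x] outer_unit_normal_iff[OF gx] by blast+
      then have "1 / real (Suc k) \<le> 0" using vw(5) by simp
      then show False by (simp add: divide_le_0_iff)
    qed
    then show "x \<in> frontier K - (\<Union>k. fst ` N k)" using gx frontier_eq by auto
  next
    fix x assume x: "x \<in> frontier K - (\<Union>k. fst ` N k)"
    then have gx: "g x = 1" using frontier_eq by auto
    have "v = w" if "outer_unit_normal K x v" "outer_unit_normal K x w" for v w
    proof (rule ccontr)
      assume "v \<noteq> w"
      then obtain k where "1 / real (Suc k) < dist v w" using nat_approx_posE[of "dist v w"] by auto
      then have "(x, v, w) \<in> N k" unfolding N_def using that gx outer_unit_normal_iff[OF gx] by auto
      then have "x \<in> fst ` N k" by force
      then show False using x by blast
    qed
    then show "x \<in> regular_boundary K" using outer_unit_normal_exists[OF gx] gx unfolding regular_boundary_iff by blast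
  qed
  then show ?thesis using 1 by (simp add: borel_closed[OF frontier_closed])
qed

lemma AE_proj_regular: "AE x in lborel. boundary_proj x \<in> regular_boundary K"
proof -
  have AE0: "AE x in lborel. x \<noteq> (0::real^'n)" by (rule AE_lborel_singleton)
  show ?thesis
    using AE0 W.AE_unique_maximizer
  proof eventually_elim
    case (elim x)
    have gp: "g (boundary_proj x) = 1" using gauge_proj elim(1) .
    have gx: "0 < g x" using W.gauge_pos elim(1) .
    have iff: "(boundary_proj x \<bullet> v) / h v = 1 \<longleftrightarrow> (x \<bullet> v) / h v = g x" for v
    proof -
      have "(boundary_proj x \<bullet> v) / h v = ((x \<bullet> v) / h v) / g x" unfolding boundary_proj_def by simp
      moreover have "a / g x = 1 \<longleftrightarrow> a = g x" for a using gx by auto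
      ultimately show ?thesis by (simp only:)
    qed
    have "v = w" if "outer_unit_normal K (boundary_proj x) v" "outer_unit_normal K (boundary_proj x) w" for v w
      using that elim(2) unfolding outer_unit_normal_iff_ratio[OF gp] iff by blast
    then show ?case using outer_unit_normal_exists[OF gp] gp unfolding regular_boundary_iff by blast
  qed
qed

end

text \<open>
  For integral \<open>p\<close> this is an ordinary power; otherwise it is a difference of powers of the positive and
  the negative part.
\<close>
lemma rpow_continuous:
  assumes p: "1 < p" shows "continuous_on UNIV (\<lambda>s. rpow s p)"
proof (cases "p \<in> \<int>")
  case True
  then obtain k where k: "p = of_int k" by (auto elim: Ints_cases)
  define m where "m = nat k"
  have m: "p = real m" "0 < m" "\<lfloor>p\<rfloor> = int m" unfolding m_def using p k by auto
  have "rpow s p = s ^ m" for s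
  proof (cases "s > 0")
    case True
    then show ?thesis unfolding rpow_def m(1) by (simp add: powr_realpow)
  next
    case False
    show ?thesis
    proof (cases "s = 0")
      case True then show ?thesis using m(2) by (simp add: rpow_def zero_power)
    next
      case nz: False
      then have "rpow s p = s powi \<lfloor>p\<rfloor>" using False True unfolding rpow_def by simp
      then show ?thesis unfolding m(3) by (simp add: power_int_def)
    qed
  qed
  then show ?thesis by (simp add: continuous_intros)
next
  case False
  have "rpow s p = max 0 s powr p - max 0 (- s) powr p" for s
    unfolding rpow_def using False p by (auto simp: max_def)
  moreover have "continuous_on UNIV (\<lambda>s::real. max 0 s powr p - max 0 (- s) powr p)"
    using p by (intro continuous_intros continuous_on_powr') auto
  ultimately show ?thesis by simp
qed

locale Lp_variation = convex_body_o K for K :: "(real^'n) set" +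
  fixes p q :: real and f :: "real^'n \<Rightarrow> real"
  assumes p: "1 < p" and q: "1 < q" and f: "continuous_on (sphere 0 1) f"
begin

text \<open>
  The function \<open>F\<close> of the introduction: \<open>h\<^sub>K\<^sup>p + t f\<^sup>p = h\<^sub>K\<^sup>p (1 + t F)\<close>.
\<close>
definition relative_rate :: "real^'n \<Rightarrow> real" where "relative_rate v = rpow (f v) p / h v powr p"

definition inverse_root :: "real \<Rightarrow> real" where "inverse_root s = (1 + s) powr (- 1 / p)"

definition perturbed_gauge :: "real \<Rightarrow> real^'n \<Rightarrow> real" where "perturbed_gauge t = wulff_gauge (Lp_perturbation p K f t)"

lemma rpow_f_continuous: "continuous_on (sphere 0 1) (\<lambda>v. rpow (f v) p)"
  using continuous_on_compose2[OF rpow_continuous[OF p] f] by simp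

lemma relative_rate_continuous: "continuous_on (sphere 0 1) relative_rate"
  unfolding relative_rate_def
proof (intro continuous_intros rpow_f_continuous W.cont)
  show "\<forall>v\<in>sphere 0 1. h v \<noteq> 0" "\<forall>v\<in>sphere 0 1. h v powr p \<noteq> 0" using W.pos by force+
qed

lemma relative_rate_bounded: "\<exists>M>0. \<forall>v\<in>sphere 0 1. \<bar>relative_rate v\<bar> \<le> M"
proof -
  have "bounded (relative_rate ` sphere 0 1)"
    by (intro compact_imp_bounded compact_continuous_image relative_rate_continuous compact_sphere)
  then show ?thesis unfolding bounded_pos by auto
qed

lemma perturbation_base: "v \<in> sphere 0 1 \<Longrightarrow> h v powr p + t * rpow (f v) p = h v powr p * (1 + t * relative_rate v)"
  using W.pos[of v] unfolding relative_rate_def by (simp add: field_simps)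

lemma perturbation_eq:
  assumes "v \<in> sphere 0 1" "0 < 1 + t * relative_rate v"
  shows "Lp_perturbation p K f t v = h v * (1 + t * relative_rate v) powr (1 / p)"
  unfolding Lp_perturbation_def perturbation_base[OF assms(1)]
  using assms W.pos[of v] p by (simp add: powr_mult powr_powr)

lemma perturbation_wulff:
  assumes pos: "\<And>v. v \<in> sphere 0 1 \<Longrightarrow> 0 < 1 + t * relative_rate v"
  shows "wulff_function (Lp_perturbation p K f t)"
proof
  have "continuous_on (sphere 0 1) (\<lambda>v. h v * (1 + t * relative_rate v) powr (1 / p))"
    by (intro continuous_intros W.cont relative_rate_continuous) (use pos in force)
  then show "continuous_on (sphere 0 1) (Lp_perturbation p K f t)"
    by (rule continuous_on_eq) (use perturbation_eq pos in force)
  show "0 < Lp_perturbation p K f t v" if "v \<in> sphere 0 1" for v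
    using perturbation_eq[OF that pos[OF that]] W.pos[OF that] pos[OF that] by simp
qed

lemma perturbation_ratio:
  assumes "v \<in> sphere 0 1" "0 < 1 + t * relative_rate v"
  shows "(y \<bullet> v) / Lp_perturbation p K f t v = (y \<bullet> v) / h v * inverse_root (t * relative_rate v)"
  unfolding perturbation_eq[OF assms] inverse_root_def by (simp add: powr_minus divide_inverse)

lemma inverse_root_expansion:
  assumes "0 < e" shows "\<exists>d>0. \<forall>s. \<bar>s\<bar> < d \<longrightarrow> \<bar>inverse_root s - 1 + s / p\<bar> \<le> e * \<bar>s\<bar>"
proof -
  have "(inverse_root has_real_derivative (- 1 / p) * (1 + 0) powr (- 1 / p - 1) * 1) (at 0)"
    unfolding inverse_root_def[abs_def] by (auto intro!: derivative_eq_intros)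
  then have "(inverse_root has_real_derivative (- 1 / p)) (at 0)" by simp
  then have "(inverse_root has_derivative (*) (- 1 / p)) (at 0)" unfolding has_field_derivative_def .
  then obtain d where d: "0 < d" "\<forall>s. norm (s - 0) < d \<longrightarrow> norm (inverse_root s - inverse_root 0 - (- 1 / p) * (s - 0)) \<le> e * norm (s - 0)"
    unfolding has_derivative_at_alt using assms by blast
  then show ?thesis by (intro exI[of _ d]) (auto simp: inverse_root_def)
qed

text \<open>
  Linear bounds in \<open>t\<close> that are uniform in the direction; they provide the majorant for dominated
  convergence. A maximiser for \<open>t\<close> bounds the perturbed gauge from above, one for \<open>t = 0\<close> from below.
\<close>
lemma gauge_perturbation_bound:
  "\<exists>C>0. \<exists>d>0. (\<forall>t. \<bar>t\<bar> < d \<longrightarrow> (\<forall>v\<in>sphere 0 1. 0 < 1 + t * relative_rate v)) \<and>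
     (\<forall>t. \<bar>t\<bar> < d \<longrightarrow> (\<forall>v\<in>sphere 0 1. \<bar>inverse_root (t * relative_rate v) - 1\<bar> \<le> C * \<bar>t\<bar>)) \<and>
     (\<forall>t y. \<bar>t\<bar> < d \<longrightarrow> g y = 1 \<longrightarrow> \<bar>perturbed_gauge t y - 1\<bar> \<le> C * \<bar>t\<bar>)"
proof -
  obtain M where M: "0 < M" "\<And>v. v \<in> sphere 0 1 \<Longrightarrow> \<bar>relative_rate v\<bar> \<le> M" using relative_rate_bounded by blast
  obtain d0 where d0: "0 < d0" "\<And>s. \<bar>s\<bar> < d0 \<Longrightarrow> \<bar>inverse_root s - 1 + s / p\<bar> \<le> 1 * \<bar>s\<bar>" using inverse_root_expansion[of 1] by auto
  define d where "d = min (d0 / M) (1 / M)"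
  define C where "C = 2 * M"
  have d: "0 < d" unfolding d_def using M d0 by simp
  have tF: "\<bar>t * relative_rate v\<bar> < d0" "\<bar>t * relative_rate v\<bar> < 1" "\<bar>t * relative_rate v\<bar> \<le> M * \<bar>t\<bar>" if "\<bar>t\<bar> < d" "v \<in> sphere 0 1" for t v
  proof -
    have "\<bar>t * relative_rate v\<bar> \<le> \<bar>t\<bar> * M" using M(2)[OF that(2)] by (simp add: abs_mult mult_left_mono)
    moreover have "\<bar>t\<bar> * M < d0" "\<bar>t\<bar> * M < 1" using that(1) M(1) unfolding d_def by (auto simp: field_simps)
    ultimately show "\<bar>t * relative_rate v\<bar> < d0" "\<bar>t * relative_rate v\<bar> < 1" "\<bar>t * relative_rate v\<bar> \<le> M * \<bar>t\<bar>" by (auto simp: mult.commute)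
  qed
  have pos: "0 < 1 + t * relative_rate v" if "\<bar>t\<bar> < d" "v \<in> sphere 0 1" for t v using tF(2)[OF that] by linarith
  have cb: "\<bar>inverse_root (t * relative_rate v) - 1\<bar> \<le> C * \<bar>t\<bar>" if "\<bar>t\<bar> < d" "v \<in> sphere 0 1" for t v
  proof -
    have "\<bar>inverse_root (t * relative_rate v) - 1 + t * relative_rate v / p\<bar> \<le> \<bar>t * relative_rate v\<bar>" using d0(2)[OF tF(1)[OF that]] by simp
    moreover have "\<bar>t * relative_rate v / p\<bar> \<le> \<bar>t * relative_rate v\<bar>"
      using p by (simp add: divide_le_eq mult_le_cancel_left1)
    ultimately have "\<bar>inverse_root (t * relative_rate v) - 1\<bar> \<le> 2 * \<bar>t * relative_rate v\<bar>" by linarith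
    then show ?thesis using tF(3)[OF that] unfolding C_def by linarith
  qed
  have c0: "0 \<le> inverse_root s" for s unfolding inverse_root_def by simp
  have Gb: "\<bar>perturbed_gauge t y - 1\<bar> \<le> C * \<bar>t\<bar>" if t: "\<bar>t\<bar> < d" and y: "g y = 1" for t y
  proof -
    interpret P: wulff_function "Lp_perturbation p K f t" using perturbation_wulff pos[OF t] by blast
    obtain v where v: "v \<in> sphere 0 1" "perturbed_gauge t y = (y \<bullet> v) / h v * inverse_root (t * relative_rate v)"
      using P.gauge_attained[of y] perturbation_ratio pos[OF t] unfolding perturbed_gauge_def by metis
    have a: "(y \<bullet> v) / h v \<le> 1" using W.gauge_upper[OF v(1), of y] y by simp
    have "perturbed_gauge t y \<le> 1 * inverse_root (t * relative_rate v)" unfolding v(2) using a c0 by (intro mult_right_mono) auto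
    then have "perturbed_gauge t y \<le> 1 + C * \<bar>t\<bar>" using cb[OF t v(1)] by linarith
    moreover obtain w where w: "w \<in> sphere 0 1" "1 = (y \<bullet> w) / h w" using W.gauge_attained[of y] y by auto
    have "1 * inverse_root (t * relative_rate w) \<le> perturbed_gauge t y"
      using P.gauge_upper[OF w(1), of y] perturbation_ratio[OF w(1) pos[OF t w(1)], of y] w(2) unfolding perturbed_gauge_def by simp
    then have "1 - C * \<bar>t\<bar> \<le> perturbed_gauge t y" using cb[OF t w(1)] by linarith
    ultimately show ?thesis by linarith
  qed
  have "0 < C" unfolding C_def using M by simp
  then show ?thesis using d pos cb Gb by blast
qed

text \<open>
  Danskin's theorem for a unique maximiser \<open>\<nu>\<close>. Testing with \<open>\<nu>\<close> gives the lower bound. For the upper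
  bound, directions in which \<open>relative_rate\<close> is close to its value at \<open>\<nu>\<close> change the maximum by the right
  amount, and the other ones lie in a compact set on which the unperturbed ratio stays below \<open>1 - \<eta>\<close>,
  so for small \<open>t\<close> they do not compete.
\<close>
lemma gauge_perturbation_deriv:
  assumes y: "y \<in> regular_boundary K"
  shows "((\<lambda>t. perturbed_gauge t y) has_real_derivative - relative_rate (gauss_map K y) / p) (at 0)"
proof -
  define \<nu> where "\<nu> = gauss_map K y"
  have gy: "g y = 1" using y regular_boundary_iff by blast
  have \<nu>: "\<nu> \<in> sphere 0 1" "(y \<bullet> \<nu>) / h \<nu> = 1"
    using gauss_map_normal[OF y] unfolding \<nu>_def outer_unit_normal_iff_ratio[OF gy] by auto
  obtain M where M: "0 < M" "\<And>v. v \<in> sphere 0 1 \<Longrightarrow> \<bar>relative_rate v\<bar> \<le> M" using relative_rate_bounded by blast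
  obtain C d1 where C: "0 < C" and d1: "0 < d1"
    and pos: "\<And>t v. \<bar>t\<bar> < d1 \<Longrightarrow> v \<in> sphere 0 1 \<Longrightarrow> 0 < 1 + t * relative_rate v"
    and cb: "\<And>t v. \<bar>t\<bar> < d1 \<Longrightarrow> v \<in> sphere 0 1 \<Longrightarrow> \<bar>inverse_root (t * relative_rate v) - 1\<bar> \<le> C * \<bar>t\<bar>"
    and Gb: "\<And>t y. \<bar>t\<bar> < d1 \<Longrightarrow> g y = 1 \<Longrightarrow> \<bar>perturbed_gauge t y - 1\<bar> \<le> C * \<bar>t\<bar>"
    using gauge_perturbation_bound by metis
  have G0: "perturbed_gauge 0 y = 1" using Gb[of 0 y] d1 gy by simp
  have c0: "0 \<le> inverse_root s" for s unfolding inverse_root_def by simp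
  have "\<exists>d>0. \<forall>t. norm (t - 0) < d \<longrightarrow> norm (perturbed_gauge t y - perturbed_gauge 0 y - (- relative_rate \<nu> / p) * (t - 0)) \<le> e * norm (t - 0)" if e: "0 < e" for e
  proof -
    define e1 where "e1 = e / (2 * M)"
    have e1: "0 < e1" "e1 * M = e / 2" unfolding e1_def using e M by auto
    obtain d2 where d2: "0 < d2" "\<And>s. \<bar>s\<bar> < d2 \<Longrightarrow> \<bar>inverse_root s - 1 + s / p\<bar> \<le> e1 * \<bar>s\<bar>" using inverse_root_expansion[OF e1(1)] by blast
    have exp: "\<bar>inverse_root (t * relative_rate v) - 1 + t * relative_rate v / p\<bar> \<le> e / 2 * \<bar>t\<bar>" if "\<bar>t\<bar> < d2 / M" "v \<in> sphere 0 1" for t v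
    proof -
      have le: "\<bar>t * relative_rate v\<bar> \<le> \<bar>t\<bar> * M" using M(2)[OF that(2)] by (simp add: abs_mult mult_left_mono)
      moreover have "\<bar>t\<bar> * M < d2" using that(1) M(1) by (simp add: field_simps)
      ultimately have "\<bar>inverse_root (t * relative_rate v) - 1 + t * relative_rate v / p\<bar> \<le> e1 * \<bar>t * relative_rate v\<bar>" by (intro d2(2)) linarith
      also have "\<dots> \<le> e1 * (\<bar>t\<bar> * M)" using le e1 by (intro mult_left_mono) auto
      also have "\<dots> = (e1 * M) * \<bar>t\<bar>" by simp
      finally show ?thesis unfolding e1(2) .
    qed
    define S' where "S' = sphere 0 1 \<inter> {v. e / 2 \<le> \<bar>relative_rate v - relative_rate \<nu>\<bar>}"
    have S': "compact S'"
    proof -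
      have "closed (sphere 0 1 \<inter> (\<lambda>v. \<bar>relative_rate v - relative_rate \<nu>\<bar>) -` {e / 2..})"
        by (intro continuous_closed_preimage continuous_intros relative_rate_continuous) auto
      moreover have "S' = sphere 0 1 \<inter> (\<lambda>v. \<bar>relative_rate v - relative_rate \<nu>\<bar>) -` {e / 2..}" unfolding S'_def by auto
      ultimately have "closed S'" by simp
      then have "compact (sphere 0 1 \<inter> S')" by (intro compact_Int_closed compact_sphere)
      moreover have "sphere 0 1 \<inter> S' = S'" unfolding S'_def by auto
      ultimately show ?thesis by simp
    qed
    have "\<exists>\<eta>>0. \<eta> \<le> 1 \<and> (\<forall>v\<in>S'. (y \<bullet> v) / h v \<le> 1 - \<eta>)"
    proof (cases "S' = {}")
      case False
      have "continuous_on S' (\<lambda>v. (y \<bullet> v) / h v)"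
        using W.ratio_continuous by (rule continuous_on_subset) (auto simp: S'_def)
      then obtain v where v: "v \<in> S'" "\<forall>w\<in>S'. (y \<bullet> w) / h w \<le> (y \<bullet> v) / h v"
        using continuous_attains_sup[OF S' False] by blast
      have vs: "v \<in> sphere 0 1" and ne: "v \<noteq> \<nu>" using v(1) e unfolding S'_def by auto
      have "(y \<bullet> v) / h v \<le> 1" using W.gauge_upper[OF vs, of y] gy by simp
      moreover have "(y \<bullet> v) / h v \<noteq> 1"
        using gauss_map_unique[OF y, of v] ne vs unfolding outer_unit_normal_iff_ratio[OF gy] \<nu>_def by blast
      ultimately have "(y \<bullet> v) / h v < 1" by (rule le_neq_trans)
      then show ?thesis using v(2) by (intro exI[of _ "min 1 (1 - (y \<bullet> v) / h v)"]) force
    qed (auto intro: exI[of _ 1])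
    then obtain \<eta> where \<eta>: "0 < \<eta>" "\<eta> \<le> 1" "\<And>v. v \<in> S' \<Longrightarrow> (y \<bullet> v) / h v \<le> 1 - \<eta>" by blast
    \<comment> \<open>the third bound makes \<open>(1 - \<eta>) (1 + C \<bar>t\<bar>) \<le> 1 - M \<bar>t\<bar>\<close>, which settles the directions in \<open>S'\<close>\<close>
    define d where "d = min d1 (min (d2 / M) (\<eta> / (C + M)))"
    have d: "0 < d" unfolding d_def using d1 d2 M \<eta> C by auto
    show ?thesis
    proof (intro exI[of _ d] conjI allI impI d)
      fix t :: real assume "norm (t - 0) < d"
      then have t: "\<bar>t\<bar> < d1" "\<bar>t\<bar> < d2 / M" "\<bar>t\<bar> < \<eta> / (C + M)" unfolding d_def by auto
      interpret P: wulff_function "Lp_perturbation p K f t" using perturbation_wulff pos[OF t(1)] by blast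
      have "inverse_root (t * relative_rate \<nu>) \<le> perturbed_gauge t y"
        using P.gauge_upper[OF \<nu>(1), of y] perturbation_ratio[OF \<nu>(1) pos[OF t(1) \<nu>(1)], of y] \<nu>(2) unfolding perturbed_gauge_def by simp
      then have low: "1 - t * relative_rate \<nu> / p - e / 2 * \<bar>t\<bar> \<le> perturbed_gauge t y" using exp[OF t(2) \<nu>(1)] by linarith
      obtain v where v: "v \<in> sphere 0 1" "perturbed_gauge t y = (y \<bullet> v) / h v * inverse_root (t * relative_rate v)"
        using P.gauge_attained[of y] perturbation_ratio pos[OF t(1)] unfolding perturbed_gauge_def by metis
      have up: "perturbed_gauge t y \<le> 1 - t * relative_rate \<nu> / p + e * \<bar>t\<bar>"
      proof (cases "v \<in> S'")
        case False
        have a: "(y \<bullet> v) / h v \<le> 1" using W.gauge_upper[OF v(1), of y] gy by simp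
        have "perturbed_gauge t y \<le> 1 * inverse_root (t * relative_rate v)" unfolding v(2) using a c0 by (intro mult_right_mono) auto
        then have 1: "perturbed_gauge t y \<le> 1 - t * relative_rate v / p + e / 2 * \<bar>t\<bar>" using exp[OF t(2) v(1)] by linarith
        have "\<bar>relative_rate v - relative_rate \<nu>\<bar> < e / 2" using False v(1) unfolding S'_def by auto
        then have "\<bar>t\<bar> * \<bar>relative_rate v - relative_rate \<nu>\<bar> \<le> \<bar>t\<bar> * (e / 2)" by (intro mult_left_mono) auto
        then have "\<bar>t * relative_rate v - t * relative_rate \<nu>\<bar> \<le> e / 2 * \<bar>t\<bar>" by (simp add: abs_mult mult.commute flip: right_diff_distrib)
        moreover have "\<bar>t * relative_rate v / p - t * relative_rate \<nu> / p\<bar> \<le> \<bar>t * relative_rate v - t * relative_rate \<nu>\<bar>"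
        proof -
          have "\<bar>t * relative_rate v / p - t * relative_rate \<nu> / p\<bar> = \<bar>t * relative_rate v - t * relative_rate \<nu>\<bar> / p" using p by (simp flip: diff_divide_distrib)
          also have "\<dots> \<le> \<bar>t * relative_rate v - t * relative_rate \<nu>\<bar>" using p by (simp add: divide_le_eq mult_le_cancel_left1)
          finally show ?thesis .
        qed
        moreover have "e / 2 * \<bar>t\<bar> + e / 2 * \<bar>t\<bar> = e * \<bar>t\<bar>" by simp
        ultimately show ?thesis using 1 by linarith
      next
        case True
        have "perturbed_gauge t y \<le> (1 - \<eta>) * inverse_root (t * relative_rate v)" unfolding v(2) using \<eta>(3)[OF True] c0 by (intro mult_right_mono) auto
        also have "\<dots> \<le> (1 - \<eta>) * (1 + C * \<bar>t\<bar>)" using cb[OF t(1) v(1)] \<eta> by (intro mult_left_mono) auto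
        also have "\<dots> \<le> 1 + C * \<bar>t\<bar> - \<eta>" using \<eta> C by (simp add: algebra_simps)
        also have "\<dots> \<le> 1 - M * \<bar>t\<bar>" using t(3) C M by (simp add: field_simps)
        also have "\<dots> \<le> 1 - t * relative_rate \<nu> / p"
        proof -
          have "\<bar>t * relative_rate \<nu> / p\<bar> = \<bar>t * relative_rate \<nu>\<bar> / p" using p by simp
          also have "\<dots> \<le> \<bar>t * relative_rate \<nu>\<bar>" using p by (simp add: divide_le_eq mult_le_cancel_left1)
          also have "\<dots> \<le> M * \<bar>t\<bar>" using M(2)[OF \<nu>(1)] by (simp add: abs_mult mult.commute[of _ "\<bar>t\<bar>"] mult_left_mono)
          finally show ?thesis by linarith
        qed
        finally show ?thesis using e by (simp add: add_increasing2)
      qed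
      have "0 \<le> e * \<bar>t\<bar>" using e by simp
      then show "norm (perturbed_gauge t y - perturbed_gauge 0 y - (- relative_rate \<nu> / p) * (t - 0)) \<le> e * norm (t - 0)"
        unfolding G0 using low up by (simp add: abs_le_iff algebra_simps)
    qed
  qed
  then have "((\<lambda>t. perturbed_gauge t y) has_derivative (\<lambda>t. (- relative_rate \<nu> / p) * t)) (at 0)"
    unfolding has_derivative_at_alt by (auto intro: bounded_linear_mult_right)
  then show ?thesis unfolding \<nu>_def has_field_derivative_def .
qed

lemma norm_bounds_boundary: "\<exists>a b. 0 < a \<and> 0 < b \<and> (\<forall>y. g y = 1 \<longrightarrow> a \<le> norm y \<and> norm y \<le> b)"
proof -
  obtain m C where mC: "0 < m" "0 < C" "\<And>x. m * norm x \<le> g x \<and> g x \<le> C * norm x"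
    using W.gauge_norm_bounds by blast
  have "1 / C \<le> norm y \<and> norm y \<le> 1 / m" if "g y = 1" for y
    using mC(3)[of y] that mC(1,2) by (simp add: field_simps)
  then show ?thesis using mC by (intro exI[of _ "1 / C"] exI[of _ "1 / m"]) auto
qed

lemma radial_density_bound:
  "\<exists>B>0. \<forall>y r. g y = 1 \<longrightarrow> 0 \<le> r \<longrightarrow> r \<le> 2 \<longrightarrow> radial_density q y r \<le> B"
proof -
  obtain a b where ab: "0 < a" "0 < b" "\<And>y. g y = 1 \<Longrightarrow> a \<le> norm y \<and> norm y \<le> b" using norm_bounds_boundary by blast
  define s where "s = q - real CARD('n)"
  define B where "B = real CARD('n) * (a powr s + b powr s) * 2 powr (q - 1)"
  have "radial_density q y r \<le> B" if y: "g y = 1" and r: "0 \<le> r" "r \<le> 2" for y r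
  proof -
    have n: "norm y powr s \<le> a powr s + b powr s"
    proof (cases "0 \<le> s")
      case True
      then have "norm y powr s \<le> b powr s" using ab(3)[OF y] by (intro powr_mono2) auto
      then show ?thesis by (simp add: add_increasing)
    next
      case False
      then have "norm y powr s \<le> a powr s" using ab(1) ab(3)[OF y] by (intro powr_mono2') auto
      then show ?thesis by (simp add: add_increasing2)
    qed
    have le: "r powr (q - 1) * exp (- (r * norm y)\<^sup>2 / 2) \<le> 2 powr (q - 1) * 1"
      using q r by (intro mult_mono powr_mono2) auto
    have "radial_density q y r \<le> real CARD('n) * (a powr s + b powr s) * (2 powr (q - 1) * 1)"
      unfolding radial_density_def s_def[symmetric]
      by (rule mult_mono[OF mult_left_mono[OF n] le]) auto
    then show ?thesis unfolding B_def by simp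
  qed
  moreover have "0 < B" unfolding B_def using ab by (simp add: add_pos_pos)
  ultimately show ?thesis by blast
qed

lemma radial_mass_le:
  assumes B: "\<And>r. 0 \<le> r \<Longrightarrow> r \<le> 2 \<Longrightarrow> radial_density q y r \<le> B" and R: "0 \<le> R" "R \<le> 2"
  shows "radial_mass q y R \<le> B * R"
proof -
  have "radial_mass q y R \<le> integral {0..R} (\<lambda>_. B)"
    unfolding radial_mass_def using B R
    by (intro integral_le integrable_continuous_interval radial_density_continuous[OF q]) auto
  then show ?thesis using R by (simp add: mult.commute)
qed

lemma radial_mass_lipschitz:
  assumes B: "\<And>r. 0 \<le> r \<Longrightarrow> r \<le> 2 \<Longrightarrow> radial_density q y r \<le> B" and R: "1 / 2 \<le> R" "R \<le> 2"
  shows "\<bar>radial_mass q y R - radial_mass q y 1\<bar> \<le> B * \<bar>R - 1\<bar>"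
proof -
  have "norm (radial_mass q y R - radial_mass q y 1) \<le> B * norm (R - 1)"
  proof (rule field_differentiable_bound[of "{1/2..2}" _ "radial_density q y"])
    fix z :: real assume z: "z \<in> {1/2..2}"
    show "(radial_mass q y has_field_derivative radial_density q y z) (at z within {1/2..2})"
      using z by (auto intro: has_field_derivative_at_within[OF radial_mass_deriv[OF q]])
    show "norm (radial_density q y z) \<le> B" using B[of z] z by (simp add: radial_density_nonneg)
  qed (use R in auto)
  then show ?thesis by simp
qed

text \<open>
  Set to zero off the regular boundary in order to be a Borel function on the whole space.
\<close>
definition boundary_rate :: "real^'n \<Rightarrow> real" where
  "boundary_rate y = indicator (regular_boundary K) y * relative_rate (gauss_map K y)"

lemma boundary_rate_measurable [measurable]: "boundary_rate \<in> borel_measurable borel"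
proof -
  have "continuous_on (regular_boundary K) (\<lambda>y. relative_rate (gauss_map K y))"
    by (rule continuous_on_compose2[OF relative_rate_continuous gauss_map_continuous]) (use gauss_map_support in auto)
  then have "(\<lambda>y. indicator (regular_boundary K) y *\<^sub>R relative_rate (gauss_map K y)) \<in> borel_measurable borel"
    by (rule borel_measurable_continuous_on_indicator[OF regular_boundary_measurable])
  then show ?thesis unfolding boundary_rate_def[abs_def] by simp
qed

lemma radial_density_measurable [measurable]: "(\<lambda>y::real^'n. radial_density q y 1) \<in> borel_measurable borel"
  unfolding radial_density_def by measurable

text \<open>
  The integrand of \<open>quermass_formula\<close> is differentiated at every \<open>x\<close> whose boundary point has a unique
  normal; its difference quotients are bounded because the radial mass is Lipschitz in the radius
  and the radius is Lipschitz in \<open>t\<close>.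
\<close>
theorem quermass_derivative:
  "\<exists>\<delta>>0. (\<forall>t. \<bar>t\<bar> < \<delta> \<longrightarrow> (\<forall>v\<in>sphere 0 1. 0 < 1 + t * relative_rate v)) \<and>
    ((\<lambda>t. (gauss_dual_quermass q (wulff_shape (Lp_perturbation p K f t)) - gauss_dual_quermass q K) / t)
      \<longlongrightarrow> (LINT x:K|lborel. radial_density q (boundary_proj x) 1 * (boundary_rate (boundary_proj x) / p))) (at 0)"
proof -
  obtain C d1 where C: "0 < C" and d1: "0 < d1"
    and pos: "\<And>t v. \<bar>t\<bar> < d1 \<Longrightarrow> v \<in> sphere 0 1 \<Longrightarrow> 0 < 1 + t * relative_rate v"
    and Gb: "\<And>t y. \<bar>t\<bar> < d1 \<Longrightarrow> g y = 1 \<Longrightarrow> \<bar>perturbed_gauge t y - 1\<bar> \<le> C * \<bar>t\<bar>"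
    using gauge_perturbation_bound by metis
  obtain B where B: "0 < B" "\<And>y r. g y = 1 \<Longrightarrow> 0 \<le> r \<Longrightarrow> r \<le> 2 \<Longrightarrow> radial_density q y r \<le> B"
    using radial_density_bound by blast
  define \<delta> where "\<delta> = min d1 (1 / (2 * C))"
  have \<delta>: "0 < \<delta>" unfolding \<delta>_def using d1 C by simp
  have G12: "1 / 2 \<le> perturbed_gauge t y" "1 / 2 \<le> 1 / perturbed_gauge t y" "1 / perturbed_gauge t y \<le> 2" "\<bar>1 / perturbed_gauge t y - 1\<bar> \<le> 2 * C * \<bar>t\<bar>"
    if t: "\<bar>t\<bar> < \<delta>" and y: "g y = 1" for t y
  proof -
    have 1: "\<bar>perturbed_gauge t y - 1\<bar> \<le> C * \<bar>t\<bar>" using Gb t y unfolding \<delta>_def by simp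
    have "C * \<bar>t\<bar> \<le> 1 / 2" using t C unfolding \<delta>_def by (simp add: field_simps)
    then have 2: "1 / 2 \<le> perturbed_gauge t y" "perturbed_gauge t y \<le> 2" using 1 by linarith+
    then show "1 / 2 \<le> perturbed_gauge t y" "1 / 2 \<le> 1 / perturbed_gauge t y" "1 / perturbed_gauge t y \<le> 2" by (auto simp: field_simps)
    have "\<bar>1 / perturbed_gauge t y - 1\<bar> = \<bar>perturbed_gauge t y - 1\<bar> / perturbed_gauge t y" using 2 by (simp add: field_simps abs_if)
    also have "\<dots> \<le> \<bar>perturbed_gauge t y - 1\<bar> / (1 / 2)" using 2 by (intro divide_left_mono) auto
    finally show "\<bar>1 / perturbed_gauge t y - 1\<bar> \<le> 2 * C * \<bar>t\<bar>" using 1 by simp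
  qed
  define \<Phi> where "\<Phi> = (\<lambda>t x. radial_mass q (boundary_proj x) (1 / perturbed_gauge t (boundary_proj x)))"
  define \<Phi>0 where "\<Phi>0 = (\<lambda>x. radial_mass q (boundary_proj x) (1 / g (boundary_proj x)))"
  have wf: "wulff_function (Lp_perturbation p K f t)" if "\<bar>t\<bar> < \<delta>" for t
    using perturbation_wulff pos that unfolding \<delta>_def by simp
  have m [measurable]: "\<Phi> t \<in> borel_measurable borel" if "\<bar>t\<bar> < \<delta>" for t
    using quermass_measurable[OF wf[OF that] q] unfolding \<Phi>_def perturbed_gauge_def .
  have m0 [measurable]: "\<Phi>0 \<in> borel_measurable borel"
    using quermass_measurable[OF W.wulff_function_axioms q] unfolding \<Phi>0_def .
  have V: "gauss_dual_quermass q (wulff_shape (Lp_perturbation p K f t)) = (LINT x:K|lborel. \<Phi> t x)" if "\<bar>t\<bar> < \<delta>" for t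
    using quermass_formula[OF wf[OF that] q] unfolding \<Phi>_def perturbed_gauge_def .
  have V0: "gauss_dual_quermass q K = (LINT x:K|lborel. \<Phi>0 x)"
    using quermass_formula[OF W.wulff_function_axioms q] unfolding \<Phi>0_def wulff_shape_support_fun .
  have AE0: "AE x in lborel. x \<noteq> (0::real^'n)" by (rule AE_lborel_singleton)
  have fin: "emeasure lborel K < \<infinity>" by (rule emeasure_bounded_finite[OF compact_imp_bounded[OF compact_K]])
  have int_const: "integrable lborel (\<lambda>x. indicator K x * D)" for D :: real
    using fin by (intro integrable_mult_left integrable_real_indicator) auto
  have int: "integrable lborel (\<lambda>x. indicator K x * \<Phi> t x)" if t: "\<bar>t\<bar> < \<delta>" for t
  proof (rule Bochner_Integration.integrable_bound[OF int_const[of "B * 2"]])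
    show "(\<lambda>x. indicator K x * \<Phi> t x) \<in> borel_measurable lborel" using m[OF t] by simp
    show "AE x in lborel. norm (indicator K x * \<Phi> t x) \<le> norm (indicator K x * (B * 2))"
      using AE0
    proof eventually_elim
      case (elim x)
      have gp: "g (boundary_proj x) = 1" using gauge_proj[OF elim] .
      have "\<Phi> t x \<le> B * (1 / perturbed_gauge t (boundary_proj x))"
        unfolding \<Phi>_def using G12[OF t gp] B(2)[OF gp] by (intro radial_mass_le) auto
      also have "\<dots> \<le> B * 2" using G12[OF t gp] B(1) by (intro mult_left_mono) auto
      finally have "\<Phi> t x \<le> B * 2" .
      moreover have "0 \<le> \<Phi> t x" unfolding \<Phi>_def by (rule radial_mass_nonneg[OF q])
      ultimately show ?case using B(1) by (auto simp: indicator_def)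
    qed
  qed
  have int0: "integrable lborel (\<lambda>x. indicator K x * \<Phi>0 x)"
  proof (rule Bochner_Integration.integrable_bound[OF int_const[of "B * 1"]])
    show "(\<lambda>x. indicator K x * \<Phi>0 x) \<in> borel_measurable lborel" using m0 by simp
    show "AE x in lborel. norm (indicator K x * \<Phi>0 x) \<le> norm (indicator K x * (B * 1))"
      using AE0
    proof eventually_elim
      case (elim x)
      have gp: "g (boundary_proj x) = 1" using gauge_proj[OF elim] .
      have "\<Phi>0 x \<le> B * 1" unfolding \<Phi>0_def gp using B(2)[OF gp] by (intro order_trans[OF radial_mass_le]) auto
      moreover have "0 \<le> \<Phi>0 x" unfolding \<Phi>0_def by (rule radial_mass_nonneg[OF q])
      ultimately show ?case using B(1) by (auto simp: indicator_def)
    qed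
  qed
  define L where "L = (\<lambda>x. indicator K x * (radial_density q (boundary_proj x) 1 * (boundary_rate (boundary_proj x) / p)))"
  have Lm [measurable]: "L \<in> borel_measurable borel" unfolding L_def by measurable
  have lim: "((\<lambda>t. (gauss_dual_quermass q (wulff_shape (Lp_perturbation p K f t)) - gauss_dual_quermass q K) / t)
      \<longlongrightarrow> (LINT x|lborel. L x)) (at 0)"
    unfolding tendsto_at_iff_sequentially
  proof (intro allI impI)
    fix X :: "nat \<Rightarrow> real" assume X: "\<forall>i. X i \<in> UNIV - {0}" "X \<longlonglongrightarrow> 0"
    obtain N where N: "\<And>i. i \<ge> N \<Longrightarrow> \<bar>X i\<bar> < \<delta>"
      using LIMSEQ_D[OF X(2) \<delta>] by auto
    \<comment> \<open>the majorant is valid only for \<open>\<bar>t\<bar> < \<delta>\<close>, so the first terms are skipped\<close>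
    define Y where "Y = (\<lambda>i. X (i + N))"
    have Y: "Y i \<noteq> 0" "\<bar>Y i\<bar> < \<delta>" for i unfolding Y_def using X(1) N by auto
    have Y0: "Y \<longlonglongrightarrow> 0" unfolding Y_def using X(2) by (rule LIMSEQ_ignore_initial_segment)
    define s where "s = (\<lambda>i x. indicator K x * ((\<Phi> (Y i) x - \<Phi>0 x) / Y i))"
    have sm: "s i \<in> borel_measurable borel" for i
      using m[OF Y(2)[of i]] m0 unfolding s_def by measurable
    have eq: "(LINT x|lborel. s i x) = (gauss_dual_quermass q (wulff_shape (Lp_perturbation p K f (Y i))) - gauss_dual_quermass q K) / Y i" for i
    proof -
      have "s i = (\<lambda>x. (indicator K x * \<Phi> (Y i) x - indicator K x * \<Phi>0 x) / Y i)"
        unfolding s_def by (auto simp: fun_eq_iff right_diff_distrib)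
      then have "(LINT x|lborel. s i x) = ((LINT x|lborel. indicator K x * \<Phi> (Y i) x) - (LINT x|lborel. indicator K x * \<Phi>0 x)) / Y i"
        using int[OF Y(2)[of i]] int0 by simp
      then show ?thesis unfolding V[OF Y(2)] V0 set_lebesgue_integral_def by simp
    qed
    have "(\<lambda>i. LINT x|lborel. s i x) \<longlonglongrightarrow> (LINT x|lborel. L x)"
    proof (rule integral_dominated_convergence[where w = "\<lambda>x. indicator K x * (B * (2 * C))"])
      show "L \<in> borel_measurable lborel" "s i \<in> borel_measurable lborel" for i using Lm sm by auto
      show "integrable lborel (\<lambda>x. indicator K x * (B * (2 * C)))" by (rule int_const)
      show "AE x in lborel. norm (s i x) \<le> indicator K x * (B * (2 * C))" for i
        using AE0
      proof eventually_elim
        case (elim x)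
        have gp: "g (boundary_proj x) = 1" using gauge_proj[OF elim] .
        have "\<bar>\<Phi> (Y i) x - \<Phi>0 x\<bar> \<le> B * \<bar>1 / perturbed_gauge (Y i) (boundary_proj x) - 1\<bar>"
          unfolding \<Phi>_def \<Phi>0_def gp div_by_1
          using G12[OF Y(2) gp] B(2)[OF gp] by (intro radial_mass_lipschitz) auto
        also have "\<dots> \<le> B * (2 * C * \<bar>Y i\<bar>)" using G12[OF Y(2) gp] B(1) by (intro mult_left_mono) auto
        finally have "\<bar>(\<Phi> (Y i) x - \<Phi>0 x) / Y i\<bar> \<le> B * (2 * C)"
          using Y(1)[of i] by (simp add: divide_le_eq mult_ac)
        then show ?case unfolding s_def by (auto simp: indicator_def)
      qed
      show "AE x in lborel. (\<lambda>i. s i x) \<longlonglongrightarrow> L x"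
        using AE0 AE_proj_regular
      proof eventually_elim
        case (elim x)
        have gp: "g (boundary_proj x) = 1" using gauge_proj[OF elim(1)] .
        define y where "y = boundary_proj x"
        have G0: "perturbed_gauge 0 y = 1" using Gb[of 0 y] d1 gp y_def by simp
        have D1: "((\<lambda>t. 1 / perturbed_gauge t y) has_real_derivative relative_rate (gauss_map K y) / p) (at 0)"
          using gauge_perturbation_deriv[OF elim(2)] unfolding y_def[symmetric]
          by (auto intro!: derivative_eq_intros simp: G0)
        have "((\<lambda>t. radial_mass q y (1 / perturbed_gauge t y)) has_real_derivative radial_density q y 1 * (relative_rate (gauss_map K y) / p)) (at 0)"
          by (rule DERIV_chain2[OF _ D1]) (use radial_mass_deriv[OF q, of 1 y] G0 in simp)
        then have "((\<lambda>t. (radial_mass q y (1 / perturbed_gauge (0 + t) y) - radial_mass q y (1 / perturbed_gauge 0 y)) / t) \<longlongrightarrow> radial_density q y 1 * (relative_rate (gauss_map K y) / p)) (at 0)"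
          unfolding DERIV_def .
        then have "((\<lambda>t. (\<Phi> t x - \<Phi>0 x) / t) \<longlongrightarrow> radial_density q y 1 * (relative_rate (gauss_map K y) / p)) (at 0)"
          unfolding \<Phi>_def \<Phi>0_def gp unfolding y_def[symmetric] G0 by simp
        then have "(\<lambda>i. (\<Phi> (Y i) x - \<Phi>0 x) / Y i) \<longlonglongrightarrow> radial_density q y 1 * (relative_rate (gauss_map K y) / p)"
          unfolding tendsto_at_iff_sequentially using Y(1) Y0 by (simp add: o_def)
        then have "(\<lambda>i. s i x) \<longlonglongrightarrow> indicator K x * (radial_density q y 1 * (relative_rate (gauss_map K y) / p))"
          unfolding s_def by (intro tendsto_mult tendsto_const)
        then show ?case unfolding L_def y_def boundary_rate_def using elim(2) by simp
      qed
    qed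
    then have "(\<lambda>i. ((\<lambda>t. (gauss_dual_quermass q (wulff_shape (Lp_perturbation p K f t)) - gauss_dual_quermass q K) / t) \<circ> X) (i + N)) \<longlonglongrightarrow> (LINT x|lborel. L x)"
      unfolding eq Y_def o_def .
    then show "((\<lambda>t. (gauss_dual_quermass q (wulff_shape (Lp_perturbation p K f t)) - gauss_dual_quermass q K) / t) \<circ> X) \<longlonglongrightarrow> (LINT x|lborel. L x)"
      by (rule LIMSEQ_offset)
  qed
  have "(LINT x:K|lborel. radial_density q (boundary_proj x) 1 * (boundary_rate (boundary_proj x) / p)) = (LINT x|lborel. L x)"
    unfolding set_lebesgue_integral_def L_def by simp
  then show ?thesis using lim \<delta> pos unfolding \<delta>_def by (intro exI[of _ \<delta>]) (auto simp: \<delta>_def)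
qed

end

section \<open>Cone measure and surface measure on the boundary\<close>

text \<open>
  By Lindelof's theorem countably many of the neighbourhoods for a fixed \<open>c\<close> cover \<open>B\<close>; made
  disjoint, they give the inequality up to the factor \<open>c\<close>, and \<open>c\<close> may tend to one.
\<close>
lemma emeasure_le_of_locally_almost_le:
  fixes M N :: "'a::second_countable_topology measure"
  assumes sets: "sets M = sets borel" "sets N = sets borel" and B: "B \<in> sets borel"
    and loc: "\<And>c x. 1 < c \<Longrightarrow> x \<in> B \<Longrightarrow>
      \<exists>U. open U \<and> x \<in> U \<and> (\<forall>E\<in>sets borel. E \<subseteq> U \<inter> B \<longrightarrow> emeasure M E \<le> ennreal c * emeasure N E)"
    and E: "E \<in> sets borel" "E \<subseteq> B"
  shows "emeasure M E \<le> emeasure N E"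
proof -
  have almost: "emeasure M E \<le> ennreal c * emeasure N E" if c: "1 < c" for c :: real
  proof (cases "B = {}")
    case True
    then show ?thesis using E by simp
  next
    case False
    define \<F> where "\<F> = {U. open U \<and> (\<forall>E\<in>sets borel. E \<subseteq> U \<inter> B \<longrightarrow> emeasure M E \<le> ennreal c * emeasure N E)}"
    obtain \<G> where \<G>: "\<G> \<subseteq> \<F>" "countable \<G>" "\<Union>\<G> = \<Union>\<F>"
      using Lindelof[of \<F>] unfolding \<F>_def by blast
    have cov: "B \<subseteq> \<Union>\<G>" unfolding \<G>(3) \<F>_def using loc[OF c] by blast
    then have Gne: "\<G> \<noteq> {}" using False by auto
    define V where "V = from_nat_into \<G>"
    have V: "V i \<in> \<F>" for i unfolding V_def using from_nat_into[OF Gne] \<G>(1) by blast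
    have rV: "range V = \<G>" unfolding V_def by (rule range_from_nat_into[OF Gne \<G>(2)])
    define A where "A = (\<lambda>i. E \<inter> disjointed V i)"
    have Vb: "V i \<in> sets borel" for i using V[of i] unfolding \<F>_def by auto
    then have "disjointed V i \<in> sets borel" for i unfolding disjointed_def by (intro sets.Diff sets.finite_UN) auto
    then have Ab: "A i \<in> sets borel" for i unfolding A_def using E by auto
    have disj: "disjoint_family A" unfolding A_def using disjoint_family_disjointed[of V]
      by (auto simp: disjoint_family_on_def)
    have "(\<Union>i. A i) = E \<inter> (\<Union>i. disjointed V i)" unfolding A_def by auto
    also have "\<dots> = E" unfolding UN_disjointed_eq using rV cov E by auto
    finally have UA: "(\<Union>i. A i) = E" .
    have Ale: "emeasure M (A i) \<le> ennreal c * emeasure N (A i)" for i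
    proof -
      have "A i \<subseteq> V i \<inter> B" unfolding A_def using disjointed_subset[of V i] E by auto
      then show ?thesis using V[of i] Ab[of i] unfolding \<F>_def by blast
    qed
    have "emeasure M E = (\<Sum>i. emeasure M (A i))"
      using suminf_emeasure[of A M] Ab disj UA sets by (simp add: image_subset_iff)
    also have "\<dots> \<le> (\<Sum>i. ennreal c * emeasure N (A i))" by (intro suminf_le Ale) auto
    also have "\<dots> = ennreal c * (\<Sum>i. emeasure N (A i))" by simp
    also have "(\<Sum>i. emeasure N (A i)) = emeasure N E"
      using suminf_emeasure[of A N] Ab disj UA sets by (simp add: image_subset_iff)
    finally show ?thesis .
  qed
  show ?thesis
  proof (rule ennreal_le_epsilon)
    fix e :: real assume e: "0 < e" and "emeasure N E < top"
    then obtain r where r: "emeasure N E = ennreal r" "0 \<le> r" by (cases "emeasure N E" rule: ennreal_cases) auto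
    have "emeasure M E \<le> ennreal (1 + e / (r + 1)) * ennreal r"
      using almost[of "1 + e / (r + 1)"] e r by simp
    also have "\<dots> = ennreal ((1 + e / (r + 1)) * r)" using e r by (simp add: ennreal_mult'')
    also have "\<dots> \<le> ennreal (r + e)"
    proof (rule ennreal_leI)
      have "e / (r + 1) * r \<le> e" using e r by (simp add: field_simps)
      then show "(1 + e / (r + 1)) * r \<le> r + e" by (simp add: algebra_simps)
    qed
    finally show "emeasure M E \<le> emeasure N E + ennreal e" using e r by simp
  qed
qed

context convex_body_o begin

definition boundary_cone :: "(real^'n) set \<Rightarrow> (real^'n) set" where
  "boundary_cone E = {x \<in> K. boundary_proj x \<in> E}"

lemma boundary_cone_measurable [measurable]:
  assumes "E \<in> sets borel" shows "boundary_cone E \<in> sets borel"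
proof -
  have "boundary_cone E = K \<inter> (boundary_proj -` E \<inter> space borel)" unfolding boundary_cone_def by auto
  then show ?thesis using assms measurable_sets[OF proj_measurable assms] by auto
qed

lemma proj_scale: "0 < a \<Longrightarrow> boundary_proj (a *\<^sub>R x) = boundary_proj x"
  unfolding boundary_proj_def using W.gauge_scale[of a x] by simp

lemma proj_boundary: "g x = 1 \<Longrightarrow> boundary_proj x = x"
  unfolding boundary_proj_def by simp

text \<open>
  All normals at boundary points close to \<open>y0\<close> are close to \<open>\<nu>\<close>. Using such normals at both ends of a
  chord from \<open>x\<close> to \<open>y\<close> shows that \<open>\<nu> \<bullet> (x - y)\<close> is small compared with \<open>norm (x - y)\<close>.
  Therefore the radial projection \<open>\<pi>\<close> to the tangent hyperplane at \<open>y0\<close> is bi-Lipschitz with constant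
  \<open>L\<close>, and it rescales rays by factors between \<open>1 / L\<close> and \<open>L\<close>. Both the Hausdorff measure of a
  piece \<open>E\<close> and the volume of the cone over it are thus comparable to those of the flat piece
  \<open>\<pi> ` E\<close>, for which the relation is exact.
\<close>
lemma cone_measure_locally_almost_hausdorff:
  assumes y0: "y0 \<in> regular_boundary K" and L: "1 < L"
  defines "\<nu> \<equiv> gauss_map K y0" and "k \<equiv> CARD('n) - 1"
  shows "\<exists>r>0. (\<forall>x\<in>regular_boundary K \<inter> ball y0 r. h \<nu> \<le> L * (x \<bullet> gauss_map K x) \<and> x \<bullet> gauss_map K x \<le> L * h \<nu>) \<and>
    (\<forall>E\<in>sets borel. E \<subseteq> ball y0 r \<inter> {x. g x = 1} \<longrightarrow>
      of_nat CARD('n) * emeasure lborel (boundary_cone E) \<le> ennreal (L ^ (2 * CARD('n))) * (ennreal (h \<nu>) * hausdorff_outer k E) \<and>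
      ennreal (h \<nu>) * hausdorff_outer k E \<le> ennreal (L ^ (2 * CARD('n))) * (of_nat CARD('n) * emeasure lborel (boundary_cone E)))"
proof -
  let ?n = "CARD('n)"
  define h0 where "h0 = h \<nu>"
  have gy0: "g y0 = 1" using y0 regular_boundary_iff by blast
  have \<nu>: "\<nu> \<in> sphere 0 1" "y0 \<bullet> \<nu> = h0" using gauss_map_support[OF y0] unfolding \<nu>_def h0_def by auto
  have n\<nu>: "norm \<nu> = 1" using \<nu> by simp
  have h0: "0 < h0" unfolding h0_def using W.pos[OF \<nu>(1)] .
  have L0: "0 < L" using L by simp
  \<comment> \<open>half of the room between 1 and \<open>L\<close> is for the ray factor \<open>a\<close>, half for its variation\<close>
  define \<kappa> where "\<kappa> = (1 - 1 / L) / 2"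
  have \<kappa>: "0 < \<kappa>" "1 - 2 * \<kappa> = 1 / L" "1 + 2 * \<kappa> \<le> L" "\<kappa> \<le> 1 / 2"
  proof -
    show "0 < \<kappa>" "1 - 2 * \<kappa> = 1 / L" unfolding \<kappa>_def using L by (auto simp: field_simps)
    have "0 \<le> (L - 1)\<^sup>2" by simp
    then have "2 * L \<le> L * L + 1" by (simp add: power2_eq_square algebra_simps)
    then show "1 + 2 * \<kappa> \<le> L" unfolding \<kappa>_def using L by (simp add: field_simps)
    show "\<kappa> \<le> 1 / 2" unfolding \<kappa>_def using L by (simp add: field_simps)
  qed
  define M where "M = norm y0 + 1"
  have M: "0 < M" unfolding M_def by (simp add: add_nonneg_pos)
  \<comment> \<open>the factor \<open>a\<close> below has Lipschitz constant at most \<open>4 \<eta> / h0\<close> on the boundary near \<open>y0\<close>, where \<open>norm y \<le> M\<close>\<close>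
  define \<eta> where "\<eta> = \<kappa> * h0 / (4 * M)"
  have \<eta>: "0 < \<eta>" "4 * \<eta> * M = \<kappa> * h0" unfolding \<eta>_def using \<kappa> h0 M by auto
  obtain r0 where r0: "0 < r0" "\<And>x v. dist x y0 < r0 \<Longrightarrow> g x = 1 \<Longrightarrow> outer_unit_normal K x v \<Longrightarrow> dist v \<nu> < \<eta>"
    using normals_near_regular[OF y0 \<eta>(1)] unfolding \<nu>_def by blast
  define r where "r = min r0 (min 1 (\<kappa> * h0 / 2))"
  have r: "0 < r" "r \<le> r0" "r \<le> 1" "r \<le> \<kappa> * h0 / 2" unfolding r_def using r0 \<kappa> h0 by auto
  have normx: "norm x \<le> M" if "x \<in> ball y0 r" for x
    using that r norm_triangle_ineq2[of x y0] unfolding M_def by (simp add: dist_norm norm_minus_commute)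
  have \<nu>x: "\<bar>\<nu> \<bullet> x - h0\<bar> \<le> \<kappa> * h0 / 2" "h0 / 2 \<le> \<nu> \<bullet> x" if "x \<in> ball y0 r" for x
  proof -
    have "\<bar>\<nu> \<bullet> (x - y0)\<bar> \<le> norm (x - y0)" using Cauchy_Schwarz_ineq2[of \<nu> "x - y0"] n\<nu> by simp
    then have "\<bar>\<nu> \<bullet> x - h0\<bar> \<le> r" using that \<nu>(2) by (simp add: inner_diff_right inner_commute[of y0] dist_norm norm_minus_commute)
    then show "\<bar>\<nu> \<bullet> x - h0\<bar> \<le> \<kappa> * h0 / 2" using r(4) by linarith
    moreover have "\<kappa> * h0 \<le> (1 / 2) * h0" using \<kappa>(4) h0 by (intro mult_right_mono) auto
    ultimately show "h0 / 2 \<le> \<nu> \<bullet> x" using h0 by linarith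
  qed
  \<comment> \<open>the factor that moves \<open>x\<close> along its ray to the tangent hyperplane at \<open>y0\<close>\<close>
  define a where "a = (\<lambda>x. h0 / (\<nu> \<bullet> x))"
  have ax: "1 - \<kappa> \<le> a x" "a x \<le> 1 + \<kappa>" "1 / L \<le> a x" "a x \<le> L" "0 < a x" if x: "x \<in> ball y0 r" for x
  proof -
    have pos: "0 < \<nu> \<bullet> x" using \<nu>x(2)[OF x] h0 by linarith
    have "\<kappa> * (h0 / 2) \<le> \<kappa> * (\<nu> \<bullet> x)" using \<nu>x(2)[OF x] \<kappa> by (intro mult_left_mono) auto
    then have "\<bar>h0 - \<nu> \<bullet> x\<bar> \<le> \<kappa> * (\<nu> \<bullet> x)" using \<nu>x(1)[OF x] by (simp add: abs_minus_commute)
    then show 1: "1 - \<kappa> \<le> a x" "a x \<le> 1 + \<kappa>" unfolding a_def using pos by (auto simp: field_simps abs_le_iff)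
    show "1 / L \<le> a x" "a x \<le> L" "0 < a x" using 1 \<kappa> by linarith+
  qed
  have flat: "\<bar>\<nu> \<bullet> (x - y)\<bar> \<le> \<eta> * norm (x - y)"
    if x: "x \<in> ball y0 r" "g x = 1" and y: "y \<in> ball y0 r" "g y = 1" for x y
  proof -
    have half: "\<nu> \<bullet> (z - w) \<le> \<eta> * norm (z - w)" if z: "z \<in> ball y0 r" "g z = 1" and w: "w \<in> ball y0 r" "g w = 1" for z w
    proof -
      obtain v where v: "outer_unit_normal K w v" using outer_unit_normal_exists[OF w(2)] by blast
      have "dist v \<nu> < \<eta>" using r0(2)[OF _ w(2) v] w(1) r(2) by (simp add: dist_commute)
      moreover have "z \<in> K" using z(2) by (simp add: K_iff)
      then have "v \<bullet> (z - w) \<le> 0" using v unfolding outer_unit_normal_def by blast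
      moreover have "(\<nu> - v) \<bullet> (z - w) \<le> norm (\<nu> - v) * norm (z - w)" by (rule norm_cauchy_schwarz)
      moreover have "norm (\<nu> - v) * norm (z - w) \<le> \<eta> * norm (z - w)"
        using \<open>dist v \<nu> < \<eta>\<close> by (intro mult_right_mono) (auto simp: dist_norm norm_minus_commute)
      ultimately show ?thesis by (simp add: inner_diff_left)
    qed
    show ?thesis
      using half[OF x y] half[OF y x] by (simp add: abs_le_iff norm_minus_commute inner_diff_right)
  qed
  define \<pi> where "\<pi> = (\<lambda>x. a x *\<^sub>R x)"
  have \<pi>xy: "norm (\<pi> x - \<pi> y) \<le> L * norm (x - y)" "norm (x - y) \<le> L * norm (\<pi> x - \<pi> y)"
    if x: "x \<in> ball y0 r" "g x = 1" and y: "y \<in> ball y0 r" "g y = 1" for x y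
  proof -
    have px: "0 < \<nu> \<bullet> x" "0 < \<nu> \<bullet> y" using \<nu>x(2)[OF x(1)] \<nu>x(2)[OF y(1)] h0 by linarith+
    have "a x - a y = h0 * (\<nu> \<bullet> (y - x)) / ((\<nu> \<bullet> x) * (\<nu> \<bullet> y))"
      unfolding a_def using px by (simp add: field_simps inner_diff_right)
    then have "\<bar>a x - a y\<bar> = h0 * \<bar>\<nu> \<bullet> (y - x)\<bar> / ((\<nu> \<bullet> x) * (\<nu> \<bullet> y))"
      using px h0 by (simp add: abs_mult)
    also have "\<dots> \<le> h0 * (\<eta> * norm (y - x)) / ((h0 / 2) * (h0 / 2))"
      using px h0 \<eta> \<nu>x(2)[OF x(1)] \<nu>x(2)[OF y(1)] flat[OF y x]
      by (intro frac_le mult_mono mult_nonneg_nonneg) auto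
    also have "\<dots> = 4 * \<eta> / h0 * norm (x - y)" using h0 by (simp add: field_simps norm_minus_commute)
    finally have da: "\<bar>a x - a y\<bar> \<le> 4 * \<eta> / h0 * norm (x - y)" .
    have dec: "\<pi> x - \<pi> y = a x *\<^sub>R (x - y) + (a x - a y) *\<^sub>R y" unfolding \<pi>_def by (simp add: algebra_simps)
    have "norm ((a x - a y) *\<^sub>R y) \<le> 4 * \<eta> / h0 * norm (x - y) * M"
      unfolding norm_scaleR real_norm_def
      by (rule mult_mono[OF da normx[OF y(1)]]) (use \<eta> h0 in auto)
    also have "\<dots> = (4 * \<eta> * M) / h0 * norm (x - y)" by simp
    also have "\<dots> = \<kappa> * norm (x - y)" unfolding \<eta>(2) using h0 by simp
    finally have err: "norm ((a x - a y) *\<^sub>R y) \<le> \<kappa> * norm (x - y)" .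
    have main: "norm (a x *\<^sub>R (x - y)) = a x * norm (x - y)" using ax(5)[OF x(1)] by simp
    have up: "a x * norm (x - y) \<le> (1 + \<kappa>) * norm (x - y)" using ax(2)[OF x(1)] by (intro mult_right_mono) auto
    have low: "(1 - \<kappa>) * norm (x - y) \<le> a x * norm (x - y)" using ax(1)[OF x(1)] by (intro mult_right_mono) auto
    have "norm (\<pi> x - \<pi> y) \<le> (1 + \<kappa>) * norm (x - y) + \<kappa> * norm (x - y)"
      unfolding dec using norm_triangle_ineq[of "a x *\<^sub>R (x - y)" "(a x - a y) *\<^sub>R y"] err main up by linarith
    also have "\<dots> = (1 + 2 * \<kappa>) * norm (x - y)" by (simp add: algebra_simps)
    also have "\<dots> \<le> L * norm (x - y)" using \<kappa>(3) by (intro mult_right_mono) auto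
    finally show "norm (\<pi> x - \<pi> y) \<le> L * norm (x - y)" .
    have "(1 - \<kappa>) * norm (x - y) - \<kappa> * norm (x - y) \<le> norm (\<pi> x - \<pi> y)"
      unfolding dec using norm_diff_ineq[of "a x *\<^sub>R (x - y)" "(a x - a y) *\<^sub>R y"] err main low by linarith
    then have "(1 - 2 * \<kappa>) * norm (x - y) \<le> norm (\<pi> x - \<pi> y)" by (simp add: algebra_simps)
    then have "1 / L * norm (x - y) \<le> norm (\<pi> x - \<pi> y)" unfolding \<kappa>(2) .
    then show "norm (x - y) \<le> L * norm (\<pi> x - \<pi> y)" using L0 by (simp add: field_simps)
  qed
  have gauss_near: "h0 \<le> L * (x \<bullet> gauss_map K x)" "x \<bullet> gauss_map K x \<le> L * h0" if x: "x \<in> regular_boundary K" "x \<in> ball y0 r" for x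
  proof -
    have gx: "g x = 1" using x(1) regular_boundary_iff by blast
    have "dist (gauss_map K x) \<nu> < \<eta>"
      using r0(2)[OF _ gx gauss_map_normal[OF x(1)]] x(2) r(2) by (simp add: dist_commute)
    then have "norm x * norm (gauss_map K x - \<nu>) \<le> M * \<eta>"
      using normx[OF x(2)] M by (intro mult_mono) (auto simp: dist_norm)
    moreover have "\<bar>x \<bullet> (gauss_map K x - \<nu>)\<bar> \<le> norm x * norm (gauss_map K x - \<nu>)" by (rule Cauchy_Schwarz_ineq2)
    moreover have "4 * (M * \<eta>) = \<kappa> * h0" using \<eta>(2) by (simp add: mult_ac)
    ultimately have "\<bar>x \<bullet> gauss_map K x - \<nu> \<bullet> x\<bar> \<le> \<kappa> * h0 / 4" by (simp add: inner_diff_right inner_commute[of x \<nu>])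
    then have d: "\<bar>x \<bullet> gauss_map K x - h0\<bar> \<le> \<kappa> * h0"
    proof -
      have "0 < \<kappa> * h0" using \<kappa>(1) h0 by simp
      then show ?thesis using \<open>\<bar>x \<bullet> gauss_map K x - \<nu> \<bullet> x\<bar> \<le> \<kappa> * h0 / 4\<close> \<nu>x(1)[OF x(2)] by linarith
    qed
    have "x \<bullet> gauss_map K x \<le> (1 + \<kappa>) * h0" using d by (simp add: algebra_simps abs_le_iff)
    also have "\<dots> \<le> L * h0" using \<kappa> h0 by (intro mult_right_mono) auto
    finally show "x \<bullet> gauss_map K x \<le> L * h0" .
    have "1 / L * h0 \<le> (1 - \<kappa>) * h0" using \<kappa> h0 by (intro mult_right_mono) auto
    also have "\<dots> \<le> x \<bullet> gauss_map K x" using d by (simp add: algebra_simps abs_le_iff)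
    finally show "h0 \<le> L * (x \<bullet> gauss_map K x)" using L0 by (simp add: field_simps)
  qed
  have meas: "of_nat ?n * emeasure lborel (boundary_cone E) \<le> ennreal (L ^ (2 * ?n)) * (ennreal h0 * hausdorff_outer k E) \<and>
      ennreal h0 * hausdorff_outer k E \<le> ennreal (L ^ (2 * ?n)) * (of_nat ?n * emeasure lborel (boundary_cone E))"
    if E: "E \<in> sets borel" "E \<subseteq> ball y0 r \<inter> {x. g x = 1}" for E
  proof -
    define F where "F = {z. \<nu> \<bullet> z = h0} \<inter> (boundary_proj -` E \<inter> space borel)"
    have Fb: "F \<in> sets borel" unfolding F_def
      by (intro sets.Int measurable_sets[OF proj_measurable E(1)]) measurable
    have Fh: "F \<subseteq> {z. \<nu> \<bullet> z = h0}" unfolding F_def by auto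
    have \<pi>E: "g (\<pi> x) = a x" "boundary_proj (\<pi> x) = x" "\<nu> \<bullet> \<pi> x = h0" if "x \<in> E" for x
    proof -
      have x: "x \<in> ball y0 r" "g x = 1" using that E by auto
      show "g (\<pi> x) = a x" unfolding \<pi>_def using W.gauge_scale[of "a x" x] ax(5)[OF x(1)] x(2) by simp
      show "boundary_proj (\<pi> x) = x" unfolding \<pi>_def using proj_scale[OF ax(5)[OF x(1)]] proj_boundary[OF x(2)] by simp
      have "0 < \<nu> \<bullet> x" using \<nu>x(2)[OF x(1)] h0 by linarith
      then show "\<nu> \<bullet> \<pi> x = h0" unfolding \<pi>_def a_def by simp
    qed
    have F\<pi>: "F = \<pi> ` E"
    proof (intro set_eqI iffI)
      fix z assume z: "z \<in> F"
      define x where "x = boundary_proj z"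
      have x: "x \<in> E" "\<nu> \<bullet> z = h0" using z unfolding F_def x_def by auto
      have z0: "z \<noteq> 0" using x(2) h0 by auto
      have gz: "0 < g z" using W.gauge_pos[OF z0] .
      have zx: "z = g z *\<^sub>R x" unfolding x_def boundary_proj_def using gz by simp
      then have eq: "h0 = g z * (\<nu> \<bullet> x)" using x(2) by (metis inner_scaleR_right)
      have "0 < \<nu> \<bullet> x" using \<nu>x(2)[of x] x(1) E(2) h0 by fastforce
      then have "g z = a x" unfolding a_def using eq by (simp add: field_simps)
      then have "z = \<pi> x" unfolding \<pi>_def using zx by simp
      then show "z \<in> \<pi> ` E" using x(1) by blast
    next
      fix z assume "z \<in> \<pi> ` E"
      then show "z \<in> F" using \<pi>E unfolding F_def by auto
    qed
    have E\<pi>: "E = boundary_proj ` F" unfolding F\<pi> image_image using \<pi>E(2) by simp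
    have Ein: "x \<in> ball y0 r" "g x = 1" if "x \<in> E" for x using that E(2) by auto
    have HF: "hausdorff_outer k F \<le> ennreal (L ^ k) * hausdorff_outer k E"
      unfolding F\<pi>
    proof (rule hausdorff_outer_lipschitz_image[OF L0])
      fix x y assume "x \<in> E" "y \<in> E"
      then show "dist (\<pi> x) (\<pi> y) \<le> L * dist x y"
        unfolding dist_norm by (intro \<pi>xy(1) Ein)
    qed
    have HE: "hausdorff_outer k E \<le> ennreal (L ^ k) * hausdorff_outer k F"
    proof -
      have "hausdorff_outer k (boundary_proj ` F) \<le> ennreal (L ^ k) * hausdorff_outer k F"
      proof (rule hausdorff_outer_lipschitz_image[OF L0])
        fix z w assume "z \<in> F" "w \<in> F"
        then obtain x y where xy: "x \<in> E" "y \<in> E" "z = \<pi> x" "w = \<pi> y" unfolding F\<pi> by auto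
        show "dist (boundary_proj z) (boundary_proj w) \<le> L * dist z w"
          unfolding xy(3,4) \<pi>E(2)[OF xy(1)] \<pi>E(2)[OF xy(2)] dist_norm by (intro \<pi>xy(2) Ein xy(1,2))
      qed
      then show ?thesis using E\<pi> by simp
    qed
    define Q where "Q = cone_below \<nu> h0 F"
    have Qb: "Q \<in> sets borel" unfolding Q_def by (rule cone_below_measurable[OF Fb])
    have Qiff: "x \<in> Q \<longleftrightarrow> 0 < \<nu> \<bullet> x \<and> \<nu> \<bullet> x \<le> h0 \<and> boundary_proj x \<in> E" for x
    proof -
      have "(h0 / (\<nu> \<bullet> x)) *\<^sub>R x \<in> F \<longleftrightarrow> boundary_proj x \<in> E" if "0 < \<nu> \<bullet> x"
        unfolding F_def using that h0 proj_scale[of "h0 / (\<nu> \<bullet> x)" x] by simp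
      then show ?thesis unfolding Q_def cone_below_def by auto
    qed
    have volQ: "of_nat ?n * emeasure lborel Q = ennreal h0 * hausdorff_outer k F"
      unfolding Q_def k_def by (rule cone_volume_over_hyperplane[OF n\<nu> h0 Fb Fh])
    have Cb: "boundary_cone E \<in> sets borel" by (rule boundary_cone_measurable[OF E(1)])
    have ray: "\<nu> \<bullet> x = g x * (\<nu> \<bullet> boundary_proj x)" for x
      unfolding boundary_proj_def using W.gauge_pos_iff[of x] by (cases "x = 0") auto
    have gpos: "0 < g x" if "boundary_proj x \<in> E" for x
    proof -
      have "g (boundary_proj x) = 1" using that E(2) by auto
      then show ?thesis using W.gauge_pos_iff[of x] W.gauge_0 unfolding boundary_proj_def by auto
    qed
    \<comment> \<open>on each ray the two cones end at distances whose ratio lies between \<open>1 / L\<close> and \<open>L\<close>\<close>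
    have CQ: "(\<lambda>x. L *\<^sub>R x) -` boundary_cone E \<subseteq> Q"
    proof
      fix x assume "x \<in> (\<lambda>x. L *\<^sub>R x) -` boundary_cone E"
      then have x: "L *\<^sub>R x \<in> K" "boundary_proj (L *\<^sub>R x) \<in> E" unfolding boundary_cone_def by auto
      have px: "boundary_proj x \<in> E" using x(2) proj_scale[OF L0] by simp
      have e: "boundary_proj x \<in> ball y0 r" using px E(2) by auto
      have "g (L *\<^sub>R x) \<le> 1" using x(1) by (simp add: K_iff)
      then have gx: "g x \<le> 1 / L" using W.gauge_scale[of L x] L0 by (simp add: field_simps)
      have np: "0 < \<nu> \<bullet> boundary_proj x" using \<nu>x(2)[OF e] h0 by linarith
      have "1 / L * (\<nu> \<bullet> boundary_proj x) \<le> a (boundary_proj x) * (\<nu> \<bullet> boundary_proj x)" using ax(3)[OF e] np by (intro mult_right_mono) auto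
      also have "\<dots> = h0" unfolding a_def using np by simp
      finally have "1 / L * (\<nu> \<bullet> boundary_proj x) \<le> h0" .
      moreover have "g x * (\<nu> \<bullet> boundary_proj x) \<le> 1 / L * (\<nu> \<bullet> boundary_proj x)" using gx np by (intro mult_right_mono) auto
      ultimately have "\<nu> \<bullet> x \<le> h0" unfolding ray[of x] by linarith
      moreover have "0 < \<nu> \<bullet> x" unfolding ray[of x] using gpos[OF px] np by simp
      ultimately show "x \<in> Q" using px Qiff by blast
    qed
    have QC: "(\<lambda>x. L *\<^sub>R x) -` Q \<subseteq> boundary_cone E"
    proof
      fix x assume "x \<in> (\<lambda>x. L *\<^sub>R x) -` Q"
      then have x: "\<nu> \<bullet> (L *\<^sub>R x) \<le> h0" "boundary_proj (L *\<^sub>R x) \<in> E" using Qiff by auto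
      have px: "boundary_proj x \<in> E" using x(2) proj_scale[OF L0] by simp
      have e: "boundary_proj x \<in> ball y0 r" using px E(2) by auto
      have np: "0 < \<nu> \<bullet> boundary_proj x" using \<nu>x(2)[OF e] h0 by linarith
      have "L * (g x * (\<nu> \<bullet> boundary_proj x)) \<le> h0" using x(1) ray[of x] by simp
      then have "L * g x \<le> a (boundary_proj x)" unfolding a_def using np by (simp add: field_simps)
      also have "\<dots> \<le> L * 1" using ax(4)[OF e] by simp
      finally have "g x \<le> 1" using L0 by (simp only: mult_le_cancel_left_pos)
      then show "x \<in> boundary_cone E" using px unfolding boundary_cone_def by (simp add: K_iff)
    qed
    have volC: "emeasure lborel (boundary_cone E) \<le> ennreal (L ^ ?n) * emeasure lborel Q"
      using emeasure_lborel_scale_vimage[OF L0 Cb] emeasure_mono[OF CQ, of lborel] Qb by (simp add: mult_left_mono)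
    have volQ': "emeasure lborel Q \<le> ennreal (L ^ ?n) * emeasure lborel (boundary_cone E)"
      using emeasure_lborel_scale_vimage[OF L0 Qb] emeasure_mono[OF QC, of lborel] Cb by (simp add: mult_left_mono)
    have pw: "ennreal (L ^ ?n) * ennreal (L ^ k) \<le> ennreal (L ^ (2 * ?n))"
    proof -
      have "L ^ ?n * L ^ k \<le> L ^ (2 * ?n)"
        unfolding power_add[symmetric] using L by (intro power_increasing) (auto simp: k_def)
      then show ?thesis using L0 by (simp add: ennreal_mult[symmetric] ennreal_leI)
    qed
    have "of_nat ?n * emeasure lborel (boundary_cone E) \<le> of_nat ?n * (ennreal (L ^ ?n) * emeasure lborel Q)"
      by (rule mult_left_mono[OF volC]) simp
    also have "\<dots> = ennreal (L ^ ?n) * (ennreal h0 * hausdorff_outer k F)"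
      unfolding volQ[symmetric] by (simp only: ac_simps)
    also have "\<dots> \<le> ennreal (L ^ ?n) * (ennreal h0 * (ennreal (L ^ k) * hausdorff_outer k E))"
      by (intro mult_left_mono HF) auto
    also have "\<dots> = (ennreal (L ^ ?n) * ennreal (L ^ k)) * (ennreal h0 * hausdorff_outer k E)" by (simp only: ac_simps)
    also have "\<dots> \<le> ennreal (L ^ (2 * ?n)) * (ennreal h0 * hausdorff_outer k E)" by (intro mult_right_mono pw) auto
    finally have 1: "of_nat ?n * emeasure lborel (boundary_cone E) \<le> \<dots>" .
    have "ennreal h0 * hausdorff_outer k E \<le> ennreal h0 * (ennreal (L ^ k) * hausdorff_outer k F)"
      by (intro mult_left_mono HE) auto
    also have "\<dots> = ennreal (L ^ k) * (of_nat ?n * emeasure lborel Q)" unfolding volQ by (simp only: ac_simps)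
    also have "\<dots> \<le> ennreal (L ^ k) * (of_nat ?n * (ennreal (L ^ ?n) * emeasure lborel (boundary_cone E)))"
      by (intro mult_left_mono volQ') auto
    also have "\<dots> = (ennreal (L ^ ?n) * ennreal (L ^ k)) * (of_nat ?n * emeasure lborel (boundary_cone E))" by (simp only: ac_simps)
    also have "\<dots> \<le> ennreal (L ^ (2 * ?n)) * (of_nat ?n * emeasure lborel (boundary_cone E))" by (intro mult_right_mono pw) auto
    finally have 2: "ennreal h0 * hausdorff_outer k E \<le> \<dots>" .
    show ?thesis using 1 2 by blast
  qed
  show ?thesis
    using r(1) gauss_near meas unfolding h0_def by (intro exI[of _ r]) auto
qed

text \<open>
  Extended by zero, the Gauss map is a Borel function and can be used under integrals.
\<close>
definition normal_part :: "real^'n \<Rightarrow> real^'n" where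
  "normal_part x = indicator (regular_boundary K) x *\<^sub>R gauss_map K x"

lemma normal_part_measurable [measurable]: "normal_part \<in> borel_measurable borel"
  unfolding normal_part_def[abs_def]
  by (rule borel_measurable_continuous_on_indicator[OF regular_boundary_measurable gauss_map_continuous])

lemma normal_part_regular: "x \<in> regular_boundary K \<Longrightarrow> normal_part x = gauss_map K x"
  unfolding normal_part_def by simp

text \<open>
  The cone-volume measure of \<open>K\<close>, multiplied by the dimension.
\<close>
definition cone_measure :: "(real^'n) measure" where
  "cone_measure = distr (density lborel (\<lambda>x. ennreal (real CARD('n) * indicator K x))) borel boundary_proj"

definition support_weighted_hausdorff :: "(real^'n) measure" where
  "support_weighted_hausdorff = density (hausdorff_measure (CARD('n) - 1)) (\<lambda>x. indicator (regular_boundary K) x * ennreal (x \<bullet> normal_part x))"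

lemma sets_cone_measure [simp, measurable_cong]: "sets cone_measure = sets borel"
  unfolding cone_measure_def by simp

lemma sets_support_weighted_hausdorff [simp, measurable_cong]: "sets support_weighted_hausdorff = sets borel"
  unfolding support_weighted_hausdorff_def by simp

lemma emeasure_cone_measure:
  assumes E: "E \<in> sets borel"
  shows "emeasure cone_measure E = of_nat CARD('n) * emeasure lborel (boundary_cone E)"
proof -
  have pE: "boundary_proj -` E \<in> sets borel" using measurable_sets[OF proj_measurable E] by simp
  have "emeasure cone_measure E = (\<integral>\<^sup>+x. ennreal (real CARD('n) * indicator K x) * indicator (boundary_proj -` E) x \<partial>lborel)"
    unfolding cone_measure_def using E pE by (subst emeasure_distr) (simp_all add: emeasure_density)
  also have "\<dots> = (\<integral>\<^sup>+x. of_nat CARD('n) * indicator (boundary_cone E) x \<partial>lborel)"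
    by (rule nn_integral_cong) (auto simp: indicator_def boundary_cone_def ennreal_of_nat_eq_real_of_nat)
  also have "\<dots> = of_nat CARD('n) * emeasure lborel (boundary_cone E)"
    using boundary_cone_measurable[OF E] by (simp add: nn_integral_cmult_indicator)
  finally show ?thesis .
qed

lemma cone_measure_regular:
  assumes E: "E \<in> sets borel"
  shows "emeasure cone_measure E = emeasure cone_measure (E \<inter> regular_boundary K)"
proof -
  have "emeasure lborel (boundary_cone E) = emeasure lborel (boundary_cone (E \<inter> regular_boundary K))"
  proof (rule emeasure_eq_AE)
    show "AE x in lborel. x \<in> boundary_cone E \<longleftrightarrow> x \<in> boundary_cone (E \<inter> regular_boundary K)"
      using AE_proj_regular by eventually_elim (auto simp: boundary_cone_def)
  qed (use E in auto)
  then show ?thesis using E by (simp add: emeasure_cone_measure)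
qed

text \<open>
  The two measures agree up to factors close to one near each regular point, hence they agree on the
  regular boundary. The rest of the space is null for \<open>cone_measure\<close>, as almost all rays hit the boundary
  in a regular point, and for the other measure by definition.
\<close>
theorem cone_measure_eq: "cone_measure = support_weighted_hausdorff"
proof (rule measure_eqI)
  let ?n = "CARD('n)" and ?k = "CARD('n) - 1"
  show "sets cone_measure = sets support_weighted_hausdorff" by simp
  fix E assume "E \<in> sets cone_measure"
  then have E: "E \<in> sets borel" by simp
  define E' where "E' = E \<inter> regular_boundary K"
  have E': "E' \<in> sets borel" "E' \<subseteq> regular_boundary K" unfolding E'_def using E by auto
  have wm [measurable]: "(\<lambda>x. indicator (regular_boundary K) x * ennreal (x \<bullet> normal_part x)) \<in> borel_measurable borel" by measurable
  have swh: "emeasure support_weighted_hausdorff A = (\<integral>\<^sup>+x. indicator (regular_boundary K) x * ennreal (x \<bullet> normal_part x) * indicator A x \<partial>hausdorff_measure ?k)"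
    if "A \<in> sets borel" for A
    unfolding support_weighted_hausdorff_def using that by (intro emeasure_density) auto
  have loc: "\<exists>U. open U \<and> y0 \<in> U \<and> (\<forall>A\<in>sets borel. A \<subseteq> U \<inter> regular_boundary K \<longrightarrow>
       emeasure cone_measure A \<le> ennreal c * emeasure support_weighted_hausdorff A \<and>
       emeasure support_weighted_hausdorff A \<le> ennreal c * emeasure cone_measure A)"
    if c: "1 < c" and y0: "y0 \<in> regular_boundary K" for c y0
  proof -
    \<comment> \<open>\<open>2 n\<close> factors \<open>L\<close> come from the local comparison, one from the variation of \<open>x \<bullet> \<nu> x\<close>\<close>
    define L where "L = c powr (1 / real (2 * ?n + 1))"
    have L: "1 < L" unfolding L_def using c by (simp add: gr_one_powr)
    have Lc: "L ^ (2 * ?n) * L = c"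
    proof -
      have "L ^ (2 * ?n + 1) = L powr real (2 * ?n + 1)" using L by (intro powr_realpow[symmetric]) simp
      also have "\<dots> = c" unfolding L_def powr_powr using c by simp
      finally show ?thesis by (simp add: mult.commute)
    qed
    define h0 where "h0 = h (gauss_map K y0)"
    have h0: "0 < h0" unfolding h0_def using gauss_map_support[OF y0] W.pos by blast
    obtain r where r: "0 < r"
      and near: "\<And>x. x \<in> regular_boundary K \<inter> ball y0 r \<Longrightarrow> h0 \<le> L * (x \<bullet> gauss_map K x) \<and> x \<bullet> gauss_map K x \<le> L * h0"
      and cmp: "\<And>A. A \<in> sets borel \<Longrightarrow> A \<subseteq> ball y0 r \<inter> {x. g x = 1} \<Longrightarrow>
        of_nat ?n * emeasure lborel (boundary_cone A) \<le> ennreal (L ^ (2 * ?n)) * (ennreal h0 * hausdorff_outer ?k A) \<and>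
        ennreal h0 * hausdorff_outer ?k A \<le> ennreal (L ^ (2 * ?n)) * (of_nat ?n * emeasure lborel (boundary_cone A))"
      using cone_measure_locally_almost_hausdorff[OF y0 L] unfolding h0_def by metis
    have cc: "ennreal (L ^ (2 * ?n)) * ennreal L = ennreal c" using Lc L by (simp add: ennreal_mult[symmetric])
    have "emeasure cone_measure A \<le> ennreal c * emeasure support_weighted_hausdorff A \<and>
       emeasure support_weighted_hausdorff A \<le> ennreal c * emeasure cone_measure A"
      if A: "A \<in> sets borel" "A \<subseteq> ball y0 r \<inter> regular_boundary K" for A
    proof -
      note [measurable] = A(1)
      have A': "A \<subseteq> ball y0 r \<inter> {x. g x = 1}" using A(2) regular_boundary_iff by blast
      have HA: "emeasure (hausdorff_measure ?k) A = hausdorff_outer ?k A" by (rule emeasure_hausdorff_measure[OF A(1)])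
      have "emeasure support_weighted_hausdorff A \<le> (\<integral>\<^sup>+x. ennreal (L * h0) * indicator A x \<partial>hausdorff_measure ?k)"
        unfolding swh[OF A(1)]
      proof (rule nn_integral_mono)
        fix x
        show "indicator (regular_boundary K) x * ennreal (x \<bullet> normal_part x) * indicator A x \<le> ennreal (L * h0) * indicator A x"
          using near[of x] A(2) by (auto simp: indicator_def normal_part_regular intro!: ennreal_leI)
      qed
      also have "\<dots> = ennreal L * (ennreal h0 * hausdorff_outer ?k A)"
      proof -
        have "(\<integral>\<^sup>+x. ennreal (L * h0) * indicator A x \<partial>hausdorff_measure ?k) = ennreal (L * h0) * hausdorff_outer ?k A"
          using A(1) HA by (subst nn_integral_cmult_indicator) auto
        then show ?thesis using L h0 by (simp only: ennreal_mult'' mult.assoc less_imp_le)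
      qed
      finally have 1: "emeasure support_weighted_hausdorff A \<le> ennreal L * (ennreal h0 * hausdorff_outer ?k A)" .
      have "ennreal h0 * hausdorff_outer ?k A = (\<integral>\<^sup>+x. ennreal h0 * indicator A x \<partial>hausdorff_measure ?k)"
        using A(1) HA by (simp add: nn_integral_cmult_indicator)
      also have "\<dots> \<le> (\<integral>\<^sup>+x. ennreal L * (indicator (regular_boundary K) x * ennreal (x \<bullet> normal_part x) * indicator A x) \<partial>hausdorff_measure ?k)"
      proof (rule nn_integral_mono)
        fix x
        show "ennreal h0 * indicator A x \<le> ennreal L * (indicator (regular_boundary K) x * ennreal (x \<bullet> normal_part x) * indicator A x)"
        proof (cases "x \<in> A")
          case True
          then have "x \<in> regular_boundary K \<inter> ball y0 r" using A(2) by blast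
          then have x: "x \<in> regular_boundary K" "h0 \<le> L * (x \<bullet> gauss_map K x)" using near[of x] by auto
          then show ?thesis using True L by (simp add: normal_part_regular ennreal_mult'[symmetric] ennreal_leI)
        qed simp
      qed
      also have "\<dots> = ennreal L * emeasure support_weighted_hausdorff A"
        unfolding swh[OF A(1)] using A(1) by (intro nn_integral_cmult) measurable
      finally have 2: "ennreal h0 * hausdorff_outer ?k A \<le> ennreal L * emeasure support_weighted_hausdorff A" .
      note C = cmp[OF A(1) A', folded emeasure_cone_measure[OF A(1)]]
      have "emeasure cone_measure A \<le> ennreal (L ^ (2 * ?n)) * (ennreal L * emeasure support_weighted_hausdorff A)"
        using C by (intro order_trans[OF conjunct1[OF C]] mult_left_mono 2) auto
      moreover have "emeasure support_weighted_hausdorff A \<le> ennreal L * (ennreal (L ^ (2 * ?n)) * emeasure cone_measure A)"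
        by (intro order_trans[OF 1] mult_left_mono conjunct2[OF C]) auto
      moreover have "ennreal (L ^ (2 * ?n)) * (ennreal L * m) = ennreal c * m" for m
        by (simp only: mult.assoc[symmetric] cc)
      moreover have "ennreal L * (ennreal (L ^ (2 * ?n)) * m) = ennreal c * m" for m
        by (simp only: mult.assoc[symmetric] mult.commute[of "ennreal L"] cc)
      ultimately show ?thesis by simp
    qed
    then show ?thesis using r by (intro exI[of _ "ball y0 r"]) auto
  qed
  have "emeasure cone_measure E' \<le> emeasure support_weighted_hausdorff E'"
    by (rule emeasure_le_of_locally_almost_le[where B = "regular_boundary K"]) (use E' loc in \<open>simp_all, meson\<close>)
  moreover have "emeasure support_weighted_hausdorff E' \<le> emeasure cone_measure E'"
    by (rule emeasure_le_of_locally_almost_le[where B = "regular_boundary K"]) (use E' loc in \<open>simp_all, meson\<close>)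
  moreover have "emeasure support_weighted_hausdorff E = emeasure support_weighted_hausdorff E'"
    unfolding swh[OF E] swh[OF E'(1)] by (rule nn_integral_cong) (auto simp: E'_def indicator_def)
  ultimately show "emeasure cone_measure E = emeasure support_weighted_hausdorff E"
    using cone_measure_regular[OF E] unfolding E'_def by simp
qed

end

section \<open>The curvature measure and the variational formula\<close>

context Lp_variation begin

text \<open>
  The density of the curvature measure divided by \<open>x \<bullet> \<nu> x\<close>, which is the density that \<open>cone_measure\<close>
  already contains; this lowers the exponent \<open>1 - p\<close> to \<open>- p\<close>.
\<close>
definition curv_weight :: "real^'n \<Rightarrow> real" where
  "curv_weight x = (x \<bullet> normal_part x) powr (- p) * norm x powr (q - real CARD('n)) * exp (- (norm x)\<^sup>2 / 2)"

lemma curv_weight_measurable [measurable]: "curv_weight \<in> borel_measurable borel"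
  unfolding curv_weight_def[abs_def] by measurable

definition base_normal :: "real^'n" where "base_normal = (SOME v. v \<in> sphere 0 1)"

lemma base_normal: "base_normal \<in> sphere 0 1"
  unfolding base_normal_def by (rule someI_ex) (use sphere_nonempty in blast)

text \<open>
  The curvature measure lives on the sphere, so to describe it as an image measure the Gauss map
  is extended by a constant with values in the sphere.
\<close>
definition total_gauss_map :: "real^'n \<Rightarrow> real^'n" where
  "total_gauss_map x = (if x \<in> regular_boundary K then gauss_map K x else base_normal)"

lemma total_gauss_map_measurable [measurable]:
  "total_gauss_map \<in> measurable borel (restrict_space borel (sphere 0 1))"
proof (rule measurable_restrict_space2)
  show "total_gauss_map \<in> space borel \<rightarrow> sphere 0 1"
    unfolding total_gauss_map_def using gauss_map_support base_normal by auto
  have "total_gauss_map = (\<lambda>x. if x \<in> regular_boundary K then normal_part x else base_normal)"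
    by (auto simp: total_gauss_map_def normal_part_regular)
  then show "total_gauss_map \<in> borel_measurable borel"
    by (simp add: measurable_If_set)
qed

text \<open>
  The set function that defines the curvature measure is recognised as the image of a measure. In particular
  it is countably additive, so that \<open>measure_of\<close> does not collapse to the zero measure.
\<close>
lemma Lp_gauss_dual_curv_eq:
  "Lp_gauss_dual_curv p q K = distr (density cone_measure (\<lambda>x. ennreal (curv_weight x))) (restrict_space borel (sphere 0 1)) total_gauss_map"
    (is "_ = ?N")
proof -
  let ?k = "CARD('n) - 1"
  define \<phi> where "\<phi> = (\<lambda>x. ennreal ((x \<bullet> gauss_map K x) powr (1 - p) * norm x powr (q - real CARD('n)) * exp (- (norm x)\<^sup>2 / 2)))"
  have T: "total_gauss_map \<in> measurable (density cone_measure (\<lambda>x. ennreal (curv_weight x))) (restrict_space borel (sphere 0 1))"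
    using total_gauss_map_measurable by (simp add: measurable_cong_sets[OF _ refl, of "density cone_measure (\<lambda>x. ennreal (curv_weight x))" borel])
  have em: "(\<integral>\<^sup>+x\<in>inverse_gauss_image K \<eta>. \<phi> x \<partial>hausdorff_measure ?k) = emeasure ?N \<eta>"
    if \<eta>: "\<eta> \<in> sets (restrict_space borel (sphere 0 1))" for \<eta>
  proof -
    define A where "A = total_gauss_map -` \<eta>"
    have A [measurable]: "A \<in> sets borel" unfolding A_def using measurable_sets[OF total_gauss_map_measurable \<eta>] by simp
    have "emeasure ?N \<eta> = emeasure (density cone_measure (\<lambda>x. ennreal (curv_weight x))) A"
      using emeasure_distr[OF T \<eta>] sets_eq_imp_space_eq[OF sets_cone_measure] unfolding A_def by simp
    also have "\<dots> = (\<integral>\<^sup>+x. ennreal (curv_weight x) * indicator A x \<partial>cone_measure)"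
      using A by (intro emeasure_density) auto
    also have "\<dots> = (\<integral>\<^sup>+x. indicator (regular_boundary K) x * ennreal (x \<bullet> normal_part x) * (ennreal (curv_weight x) * indicator A x) \<partial>hausdorff_measure ?k)"
      unfolding cone_measure_eq support_weighted_hausdorff_def using A by (intro nn_integral_density) measurable
    also have "\<dots> = (\<integral>\<^sup>+x\<in>inverse_gauss_image K \<eta>. \<phi> x \<partial>hausdorff_measure ?k)"
    proof (rule nn_integral_cong)
      fix x
      show "indicator (regular_boundary K) x * ennreal (x \<bullet> normal_part x) * (ennreal (curv_weight x) * indicator A x) = \<phi> x * indicator (inverse_gauss_image K \<eta>) x"
      proof (cases "x \<in> regular_boundary K")
        case True
        have pos: "0 < x \<bullet> gauss_map K x" using gauss_map_support[OF True] W.pos by metis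
        have "(x \<bullet> gauss_map K x) * (x \<bullet> gauss_map K x) powr (- p) = (x \<bullet> gauss_map K x) powr (1 - p)"
          using pos by (simp add: powr_diff powr_minus divide_inverse)
        then have "(x \<bullet> normal_part x) * curv_weight x = (x \<bullet> gauss_map K x) powr (1 - p) * norm x powr (q - real CARD('n)) * exp (- (norm x)\<^sup>2 / 2)"
          unfolding curv_weight_def normal_part_regular[OF True] by (simp add: mult.assoc[symmetric])
        then have "ennreal (x \<bullet> normal_part x) * ennreal (curv_weight x) = \<phi> x"
          unfolding \<phi>_def using pos normal_part_regular[OF True]
          by (subst ennreal_mult[symmetric]) (auto simp: curv_weight_def)
        moreover have "x \<in> A \<longleftrightarrow> x \<in> inverse_gauss_image K \<eta>"
          unfolding A_def total_gauss_map_def inverse_gauss_image_def using True by simp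
        ultimately show ?thesis using True by (simp add: mult.assoc[symmetric] indicator_def)
      qed (simp add: inverse_gauss_image_def)
    qed
    finally show ?thesis by simp
  qed
  have sub: "sets (restrict_space borel (sphere (0::real^'n) 1)) \<subseteq> Pow (sphere 0 1)"
    using sets.space_closed[of "restrict_space borel (sphere (0::real^'n) 1)"] by (simp add: space_restrict_space)
  have ss: "sigma_sets (sphere 0 1) (sets (restrict_space borel (sphere (0::real^'n) 1))) = sets (restrict_space borel (sphere 0 1))"
    using sets.sigma_sets_eq[of "restrict_space borel (sphere (0::real^'n) 1)"] by (simp add: space_restrict_space)
  have "Lp_gauss_dual_curv p q K = measure_of (sphere 0 1) (sets (restrict_space borel (sphere 0 1))) (emeasure ?N)"
    unfolding Lp_gauss_dual_curv_def \<phi>_def[symmetric]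
    by (rule measure_of_eq[OF sub]) (use em in \<open>simp add: ss \<phi>_def\<close>)
  also have "\<dots> = ?N"
    using measure_of_of_measure[of ?N] by (simp add: space_restrict_space)
  finally show ?thesis .
qed

text \<open>
  Pulled back to \<open>K\<close>, the integral against the curvature measure has the integrand
  of \<open>quermass_derivative\<close>, since \<open>h (\<nu> y) = y \<bullet> \<nu> y\<close> at a regular point \<open>y\<close>.
\<close>
lemma integral_Lp_gauss_dual_curv:
  "(LINT v|Lp_gauss_dual_curv p q K. rpow (f v) p) = (LINT x:K|lborel. radial_density q (boundary_proj x) 1 * boundary_rate (boundary_proj x))"
proof -
  let ?D = "density cone_measure (\<lambda>x. ennreal (curv_weight x))"
  define \<psi> where "\<psi> = (\<lambda>x. rpow (f (total_gauss_map x)) p)"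
  have fm: "(\<lambda>v. rpow (f v) p) \<in> borel_measurable (restrict_space borel (sphere 0 1))"
    by (rule borel_measurable_continuous_on_restrict[OF rpow_f_continuous])
  have [measurable]: "\<psi> \<in> borel_measurable borel"
    using measurable_compose[OF total_gauss_map_measurable fm] unfolding \<psi>_def .
  have T: "total_gauss_map \<in> measurable ?D (restrict_space borel (sphere 0 1))"
    using total_gauss_map_measurable by (simp add: measurable_cong_sets[OF _ refl, of ?D borel])
  have cw0: "0 \<le> curv_weight x" for x unfolding curv_weight_def by simp
  have "(LINT v|Lp_gauss_dual_curv p q K. rpow (f v) p) = (LINT x|?D. \<psi> x)"
    unfolding Lp_gauss_dual_curv_eq \<psi>_def by (rule integral_distr[OF T fm])
  also have "\<dots> = (LINT x|cone_measure. curv_weight x *\<^sub>R \<psi> x)"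
    by (rule integral_density) (auto simp: cw0)
  also have "\<dots> = (LINT x|density lborel (\<lambda>x. ennreal (real CARD('n) * indicator K x)). curv_weight (boundary_proj x) *\<^sub>R \<psi> (boundary_proj x))"
    unfolding cone_measure_def by (rule integral_distr) measurable
  also have "\<dots> = (LINT x|lborel. (real CARD('n) * indicator K x) *\<^sub>R (curv_weight (boundary_proj x) *\<^sub>R \<psi> (boundary_proj x)))"
  proof (rule integral_density)
    show "(\<lambda>x. curv_weight (boundary_proj x) *\<^sub>R \<psi> (boundary_proj x)) \<in> borel_measurable lborel" by measurable
    have "(\<lambda>x. real CARD('n) * indicator K x :: real) \<in> borel_measurable borel"
      by (intro borel_measurable_times borel_measurable_const borel_measurable_indicator K_measurable)
    then show "(\<lambda>x. real CARD('n) * indicator K x :: real) \<in> borel_measurable lborel" by simp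
  qed simp
  also have "\<dots> = (LINT x|lborel. indicator K x *\<^sub>R (radial_density q (boundary_proj x) 1 * boundary_rate (boundary_proj x)))"
  proof (rule integral_cong_AE)
    show "AE x in lborel. (real CARD('n) * indicator K x) *\<^sub>R (curv_weight (boundary_proj x) *\<^sub>R \<psi> (boundary_proj x)) = indicator K x *\<^sub>R (radial_density q (boundary_proj x) 1 * boundary_rate (boundary_proj x))"
      using AE_proj_regular
    proof eventually_elim
      case (elim x)
      define y where "y = boundary_proj x"
      have y: "y \<in> regular_boundary K" using elim unfolding y_def .
      have hn: "y \<bullet> gauss_map K y = h (gauss_map K y)" "0 < h (gauss_map K y)"
        using gauss_map_support[OF y] W.pos by auto
      have "curv_weight y = 1 / h (gauss_map K y) powr p * norm y powr (q - real CARD('n)) * exp (- (norm y)\<^sup>2 / 2)"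
        unfolding curv_weight_def normal_part_regular[OF y] hn(1) by (simp only: powr_minus_divide)
      moreover have "\<psi> y = rpow (f (gauss_map K y)) p"
        unfolding \<psi>_def total_gauss_map_def using y by simp
      moreover have "boundary_rate y = rpow (f (gauss_map K y)) p / h (gauss_map K y) powr p"
        unfolding boundary_rate_def relative_rate_def using y by simp
      moreover have "radial_density q y 1 = real CARD('n) * norm y powr (q - real CARD('n)) * exp (- (norm y)\<^sup>2 / 2)"
        unfolding radial_density_def by simp
      ultimately have "real CARD('n) * (curv_weight y * \<psi> y) = radial_density q y 1 * boundary_rate y"
        by simp
      then show ?case unfolding y_def[symmetric] by simp
    qed
  qed measurable
  finally show ?thesis unfolding set_lebesgue_integral_def .
qed

end

theorem theorem3p1:
  fixes p q :: real and K :: "(real^'n) set" and f :: "real^'n \<Rightarrow> real"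
  assumes "p > 1" and "q > 1"
    and "K \<in> convex_bodies_o"
    and "continuous_on (sphere 0 1) f"
  shows "\<exists>\<delta>>0.
      (\<forall>t\<in>{-\<delta><..<\<delta>}. \<forall>v\<in>sphere 0 1. 0 < support_fun K v powr p + t * rpow (f v) p) \<and>
      ((\<lambda>t. (gauss_dual_quermass q (wulff_shape (Lp_perturbation p K f t))
               - gauss_dual_quermass q K) / t)
         \<longlongrightarrow> (1 / p) * (LINT v|Lp_gauss_dual_curv p q K. rpow (f v) p))
        (at 0 within {-\<delta><..<\<delta>})"
proof -
  interpret Lp_variation K p q f
    using assms by unfold_locales
  obtain \<delta> where \<delta>: "0 < \<delta>" "\<And>t v. \<bar>t\<bar> < \<delta> \<Longrightarrow> v \<in> sphere 0 1 \<Longrightarrow> 0 < 1 + t * relative_rate v"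
    and lim: "((\<lambda>t. (gauss_dual_quermass q (wulff_shape (Lp_perturbation p K f t)) - gauss_dual_quermass q K) / t)
      \<longlongrightarrow> (LINT x:K|lborel. radial_density q (boundary_proj x) 1 * (boundary_rate (boundary_proj x) / p))) (at 0)"
    using quermass_derivative by blast
  have eq: "(LINT x:K|lborel. radial_density q (boundary_proj x) 1 * (boundary_rate (boundary_proj x) / p)) = (1 / p) * (LINT v|Lp_gauss_dual_curv p q K. rpow (f v) p)"
    unfolding integral_Lp_gauss_dual_curv set_lebesgue_integral_def by simp
  show ?thesis
  proof (intro exI[of _ \<delta>] conjI ballI)
    fix t v assume "t \<in> {-\<delta><..<\<delta>}" and v: "v \<in> sphere (0::real^'n) 1"
    then have "0 < 1 + t * relative_rate v" by (intro \<delta>(2)) auto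
    then show "0 < support_fun K v powr p + t * rpow (f v) p"
      unfolding perturbation_base[OF v] using W.pos[OF v] by simp
  next
    show "((\<lambda>t. (gauss_dual_quermass q (wulff_shape (Lp_perturbation p K f t)) - gauss_dual_quermass q K) / t)
         \<longlongrightarrow> (1 / p) * (LINT v|Lp_gauss_dual_curv p q K. rpow (f v) p)) (at 0 within {-\<delta><..<\<delta>})"
      using lim unfolding eq by (rule tendsto_within_subset) simp
  qed (rule \<delta>(1))
qed

end
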